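(* Suppose that $f$ is a transcendental entire function of hyper-order strictly less than $1$, and $a,b,c$ are small entire functions of $f$ such that $f-c$ has finitely many zeros, $\rho(c)<\rho(f)$ and $a\not\equiv b$. If $f'(z)$ and $f(z+1)$ share the set $\{a,b\}$ CM, then $f(z)=c(z)+pe^{\gamma z}$, where $\gamma,p$ are non-zero constants, and one of the following cases holds. (i) $\frac{\gamma}{e^{\gamma}}=1$, $c=0$ and $f'(z)=f(z+1)$. (ii) $\frac{\gamma}{e^{\gamma}}=-1$, $(f-c)'(z)=-[f(z+1)-c(z+1)]$, and $c'(z)+c(z+1)=a(z)+b(z)$.
   Context: Standard Nevanlinna theory notation is used: $T(r,f)$ is the Nevanlinna characteristic. For a meromorphic $f$, $\rho(f)=\limsup_{r\to\infty}\frac{\log^+T(r,f)}{\log r}$ is the order and $\rho_2(f)=\limsup_{r\to\infty}\frac{\log^+\log^+T(r,f)}{\log r}$ is the hyper-order. A meromorphic function $g$ is a small function of $f$ if $T(r,g)=o(T(r,f))$ as $r\to\infty$ outside a possible exceptional set of finite linear measure. For a set $S$ of functions and a meromorphic $F$, let $E(S,F)=\bigcup_{s\in S}\{z: F(z)-s(z)=0\}$, counting multiplicities; $F$ and $G$ share the set $S$ CM if $E(S,F)=E(S,G)$. *)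

theory Defs
  imports "HOL-Complex_Analysis.Complex_Analysis"
begin

definition lnp :: "real \<Rightarrow> real" where
  "lnp x = (if x \<le> 1 then 0 else ln x)"

text \<open>Nevanlinna characteristic of an entire function (no poles, so N(r,f)=0
  and T(r,f) = m(r,f)).\<close>
definition char_T :: "(complex \<Rightarrow> complex) \<Rightarrow> real \<Rightarrow> real" where
  "char_T f r = (1 / (2 * pi)) *
      integral {0..2*pi} (\<lambda>\<theta>. lnp (cmod (f (complex_of_real r * cis \<theta>))))"

definition order_of :: "(complex \<Rightarrow> complex) \<Rightarrow> ereal" where
  "order_of f = Limsup at_top (\<lambda>r. ereal (lnp (char_T f r) / ln r))"

definition hyper_order :: "(complex \<Rightarrow> complex) \<Rightarrow> ereal" where
  "hyper_order f = Limsup at_top (\<lambda>r. ereal (lnp (lnp (char_T f r)) / ln r))"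

definition entire :: "(complex \<Rightarrow> complex) \<Rightarrow> bool" where
  "entire f \<longleftrightarrow> f holomorphic_on UNIV"

definition transcendental_entire :: "(complex \<Rightarrow> complex) \<Rightarrow> bool" where
  "transcendental_entire f \<longleftrightarrow> entire f \<and> \<not> (\<exists>p. \<forall>z. f z = poly p z)"

definition small_fun :: "(complex \<Rightarrow> complex) \<Rightarrow> (complex \<Rightarrow> complex) \<Rightarrow> bool" where
  "small_fun g f \<longleftrightarrow> (\<exists>E. E \<in> sets lborel \<and> emeasure lborel E < \<infinity> \<and>
      (\<forall>\<epsilon>>0. \<exists>R. \<forall>r>R. r \<notin> E \<longrightarrow> \<bar>char_T g r\<bar> \<le> \<epsilon> * char_T f r))"

definition zmult :: "(complex \<Rightarrow> complex) \<Rightarrow> complex \<Rightarrow> enat" where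
  "zmult h z = (if h z \<noteq> 0 then 0
     else if (\<forall>\<^sub>F w in at z. h w = 0) then \<infinity>
     else enat (nat (zorder h z)))"

definition Eset :: "(complex \<Rightarrow> complex) set \<Rightarrow> (complex \<Rightarrow> complex) \<Rightarrow> complex \<Rightarrow> enat" where
  "Eset S F z = (\<Sum>s\<in>S. zmult (\<lambda>w. F w - s w) z)"

definition share_set_CM ::
  "(complex \<Rightarrow> complex) \<Rightarrow> (complex \<Rightarrow> complex) \<Rightarrow> (complex \<Rightarrow> complex) set \<Rightarrow> bool" where
  "share_set_CM F G S \<longleftrightarrow> Eset S F = Eset S G"

end

theory Submission
  imports Defs "HOL-Real_Asymp.Real_Asymp"
begin

text \<open>
  Since \<open>f - c\<close> has finitely many zeros, \<open>f = c + q exp h\<close> with a polynomial \<open>q\<close>, and the growth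
  condition gives \<open>ln T(r, exp h) = o(r)\<close>. With \<open>A = q' + q h'\<close> and
  \<open>B(z) = q(z+1) exp (h(z+1) - h(z))\<close> one has \<open>f' = c' + A exp h\<close> and \<open>f(z+1) = c(z+1) + B exp h\<close>,
  where \<open>A\<close> and \<open>B\<close> are small compared with \<open>exp h\<close>. If \<open>A\<close> and \<open>\<alpha>\<close> are small and nonzero, then
  \<open>A exp h - \<alpha>\<close> has too many zeros to divide a nonzero small function; this follows from logarithmic
  derivative estimates and the Wronskian of \<open>A exp h\<close> and \<open>\<alpha>\<close>. Reducing the shared product modulo
  \<open>A exp h - (a - c')\<close> and its analogues leaves only the possibilities \<open>A = B\<close>, \<open>c' = c(z+1)\<close> and
  \<open>A = -B\<close>, \<open>c' + c(z+1) = a + b\<close>. Then \<open>exp (h(z+1) - h(z)) = \<plusminus> A(z) / q(z+1)\<close> has logarithmic growth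
  \<open>o(r)\<close>, so \<open>h(z+1) - h(z)\<close> is constant, \<open>h'\<close> is bounded, \<open>h\<close> is linear and \<open>q\<close> is constant. In the
  first case \<open>c\<close> has exponential type zero, and \<open>c' = c(z+1)\<close> forces \<open>c = 0\<close>.
\<close>

section \<open>Circle averages and the Poisson formula\<close>

text \<open>The second main theorem is needed only as an obstruction to divisibility, so no counting
  function appears: zeros enter through an entire quotient, and Jensen's formula only through
  inequalities. All growth is measured by \<open>\<tau>\<close>, the characteristic of
  \<open>exp h\<close>, which is monotone because \<open>exp h\<close> has no zeros and at least
  linear because \<open>h\<close> is not constant. Logarithmic derivatives may therefore be as large
  as \<open>exp (\<epsilon> r)\<close>: the logarithm \<open>\<epsilon> r\<close> is negligible
  against \<open>\<tau>\<close>. The obstacle is the shift. Comparing \<open>h(z+1)\<close> with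
  \<open>h(z)\<close> on \<open>|z| = r\<close> costs \<open>\<tau>\<close> at a radius
  \<open>r + 1 + K\<close> with \<open>K\<close> large, so the values of \<open>\<tau>\<close> at
  \<open>r\<close> and \<open>r + 1 + K\<close> must be comparable, and this may fail for many
  \<open>r\<close>, whereas the other estimates hold off sets of finite measure. A contradiction
  needs only arbitrarily large radii, so the argument runs along a filter finer than
  \<open>nev\<close> on which both kinds of estimate hold.\<close>

definition cavg :: "real \<Rightarrow> (complex \<Rightarrow> 'a::euclidean_space) \<Rightarrow> 'a" where
  "cavg r u = (1 / (2 * pi)) *\<^sub>R integral {0..2*pi} (\<lambda>t. u (complex_of_real r * cis t))"

lemma char_T_eq: "char_T f r = cavg r (\<lambda>z. lnp (cmod (f z)))"
  by (simp add: char_T_def cavg_def)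

lemma circle_continuous:
  assumes "continuous_on (sphere 0 r) u" "r \<ge> 0"
  shows "continuous_on {0..2*pi} (\<lambda>t. u (complex_of_real r * cis t))"
  by (rule continuous_on_compose2[OF assms(1)]) (use assms(2) in \<open>auto intro!: continuous_intros simp: norm_mult\<close>)

lemma circle_integrable:
  fixes u :: "complex \<Rightarrow> 'a::euclidean_space"
  assumes "continuous_on (sphere 0 r) u" "r \<ge> 0"
  shows "(\<lambda>t. u (complex_of_real r * cis t)) integrable_on {0..2*pi}"
  by (rule integrable_continuous_interval[OF circle_continuous[OF assms]])

lemma cavg_cong:
  assumes "\<And>z. cmod z = r \<Longrightarrow> u z = v z" "r \<ge> 0"
  shows "cavg r u = cavg r v"
  unfolding cavg_def using assms by (simp add: norm_mult)

lemma cavg_add: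
  fixes u :: "complex \<Rightarrow> 'a::euclidean_space"
  assumes "continuous_on (sphere 0 r) u" "continuous_on (sphere 0 r) v" "r \<ge> 0"
  shows "cavg r (\<lambda>z. u z + v z) = cavg r u + cavg r v"
  unfolding cavg_def
  by (subst integral_add) (use circle_integrable assms in \<open>auto simp: scaleR_add_right\<close>)

lemma cavg_diff:
  fixes u :: "complex \<Rightarrow> 'a::euclidean_space"
  assumes "continuous_on (sphere 0 r) u" "continuous_on (sphere 0 r) v" "r \<ge> 0"
  shows "cavg r (\<lambda>z. u z - v z) = cavg r u - cavg r v"
  unfolding cavg_def
  by (subst integral_diff) (use circle_integrable assms in \<open>auto simp: scaleR_diff_right\<close>)

lemma cavg_const [simp]: "cavg r (\<lambda>z. k) = k"
  unfolding cavg_def by simp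

lemma cavg_cmult:
  fixes u :: "complex \<Rightarrow> real"
  shows "cavg r (\<lambda>z. k * u z) = k * cavg r u"
  unfolding cavg_def by simp

lemma cavg_mono:
  fixes u :: "complex \<Rightarrow> real"
  assumes "continuous_on (sphere 0 r) u" "continuous_on (sphere 0 r) v" "r \<ge> 0"
    and "\<And>z. cmod z = r \<Longrightarrow> u z \<le> v z"
  shows "cavg r u \<le> cavg r v"
proof -
  have "integral {0..2*pi} (\<lambda>t. u (complex_of_real r * cis t)) \<le>
        integral {0..2*pi} (\<lambda>t. v (complex_of_real r * cis t))"
    by (rule integral_le) (use assms in \<open>auto intro!: circle_integrable simp: norm_mult\<close>)
  thus ?thesis by (simp add: cavg_def divide_right_mono)
qed

lemma cavg_norm:
  fixes u :: "complex \<Rightarrow> 'a::euclidean_space"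
  assumes "continuous_on (sphere 0 r) u" "r \<ge> 0"
  shows "norm (cavg r u) \<le> cavg r (\<lambda>z. norm (u z))"
proof -
  have "norm (integral {0..2*pi} (\<lambda>t. u (complex_of_real r * cis t))) \<le>
     integral {0..2*pi} (\<lambda>t. norm (u (complex_of_real r * cis t)))"
    by (rule integral_norm_bound_integral)
       (use circle_integrable[OF assms] circle_integrable[of r "\<lambda>z. norm (u z)"] assms in
         \<open>auto intro!: continuous_intros\<close>)
  thus ?thesis by (simp add: cavg_def divide_right_mono)
qed

lemma cavg_linear:
  fixes u :: "complex \<Rightarrow> 'a::euclidean_space" and L :: "'a \<Rightarrow> 'b::euclidean_space"
  assumes "continuous_on (sphere 0 r) u" "r \<ge> 0" "bounded_linear L"
  shows "cavg r (\<lambda>z. L (u z)) = L (cavg r u)"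
  unfolding cavg_def using integral_linear[OF circle_integrable[OF assms(1,2)] assms(3)]
  by (simp add: o_def linear_scale bounded_linear.linear[OF assms(3)])

lemma cavg_swap:
  fixes K :: "complex \<Rightarrow> complex \<Rightarrow> real"
  assumes "continuous_on (sphere 0 r \<times> sphere 0 \<rho>) (\<lambda>(z, w). K z w)" "r \<ge> 0" "\<rho> \<ge> 0"
  shows "cavg r (\<lambda>z. cavg \<rho> (\<lambda>w. K z w)) = cavg \<rho> (\<lambda>w. cavg r (\<lambda>z. K z w))"
proof -
  have "continuous_on (cbox (0,0) (2*pi,2*pi)) (\<lambda>x. (\<lambda>(z, w). K z w) (complex_of_real r * cis (fst x), complex_of_real \<rho> * cis (snd x)))"
    by (rule continuous_on_compose2[OF assms(1)])
      (use assms in \<open>auto intro!: continuous_intros simp: norm_mult\<close>)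
  hence "continuous_on (cbox (0,0) (2*pi,2*pi)) (\<lambda>(s,t). K (complex_of_real r * cis s) (complex_of_real \<rho> * cis t))"
    by (simp add: case_prod_unfold)
  from integral_swap_continuous[OF this] show ?thesis
    by (simp add: cavg_def cbox_interval)
qed

lemma cavg_continuous:
  fixes K :: "complex \<Rightarrow> complex \<Rightarrow> real"
  assumes "continuous_on (sphere 0 r \<times> sphere 0 \<rho>) (\<lambda>(z, w). K z w)" "r \<ge> 0" "\<rho> \<ge> 0"
  shows "continuous_on (sphere 0 r) (\<lambda>z. cavg \<rho> (\<lambda>w. K z w))"
proof -
  have "continuous_on (sphere 0 r \<times> cbox 0 (2*pi)) (\<lambda>x. (\<lambda>(z, w). K z w) (fst x, complex_of_real \<rho> * cis (snd x)))"
    by (rule continuous_on_compose2[OF assms(1)])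
      (use assms in \<open>auto intro!: continuous_intros simp: norm_mult\<close>)
  hence "continuous_on (sphere 0 r \<times> cbox 0 (2*pi)) (\<lambda>(z,t). K z (complex_of_real \<rho> * cis t))"
    by (simp add: case_prod_unfold)
  from integral_continuous_on_param[OF this] show ?thesis
    unfolding cavg_def by (auto intro!: continuous_intros simp: cbox_interval)
qed

lemma cavg_Cauchy:
  assumes "f holomorphic_on cball 0 \<rho>" "cmod z < \<rho>"
  shows "cavg \<rho> (\<lambda>w. f w * (w / (w - z))) = f z"
proof -
  have "((\<lambda>u. f u/(u-z)) has_contour_integral (2 * of_real pi * \<i> * f z)) (part_circlepath 0 \<rho> 0 (2*pi))"
    using Cauchy_integral_circlepath_simple[OF assms(1), of z] assms(2) by (simp add: circlepath_def)
  hence "((\<lambda>t. f (\<rho> * cis t) / (\<rho> * cis t - z) * \<rho> * \<i> * cis t) has_integral (2 * of_real pi * \<i> * f z)) {0..2*pi}"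
    by (subst (asm) has_contour_integral_part_circlepath_iff) auto
  \<comment> \<open>Multiplying by \<open>-\<i>\<close> cancels the \<open>\<i>\<close> in
    \<open>dw = \<i> w dt\<close>; the factor \<open>w\<close> that remains is why the kernel is
    \<open>w / (w - z)\<close>.\<close>
  from has_integral_mult_right[OF this, of "-\<i>"]
  have "((\<lambda>t. f (\<rho> * cis t) * (\<rho> * cis t / (\<rho> * cis t - z))) has_integral (2 * of_real pi * f z)) {0..2*pi}"
    by (simp add: mult_ac)
  from integral_unique[OF this] show ?thesis
    by (simp add: cavg_def scaleR_conv_of_real)
qed

lemma cavg_mean:
  assumes "f holomorphic_on cball 0 \<rho>" "0 < \<rho>"
  shows "cavg \<rho> f = f 0"
proof -
  have "cavg \<rho> (\<lambda>w. f w * (w / (w - 0))) = cavg \<rho> f"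
    using assms(2) by (intro cavg_cong) auto
  thus ?thesis using cavg_Cauchy[OF assms(1), of 0] assms(2) by simp
qed

lemma cavg_mean_Re:
  assumes "f holomorphic_on cball 0 \<rho>" "0 < \<rho>"
  shows "cavg \<rho> (\<lambda>z. Re (f z)) = Re (f 0)"
proof -
  have "continuous_on (sphere 0 \<rho>) f"
    using holomorphic_on_imp_continuous_on[OF assms(1)] continuous_on_subset by fastforce
  thus ?thesis
    using cavg_linear[of \<rho> f Re, OF _ _ bounded_linear_Re] cavg_mean[OF assms] assms(2) by simp
qed

text \<open>Cauchy's formula for \<open>f\<close> is added to a mean of \<open>cnj f\<close>: on the
  circle \<open>w / (w - z)\<close> is the conjugate of
  \<open>\<rho>^2 / (\<rho>^2 - cnj z * w)\<close>, holomorphic in \<open>w\<close> on the disc with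
  value 1 at 0, so the mean value property yields \<open>cnj (f 0)\<close>.\<close>

lemma Schwarz_formula:
  assumes f: "f holomorphic_on cball 0 \<rho>" and z: "cmod z < \<rho>"
  shows "cavg \<rho> (\<lambda>w. complex_of_real (2 * Re (f w)) * (w / (w - z))) = f z + cnj (f 0)"
proof -
  have \<rho>: "\<rho> > 0" using z norm_ge_zero[of z] by linarith
  have cf: "continuous_on (sphere 0 \<rho>) f"
    using holomorphic_on_imp_continuous_on[OF f] continuous_on_subset by fastforce
  have nz: "w \<noteq> z" if "cmod w = \<rho>" for w using that z by auto
  have nz': "of_real (\<rho>^2) - cnj z * w \<noteq> 0" if "cmod w \<le> \<rho>" for w
  proof
    assume "of_real (\<rho>^2) - cnj z * w = 0"
    hence "of_real (\<rho>^2) = cnj z * w" by simp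
    from arg_cong[OF this, of cmod] have e: "\<rho>^2 = cmod z * cmod w" by (simp add: norm_mult norm_power)
    have "cmod z * cmod w \<le> cmod z * \<rho>" using that by (intro mult_left_mono) auto
    also have "\<dots> < \<rho> * \<rho>" using z \<rho> by simp
    finally show False using e by (simp add: power2_eq_square)
  qed
  have "cavg \<rho> (\<lambda>w. cnj (f w) * (w / (w - z))) =
        cavg \<rho> (\<lambda>w. cnj (f w * (of_real (\<rho>^2) / (of_real (\<rho>^2) - cnj z * w))))"
  proof (rule cavg_cong)
    fix w assume w: "cmod w = \<rho>"
    have ww: "of_real (\<rho>^2) = w * cnj w" using w complex_norm_square[of w] by simp
    have "cnj w \<noteq> 0" using w \<rho> by auto
    hence "w / (w - z) = (w * cnj w) / (w * cnj w - z * cnj w)"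
      using nz[OF w] by (simp add: field_simps)
    thus "cnj (f w) * (w / (w - z)) = cnj (f w * (of_real (\<rho>^2) / (of_real (\<rho>^2) - cnj z * w)))"
      by (simp add: ww mult.commute del: of_real_power)
  qed (use \<rho> in auto)
  also have "\<dots> = cnj (cavg \<rho> (\<lambda>w. f w * (of_real (\<rho>^2) / (of_real (\<rho>^2) - cnj z * w))))"
    by (rule cavg_linear) (use \<rho> nz' cf in \<open>auto intro!: continuous_intros bounded_linear_cnj\<close>)
  also have "cavg \<rho> (\<lambda>w. f w * (of_real (\<rho>^2) / (of_real (\<rho>^2) - cnj z * w))) = f 0"
    by (subst cavg_mean) (use \<rho> nz' f in \<open>auto intro!: holomorphic_intros\<close>)
  finally have 1: "cavg \<rho> (\<lambda>w. cnj (f w) * (w / (w - z))) = cnj (f 0)" .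
  have "cavg \<rho> (\<lambda>w. complex_of_real (2 * Re (f w)) * (w / (w - z))) =
        cavg \<rho> (\<lambda>w. f w * (w / (w - z)) + cnj (f w) * (w / (w - z)))"
    by (intro cavg_cong) (use \<rho> in \<open>simp_all add: complex_add_cnj[symmetric] distrib_right del: of_real_mult times_divide_eq_right\<close>)
  also have "\<dots> = cavg \<rho> (\<lambda>w. f w * (w / (w - z))) + cavg \<rho> (\<lambda>w. cnj (f w) * (w / (w - z)))"
    by (rule cavg_add) (use \<rho> nz cf in \<open>auto intro!: continuous_intros\<close>)
  finally show ?thesis using 1 cavg_Cauchy[OF f z] by simp
qed

text \<open>Real part of the Herglotz kernel, boundary point first. This form is visibly harmonic in
  \<open>z\<close>, which \<open>cavg_poisson\<close> exploits.\<close>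

definition poisson :: "complex \<Rightarrow> complex \<Rightarrow> real" where
  "poisson w z = Re ((w + z) / (w - z))"

lemma poisson_eq: "poisson w z = ((cmod w)\<^sup>2 - (cmod z)\<^sup>2) / (cmod (w - z))\<^sup>2"
  unfolding poisson_def Re_divide' cmod_power2
  by (simp add: power2_eq_square algebra_simps)

lemma poisson_nonneg: "cmod z < cmod w \<Longrightarrow> 0 \<le> poisson w z"
  by (auto simp: poisson_eq intro!: divide_nonneg_nonneg power_mono)

lemma poisson_le:
  assumes "cmod z < cmod w" shows "poisson w z \<le> (cmod w + cmod z) / (cmod w - cmod z)"
proof -
  have "cmod w - cmod z \<le> cmod (w - z)" by norm
  hence "(cmod w - cmod z)\<^sup>2 \<le> (cmod (w - z))\<^sup>2" using assms by (intro power_mono) auto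
  hence "poisson w z \<le> ((cmod w)\<^sup>2 - (cmod z)\<^sup>2) / (cmod w - cmod z)\<^sup>2"
    unfolding poisson_eq using assms by (intro divide_left_mono mult_pos_pos) (auto intro!: power_mono)
  also have "\<dots> = ((cmod w + cmod z) * (cmod w - cmod z)) / ((cmod w - cmod z) * (cmod w - cmod z))"
    by (simp add: power2_eq_square algebra_simps)
  also have "\<dots> = (cmod w + cmod z) / (cmod w - cmod z)"
    using assms by simp
  finally show ?thesis .
qed

lemma Poisson_formula:
  assumes f: "f holomorphic_on cball 0 \<rho>" and z: "cmod z < \<rho>"
  shows "cavg \<rho> (\<lambda>w. Re (f w) * poisson w z) = Re (f z)"
proof -
  have \<rho>: "\<rho> > 0" using z norm_ge_zero[of z] by linarith
  have cf: "continuous_on (sphere 0 \<rho>) f"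
    using holomorphic_on_imp_continuous_on[OF f] continuous_on_subset by fastforce
  have nz: "w \<noteq> z" if "cmod w = \<rho>" for w using that z by auto
  have p: "poisson w z = 2 * Re (w / (w - z)) - 1" if "cmod w = \<rho>" for w
  proof -
    have "(w + z) / (w - z) = 2 * (w / (w - z)) - 1" using nz[OF that] by (simp add: field_simps)
    moreover have "Re (2 * x - 1) = 2 * Re x - 1" for x by simp
    ultimately show ?thesis unfolding poisson_def by metis
  qed
  have "cavg \<rho> (\<lambda>w. Re (f w) * poisson w z) = cavg \<rho> (\<lambda>w. Re (complex_of_real (2 * Re (f w)) * (w / (w - z))) - Re (f w))"
  proof (rule cavg_cong)
    fix w assume "cmod w = \<rho>"
    have "Re (complex_of_real (2 * Re (f w)) * (w / (w - z))) = 2 * Re (f w) * Re (w / (w - z))"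
      by (simp only: times_complex.sel Re_complex_of_real Im_complex_of_real)
    thus "Re (f w) * poisson w z = Re (complex_of_real (2 * Re (f w)) * (w / (w - z))) - Re (f w)"
      using p[OF \<open>cmod w = \<rho>\<close>] by (simp only: right_diff_distrib)
  qed (use \<rho> in auto)
  also have "\<dots> = cavg \<rho> (\<lambda>w. Re (complex_of_real (2 * Re (f w)) * (w / (w - z)))) - cavg \<rho> (\<lambda>w. Re (f w))"
    by (rule cavg_diff) (use \<rho> nz cf in \<open>auto intro!: continuous_intros\<close>)
  also have "cavg \<rho> (\<lambda>w. Re (complex_of_real (2 * Re (f w)) * (w / (w - z)))) = Re (f z + cnj (f 0))"
    unfolding Schwarz_formula[OF f z, symmetric]
    by (rule cavg_linear) (use \<rho> nz cf in \<open>auto intro!: continuous_intros bounded_linear_Re\<close>)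
  also have "cavg \<rho> (\<lambda>w. Re (f w)) = Re (f 0)" by (rule cavg_mean_Re[OF f \<rho>])
  finally show ?thesis by simp
qed

text \<open>The mean of \<open>|Re f|\<close>, not a maximum, stands on the right because for
  \<open>f = h\<close> it is \<open>2 * \<tau> \<rho>\<close> up to a constant
  (\<open>cavg_abs_Re\<close>).\<close>

lemma Schwarz_bound:
  assumes f: "f holomorphic_on cball 0 \<rho>" and z: "cmod z < \<rho>"
  shows "cmod (f z) \<le> cmod (f 0) + 2 * \<rho> / (\<rho> - cmod z) * cavg \<rho> (\<lambda>w. \<bar>Re (f w)\<bar>)"
proof -
  have \<rho>: "\<rho> > 0" using z norm_ge_zero[of z] by linarith
  have cf: "continuous_on (sphere 0 \<rho>) f"
    using holomorphic_on_imp_continuous_on[OF f] continuous_on_subset by fastforce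
  have nz: "w \<noteq> z" if "cmod w = \<rho>" for w using that z by auto
  have "cmod (f z + cnj (f 0)) \<le> cavg \<rho> (\<lambda>w. cmod (complex_of_real (2 * Re (f w)) * (w / (w - z))))"
    unfolding Schwarz_formula[OF f z, symmetric]
    by (rule cavg_norm) (use \<rho> nz cf in \<open>auto intro!: continuous_intros\<close>)
  also have "\<dots> \<le> cavg \<rho> (\<lambda>w. (2 * \<rho> / (\<rho> - cmod z)) * \<bar>Re (f w)\<bar>)"
  proof (rule cavg_mono)
    fix w assume w: "cmod w = \<rho>"
    have "cmod (w / (w - z)) \<le> \<rho> / (\<rho> - cmod z)"
      unfolding norm_divide w using z \<rho> norm_triangle_ineq2[of w z] w
      by (intro divide_left_mono mult_pos_pos) auto
    hence "2 * \<bar>Re (f w)\<bar> * cmod (w / (w - z)) \<le> 2 * \<bar>Re (f w)\<bar> * (\<rho> / (\<rho> - cmod z))"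
      by (intro mult_left_mono) auto
    thus "cmod (complex_of_real (2 * Re (f w)) * (w / (w - z))) \<le> (2 * \<rho> / (\<rho> - cmod z)) * \<bar>Re (f w)\<bar>"
      by (simp add: norm_mult norm_divide mult_ac)
  qed (use z \<rho> nz cf in \<open>auto intro!: continuous_intros\<close>)
  finally have "cmod (f z + cnj (f 0)) \<le> 2 * \<rho> / (\<rho> - cmod z) * cavg \<rho> (\<lambda>w. \<bar>Re (f w)\<bar>)"
    by (simp only: cavg_cmult)
  moreover have "cmod (f z) \<le> cmod (f z + cnj (f 0)) + cmod (f 0)"
    using norm_triangle_ineq4[of "f z + cnj (f 0)" "cnj (f 0)"] by simp
  ultimately show ?thesis by simp
qed

section \<open>The Poisson--Jensen inequality\<close>

lemma lnp_eq: "lnp x = ln (max 1 x)"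
  by (auto simp: lnp_def max_def)

lemma lnp_nonneg [simp]: "0 \<le> lnp x"
  by (simp add: lnp_def)

lemma lnp_mono: "x \<le> y \<Longrightarrow> lnp x \<le> lnp y"
  by (simp add: lnp_eq)

lemma ln_le_lnp: "0 < x \<Longrightarrow> ln x \<le> lnp x"
  by (simp add: lnp_def)

lemma lnp_mult: "0 \<le> x \<Longrightarrow> 0 \<le> y \<Longrightarrow> lnp (x * y) \<le> lnp x + lnp y"
proof -
  assume "0 \<le> x" "0 \<le> y"
  have "max 1 (x * y) \<le> max 1 x * max 1 y"
    using mult_mono[of 1 "max 1 x" 1 "max 1 y"] mult_mono[of x "max 1 x" y "max 1 y"] \<open>0 \<le> x\<close> \<open>0 \<le> y\<close> by simp
  hence "ln (max 1 (x * y)) \<le> ln (max 1 x * max 1 y)" by (subst ln_le_cancel_iff) auto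
  moreover have "max 1 x \<noteq> 0" "max 1 y \<noteq> 0" by (auto simp: max_def)
  ultimately show ?thesis by (simp add: lnp_eq ln_mult)
qed

lemma lnp_add: "lnp (x + y) \<le> lnp x + lnp y + ln 2"
proof -
  have "max 1 (x + y) \<le> max 1 x * max 1 y * 2"
  proof (cases "x \<le> y")
    case True
    have "max 1 (x + y) \<le> 1 * (max 1 y) * 2" using True by (auto simp: max_def)
    also have "\<dots> \<le> max 1 x * max 1 y * 2" by (intro mult_right_mono) auto
    finally show ?thesis .
  next
    case False
    have "max 1 (x + y) \<le> (max 1 x) * 1 * 2" using False by (auto simp: max_def)
    also have "\<dots> \<le> max 1 x * max 1 y * 2" by (intro mult_right_mono mult_left_mono) auto
    finally show ?thesis .
  qed
  hence "ln (max 1 (x + y)) \<le> ln (max 1 x * max 1 y * 2)" by (subst ln_le_cancel_iff) auto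
  moreover have "max 1 x \<noteq> 0" "max 1 y \<noteq> 0" by (auto simp: max_def)
  ultimately show ?thesis by (simp add: lnp_eq ln_mult)
qed

lemma ln_eq_lnp_diff: "0 < x \<Longrightarrow> ln x = lnp x - lnp (1 / x)"
  by (auto simp: lnp_def ln_div divide_simps)

lemma continuous_on_lnp [continuous_intros]:
  "continuous_on S u \<Longrightarrow> continuous_on S (\<lambda>z. lnp (u z))" for u :: "_ \<Rightarrow> real"
  unfolding lnp_eq by (intro continuous_intros) auto

section \<open>Zeros of entire functions and their removal\<close>

lemma entire_continuous: "entire F \<Longrightarrow> continuous_on S F"
  using holomorphic_on_imp_continuous_on holomorphic_on_subset unfolding entire_def by blast

lemma entire_holo: "entire F \<Longrightarrow> F holomorphic_on S"
  using holomorphic_on_subset unfolding entire_def by blast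

lemma entire_open_nonzero: "entire u \<Longrightarrow> open {z. u z \<noteq> 0}"
  using continuous_open_preimage[OF entire_continuous[of u UNIV] open_UNIV, of "- {0}"]
  by (auto simp: vimage_def)

text \<open>\<open>zor_poly F a\<close> and \<open>F z / (z - a) ^ n\<close> agree on a punctured
  disc, so they glue to an entire function. Allowing \<open>n = 0\<close> avoids case distinctions
  on whether \<open>a\<close> is a zero.\<close>

lemma entire_divide_power:
  assumes F: "entire F" "\<exists>z. F z \<noteq> 0"
  obtains n G where "entire G" "G a \<noteq> 0" "\<And>z. F z = (z - a) ^ n * G z"
proof -
  define n where "n = nat (zorder F a)"
  obtain r where r: "r > 0" "zor_poly F a holomorphic_on cball a r"
      "\<And>w. w \<in> cball a r \<Longrightarrow> F w = zor_poly F a w * (w - a) ^ n \<and> zor_poly F a w \<noteq> 0"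
    using zorder_exist_zero[of F UNIV a] F connected_UNIV unfolding entire_def n_def by blast
  define G where "G = (\<lambda>z. if z \<in> ball a r then zor_poly F a z else F z / (z - a) ^ n)"
  have 1: "G holomorphic_on ball a r"
    by (rule holomorphic_transform[of "zor_poly F a"])
       (use r in \<open>auto simp: G_def intro: holomorphic_on_subset\<close>)
  have 2: "G holomorphic_on - {a}"
  proof (rule holomorphic_transform[of "\<lambda>z. F z / (z - a) ^ n"])
    show "(\<lambda>z. F z / (z - a) ^ n) holomorphic_on - {a}"
      using entire_holo[OF F(1)] by (auto intro!: holomorphic_intros)
  qed (use r(3) in \<open>auto simp: G_def\<close>)
  have "G holomorphic_on ball a r \<union> - {a}"
    using 1 2 by (intro holomorphic_on_Un) auto
  moreover have "ball a r \<union> - {a} = UNIV" using r(1) by auto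
  ultimately have "entire G" by (simp add: entire_def)
  moreover have "G a \<noteq> 0" using r by (auto simp: G_def)
  moreover have "F z = (z - a) ^ n * G z" for z
    using r(1) r(3)[of z] by (auto simp: G_def)
  ultimately show ?thesis using that by blast
qed

text \<open>\<open>as\<close> lists zeros with multiplicity; each induction step strips one zero
  completely, so the number of distinct zeros drops. \<open>Z\<close> is a disc in the local
  arguments and the whole plane in \<open>finite_zeros_factor\<close>.\<close>

lemma entire_factor:
  assumes "entire F" "\<exists>z. F z \<noteq> 0" "finite {z \<in> Z. F z = 0}"
  obtains as G where "entire G" "set as \<subseteq> {z \<in> Z. F z = 0}" "{z \<in> Z. F z = 0} \<subseteq> set as" "\<And>z. z \<in> Z \<Longrightarrow> G z \<noteq> 0"
    "\<And>z. F z = prod_list (map (\<lambda>a. z - a) as) * G z"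
proof -
  have "\<exists>as G. entire G \<and> set as \<subseteq> {z \<in> Z. F z = 0} \<and> {z \<in> Z. F z = 0} \<subseteq> set as \<and> (\<forall>z\<in>Z. G z \<noteq> 0) \<and>
     (\<forall>z. F z = prod_list (map (\<lambda>a. z - a) as) * G z)"
    using assms
  proof (induction "card {z \<in> Z. F z = 0}" arbitrary: F)
    case 0
    hence "{z \<in> Z. F z = 0} = {}" by simp
    thus ?case using 0 by (intro exI[of _ "[]"] exI[of _ F]) auto
  next
    case (Suc k)
    from Suc(2) have "{z \<in> Z. F z = 0} \<noteq> {}" by (metis card.empty nat.simps(3))
    then obtain a where a: "a \<in> Z" "F a = 0" by auto
    obtain n G where G: "entire G" "G a \<noteq> 0" "\<And>z. F z = (z - a) ^ n * G z"
      using entire_divide_power[OF Suc(3,4), of a] by blast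
    have n: "n \<noteq> 0" using a(2) G(2) G(3)[of a] by (cases n) auto
    have eq: "{z \<in> Z. F z = 0} = insert a {z \<in> Z. G z = 0}"
      using a G(3) n by auto
    have fin: "finite {z \<in> Z. G z = 0}" using Suc(5) unfolding eq by simp
    have "k = card {z \<in> Z. G z = 0}" using Suc(2) fin G(2) unfolding eq by simp
    from Suc(1)[OF this G(1) _ fin] G(2) obtain as H where H:
       "entire H" "set as \<subseteq> {z \<in> Z. G z = 0}" "{z \<in> Z. G z = 0} \<subseteq> set as" "\<forall>z\<in>Z. H z \<noteq> 0"
       "\<forall>z. G z = prod_list (map (\<lambda>a. z - a) as) * H z" by blast
    show ?case
      by (rule exI[of _ "replicate n a @ as"], rule exI[of _ H])
         (use H n G(3) eq in \<open>auto simp: mult_ac map_replicate_const\<close>)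
  qed
  thus ?thesis using that by blast
qed

lemma entire_finite_zeros:
  assumes "entire F" "\<exists>z. F z \<noteq> 0" "compact K"
  shows "finite {z \<in> K. F z = 0}"
proof (cases "F constant_on UNIV")
  case True
  then obtain k where k: "\<And>z. F z = k" by (auto simp: constant_on_def)
  show ?thesis using k assms by auto
next
  case False
  thus ?thesis
    using holomorphic_compact_finite_zeros[of F UNIV K] assms by (auto simp: entire_def)
qed

text \<open>The first two parts rest on the identity \<open>|\<rho>^2 - cnj a z|^2 - \<rho>^2 |z -
  a|^2 = (\<rho>^2 - |a|^2) (\<rho>^2 - |z|^2)\<close>.\<close>

lemma Blaschke_factor:
  assumes "\<rho> > 0" "cmod a < \<rho>" "cmod z \<le> \<rho>"
  shows "cmod (z - a) \<le> cmod ((of_real (\<rho>^2) - cnj a * z) / of_real \<rho>)"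
    and "cmod z = \<rho> \<Longrightarrow> cmod ((of_real (\<rho>^2) - cnj a * z) / of_real \<rho>) = cmod (z - a)"
    and "of_real (\<rho>^2) - cnj a * z \<noteq> 0"
proof -
  have eq: "(cmod (of_real (\<rho>^2) - cnj a * z))\<^sup>2 - (\<rho> * cmod (z - a))\<^sup>2 = (\<rho>^2 - (cmod a)^2) * (\<rho>^2 - (cmod z)^2)"
    unfolding power_mult_distrib cmod_power2 by (simp add: power2_eq_square algebra_simps)
  have "0 \<le> (\<rho>^2 - (cmod a)^2) * (\<rho>^2 - (cmod z)^2)"
    using assms by (intro mult_nonneg_nonneg) (auto intro: power_mono)
  hence "(\<rho> * cmod (z - a))\<^sup>2 \<le> (cmod (of_real (\<rho>^2) - cnj a * z))\<^sup>2" using eq by linarith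
  hence "\<rho> * cmod (z - a) \<le> cmod (of_real (\<rho>^2) - cnj a * z)"
    using power2_le_imp_le by fastforce
  thus "cmod (z - a) \<le> cmod ((of_real (\<rho>^2) - cnj a * z) / of_real \<rho>)"
    using assms(1) by (simp add: norm_divide field_simps)
  show "cmod ((of_real (\<rho>^2) - cnj a * z) / of_real \<rho>) = cmod (z - a)" if "cmod z = \<rho>"
  proof -
    have "(\<rho> * cmod (z - a))\<^sup>2 = (cmod (of_real (\<rho>^2) - cnj a * z))\<^sup>2" using eq that by simp
    hence "\<rho> * cmod (z - a) = cmod (of_real (\<rho>^2) - cnj a * z)"
      using assms(1) by (subst (asm) power2_eq_iff_nonneg) auto
    thus ?thesis using assms(1) by (simp add: norm_divide field_simps)
  qed
  show "of_real (\<rho>^2) - cnj a * z \<noteq> 0"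
  proof
    assume "of_real (\<rho>^2) - cnj a * z = 0"
    hence "of_real (\<rho>^2) = cnj a * z" by simp
    from arg_cong[OF this, of cmod] have e: "\<rho>^2 = cmod a * cmod z" by (simp add: norm_mult norm_power)
    have "cmod a * cmod z \<le> cmod a * \<rho>" using assms by (intro mult_left_mono) auto
    also have "\<dots> < \<rho> * \<rho>" using assms by simp
    finally show False using e by (simp add: power2_eq_square)
  qed
qed

text \<open>Each \<open>z - a\<close> is exchanged for \<open>(\<rho>^2 - cnj a z) / \<rho>\<close>,
  which has the same modulus on the circle, is no smaller inside, and has no zero in the closed
  disc.\<close>

lemma Blaschke_removal:
  assumes F: "entire F" and nz: "\<And>z. cmod z = \<rho> \<Longrightarrow> F z \<noteq> 0" and \<rho>: "\<rho> > 0"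
  obtains G where "entire G" "\<And>z. cmod z \<le> \<rho> \<Longrightarrow> G z \<noteq> 0" "\<And>z. cmod z \<le> \<rho> \<Longrightarrow> cmod (F z) \<le> cmod (G z)"
    "\<And>z. cmod z = \<rho> \<Longrightarrow> cmod (G z) = cmod (F z)"
proof -
  have "F (of_real \<rho>) \<noteq> 0" using nz \<rho> by simp
  hence ex: "\<exists>z. F z \<noteq> 0" by blast
  obtain as v where v: "entire v" "set as \<subseteq> {z \<in> cball 0 \<rho>. F z = 0}" "\<And>z. z \<in> cball 0 \<rho> \<Longrightarrow> v z \<noteq> 0"
     "\<And>z. F z = prod_list (map (\<lambda>a. z - a) as) * v z"
    by (rule entire_factor[OF F ex entire_finite_zeros[OF F ex compact_cball, of 0 \<rho>]]) blast
  define B where "B = (\<lambda>z a. (of_real (\<rho>^2) - cnj a * z) / complex_of_real \<rho>)"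
  have as: "cmod a < \<rho>" if "a \<in> set as" for a
    using v(2) nz[of a] that by (force simp: less_le)
  define G where "G = (\<lambda>z. prod_list (map (B z) as) * v z)"
  have le: "cmod (prod_list (map (\<lambda>a. z - a) as)) \<le> cmod (prod_list (map (B z) as))" if z: "cmod z \<le> \<rho>" for z
    using as
  proof (induction as)
    case (Cons a as)
    have "cmod (z - a) \<le> cmod (B z a)"
      unfolding B_def by (rule Blaschke_factor(1)[OF \<rho> _ z]) (use Cons in simp)
    thus ?case using Cons by (simp add: norm_mult mult_mono)
  qed simp
  have eq: "cmod (prod_list (map (B z) as)) = cmod (prod_list (map (\<lambda>a. z - a) as))" if z: "cmod z = \<rho>" for z
    using as
  proof (induction as)
    case (Cons a as)
    have "cmod (B z a) = cmod (z - a)"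
      unfolding B_def by (rule Blaschke_factor(2)[OF \<rho> _ _ z]) (use Cons z in simp_all)
    thus ?case using Cons by (simp add: norm_mult)
  qed simp
  have nz: "prod_list (map (B z) as) \<noteq> 0" if z: "cmod z \<le> \<rho>" for z
    using as
  proof (induction as)
    case (Cons a as)
    have "of_real (\<rho>^2) - cnj a * z \<noteq> 0"
      by (rule Blaschke_factor(3)[OF \<rho> _ z]) (use Cons in simp)
    hence "B z a \<noteq> 0" unfolding B_def using \<rho> by simp
    thus ?case using Cons by simp
  qed simp
  have "(\<lambda>z. prod_list (map (B z) as)) holomorphic_on UNIV"
    by (induction as) (auto intro!: holomorphic_intros simp: B_def \<rho>)
  hence 1: "entire G" using v(1) unfolding G_def entire_def by (intro holomorphic_intros)
  have 2: "G z \<noteq> 0" if "cmod z \<le> \<rho>" for z using nz v(3) that by (auto simp: G_def)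
  have 3: "cmod (F z) \<le> cmod (G z)" if "cmod z \<le> \<rho>" for z
    using le[OF that] by (simp add: G_def v(4) norm_mult mult_right_mono)
  have 4: "cmod (G z) = cmod (F z)" if "cmod z = \<rho>" for z
    using eq[OF that] by (simp add: G_def v(4) norm_mult)
  show ?thesis by (rule that[OF 1 2 3 4])
qed

lemma entire_log:
  assumes G: "entire G" and nz: "\<And>z. cmod z \<le> \<rho> \<Longrightarrow> G z \<noteq> 0" and \<rho>: "\<rho> > 0"
  obtains g where "g holomorphic_on cball 0 \<rho>" "\<And>z. cmod z \<le> \<rho> \<Longrightarrow> G z = exp (g z)"
proof -
  have "cball 0 \<rho> \<subseteq> {z. G z \<noteq> 0}" using nz by auto
  from compact_subset_open_imp_ball_epsilon_subset[OF compact_cball entire_open_nonzero[OF G] this]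
  obtain e where e: "e > 0" "(\<Union>x\<in>cball 0 \<rho>. ball x e) \<subseteq> {z. G z \<noteq> 0}" by blast
  have "G z \<noteq> 0" if "z \<in> ball 0 (\<rho> + e)" for z
  proof (cases "cmod z \<le> \<rho>")
    case False
    \<comment> \<open>Radial projection onto the disc: its distance to \<open>z\<close> is
      \<open>cmod z - \<rho> < e\<close>, so \<open>z\<close> lies in the zero-free
      neighbourhood.\<close>
    define x where "x = of_real (\<rho> / cmod z) * z"
    have z0: "cmod z > 0" using False \<rho> by linarith
    have "x \<in> cball 0 \<rho>" using z0 \<rho> by (auto simp: x_def norm_mult norm_divide)
    moreover have "z - x = of_real (1 - \<rho> / cmod z) * z" by (simp add: x_def algebra_simps)
    hence "cmod (z - x) = \<bar>1 - \<rho> / cmod z\<bar> * cmod z" by (simp only: norm_mult norm_of_real)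
    hence "cmod (z - x) = cmod z - \<rho>" using False z0 by (simp add: divide_simps abs_if)
    hence "z \<in> ball x e" using that by (simp add: dist_norm norm_minus_commute)
    ultimately show ?thesis using e(2) by blast
  qed (use nz in auto)
  from contractible_imp_holomorphic_log[OF entire_holo[OF G] convex_imp_contractible[OF convex_ball] this]
  obtain g where g: "g holomorphic_on ball 0 (\<rho> + e)" "\<And>z. z \<in> ball 0 (\<rho> + e) \<Longrightarrow> G z = exp (g z)"
    by blast
  have "cball 0 \<rho> \<subseteq> ball 0 (\<rho> + e)" using e(1) by auto
  hence "g holomorphic_on cball 0 \<rho>" using g(1) holomorphic_on_subset by blast
  moreover have "G z = exp (g z)" if "cmod z \<le> \<rho>" for z using g(2) that e(1) by simp
  ultimately show ?thesis using that by blast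
qed

text \<open>The zero terms of Jensen's formula have a sign and are discarded:
  \<open>|F| \<le> |G|\<close> inside, with equality on the circle, and \<open>ln |G|\<close> is
  harmonic.\<close>

lemma Poisson_Jensen_ineq:
  assumes F: "entire F" and nz: "\<And>z. cmod z = \<rho> \<Longrightarrow> F z \<noteq> 0" and z: "cmod z < \<rho>" "F z \<noteq> 0"
  shows "ln (cmod (F z)) \<le> cavg \<rho> (\<lambda>w. ln (cmod (F w)) * poisson w z)"
proof -
  have \<rho>: "\<rho> > 0" using z(1) norm_ge_zero[of z] by linarith
  obtain G where G: "entire G" "\<And>z. cmod z \<le> \<rho> \<Longrightarrow> G z \<noteq> 0" "\<And>z. cmod z \<le> \<rho> \<Longrightarrow> cmod (F z) \<le> cmod (G z)"
    "\<And>z. cmod z = \<rho> \<Longrightarrow> cmod (G z) = cmod (F z)"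
    using Blaschke_removal[OF F nz \<rho>] by blast
  obtain g where g: "g holomorphic_on cball 0 \<rho>" "\<And>z. cmod z \<le> \<rho> \<Longrightarrow> G z = exp (g z)"
    using entire_log[OF G(1,2) \<rho>] by blast
  have re: "ln (cmod (G z)) = Re (g z)" if "cmod z \<le> \<rho>" for z using g(2)[OF that] by simp
  have "ln (cmod (F z)) \<le> ln (cmod (G z))" using G(2,3)[of z] z by simp
  also have "\<dots> = cavg \<rho> (\<lambda>w. Re (g w) * poisson w z)"
    using re[of z] z Poisson_formula[OF g(1) z(1)] by simp
  also have "\<dots> = cavg \<rho> (\<lambda>w. ln (cmod (F w)) * poisson w z)"
    by (rule cavg_cong) (use re G(4) \<rho> in \<open>simp_all flip: re\<close>)
  finally show ?thesis .
qed

lemma poisson_continuous [continuous_intros]: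
  assumes "continuous_on S u" "continuous_on S v" "\<And>x. x \<in> S \<Longrightarrow> u x \<noteq> v x"
  shows "continuous_on S (\<lambda>x. poisson (u x) (v x))"
  unfolding poisson_def using assms by (auto intro!: continuous_intros)

lemma Poisson_lnp_ineq:
  assumes F: "entire F" and nz: "\<And>z. cmod z = \<rho> \<Longrightarrow> F z \<noteq> 0" and z: "cmod z < \<rho>"
  shows "lnp (cmod (F z)) \<le> cavg \<rho> (\<lambda>w. lnp (cmod (F w)) * poisson w z)"
proof -
  have \<rho>: "\<rho> > 0" using z(1) norm_ge_zero[of z] by linarith
  have ne: "w \<noteq> z" if "cmod w = \<rho>" for w using that z by auto
  have c1: "continuous_on (sphere 0 \<rho>) (\<lambda>w. lnp (cmod (F w)) * poisson w z)"
    using ne z by (auto intro!: continuous_intros entire_continuous F)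
  show ?thesis
  proof (cases "cmod (F z) \<le> 1")
    case True
    have "0 = cavg \<rho> (\<lambda>w. 0::real)" by simp
    also have "\<dots> \<le> cavg \<rho> (\<lambda>w. lnp (cmod (F w)) * poisson w z)"
      by (rule cavg_mono) (use c1 \<rho> z in \<open>auto intro!: mult_nonneg_nonneg poisson_nonneg\<close>)
    finally show ?thesis using True by (simp add: lnp_def)
  next
    case False
    hence "lnp (cmod (F z)) = ln (cmod (F z))" by (simp add: lnp_def)
    also have "\<dots> \<le> cavg \<rho> (\<lambda>w. ln (cmod (F w)) * poisson w z)"
      by (rule Poisson_Jensen_ineq[OF F nz z]) (use False in auto)
    also have "\<dots> \<le> cavg \<rho> (\<lambda>w. lnp (cmod (F w)) * poisson w z)"
    proof (rule cavg_mono)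
      show "continuous_on (sphere 0 \<rho>) (\<lambda>w. ln (cmod (F w)) * poisson w z)"
        using ne nz z by (auto intro!: continuous_intros entire_continuous F)
    qed (use c1 \<rho> z nz in \<open>auto intro!: mult_right_mono poisson_nonneg ln_le_lnp\<close>)
    finally show ?thesis .
  qed
qed

lemma char_T_nonneg: "r \<ge> 0 \<Longrightarrow> entire F \<Longrightarrow> 0 \<le> char_T F r"
  using cavg_mono[of r "\<lambda>z. 0" "\<lambda>z. lnp (cmod (F z))"]
  by (simp add: char_T_eq continuous_on_lnp continuous_on_norm entire_continuous)

lemma lnp_le_char_T:
  assumes F: "entire F" and nz: "\<And>z. cmod z = \<rho> \<Longrightarrow> F z \<noteq> 0" and z: "cmod z < \<rho>"
  shows "lnp (cmod (F z)) \<le> (\<rho> + cmod z) / (\<rho> - cmod z) * char_T F \<rho>"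
proof -
  have \<rho>: "\<rho> > 0" using z(1) norm_ge_zero[of z] by linarith
  have ne: "w \<noteq> z" if "cmod w = \<rho>" for w using that z by auto
  have "lnp (cmod (F z)) \<le> cavg \<rho> (\<lambda>w. lnp (cmod (F w)) * poisson w z)"
    by (rule Poisson_lnp_ineq[OF F nz z])
  also have "\<dots> \<le> cavg \<rho> (\<lambda>w. (\<rho> + cmod z) / (\<rho> - cmod z) * lnp (cmod (F w)))"
  proof (rule cavg_mono)
    fix w assume w: "cmod w = \<rho>"
    have "lnp (cmod (F w)) * poisson w z \<le> lnp (cmod (F w)) * ((\<rho> + cmod z) / (\<rho> - cmod z))"
      using poisson_le[of z w] z w by (intro mult_left_mono) auto
    thus "lnp (cmod (F w)) * poisson w z \<le> (\<rho> + cmod z) / (\<rho> - cmod z) * lnp (cmod (F w))" by (simp add: mult.commute)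
  qed (use ne \<rho> z in \<open>auto intro!: continuous_intros entire_continuous F\<close>)
  finally show ?thesis by (simp only: cavg_cmult char_T_eq)
qed

lemma cavg_poisson:
  assumes "r + cmod s < cmod w" "r > 0"
  shows "cavg r (\<lambda>z. poisson w (z + s)) = poisson w s"
proof -
  have "w - (z + s) \<noteq> 0" if "cmod z \<le> r" for z
  proof
    assume "w - (z + s) = 0"
    hence "w = z + s" by simp
    thus False using norm_triangle_ineq[of z s] assms that by simp
  qed
  hence "(\<lambda>z. (w + (z + s)) / (w - (z + s))) holomorphic_on cball 0 r"
    by (auto intro!: holomorphic_intros)
  from cavg_mean_Re[OF this assms(2)] show ?thesis by (simp add: poisson_def)
qed

text \<open>\<open>Poisson_lnp_ineq\<close> is averaged over the shifted circle and the means are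
  exchanged; the inner mean of the kernel is its value at the centre \<open>s\<close>. For
  \<open>s = 0\<close> the factor is 1, which gives monotonicity of the characteristic.\<close>

lemma char_T_shift:
  assumes F: "entire F" and nz: "\<And>z. cmod z = \<rho> \<Longrightarrow> F z \<noteq> 0" and r: "r > 0" "r + cmod s < \<rho>"
  shows "char_T (\<lambda>z. F (z + s)) r \<le> (\<rho> + cmod s) / (\<rho> - cmod s) * char_T F \<rho>"
proof -
  have \<rho>: "\<rho> > 0" using r norm_ge_zero[of s] by linarith
  have lt: "cmod (z + s) < \<rho>" if "cmod z = r" for z using norm_triangle_ineq[of z s] r that by simp
  hence ne: "w \<noteq> z + s" if "cmod w = \<rho>" "cmod z = r" for w z using that by auto
  have cK: "continuous_on (sphere 0 r \<times> sphere 0 \<rho>) (\<lambda>(z, w). lnp (cmod (F w)) * poisson w (z + s))"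
    using ne by (auto simp: case_prod_unfold intro!: continuous_intros continuous_on_compose2[OF entire_continuous[OF F, of UNIV]])
  have "char_T (\<lambda>z. F (z + s)) r \<le> cavg r (\<lambda>z. cavg \<rho> (\<lambda>w. lnp (cmod (F w)) * poisson w (z + s)))"
    unfolding char_T_eq
  proof (rule cavg_mono)
    show "continuous_on (sphere 0 r) (\<lambda>z. cavg \<rho> (\<lambda>w. lnp (cmod (F w)) * poisson w (z + s)))"
      by (rule cavg_continuous[OF cK]) (use r \<rho> in auto)
  qed (use lt Poisson_lnp_ineq[OF F nz] r in \<open>auto intro!: continuous_intros continuous_on_compose2[OF entire_continuous[OF F, of UNIV]]\<close>)
  also have "\<dots> = cavg \<rho> (\<lambda>w. cavg r (\<lambda>z. lnp (cmod (F w)) * poisson w (z + s)))"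
    by (rule cavg_swap[OF cK]) (use r \<rho> in auto)
  also have "\<dots> = cavg \<rho> (\<lambda>w. lnp (cmod (F w)) * poisson w s)"
    by (rule cavg_cong) (use r \<rho> in \<open>auto simp: cavg_cmult cavg_poisson\<close>)
  also have "\<dots> \<le> cavg \<rho> (\<lambda>w. (\<rho> + cmod s) / (\<rho> - cmod s) * lnp (cmod (F w)))"
  proof (rule cavg_mono)
    fix w assume w: "cmod w = \<rho>"
    have "lnp (cmod (F w)) * poisson w s \<le> lnp (cmod (F w)) * ((\<rho> + cmod s) / (\<rho> - cmod s))"
      using poisson_le[of s w] r w by (intro mult_left_mono) auto
    thus "lnp (cmod (F w)) * poisson w s \<le> (\<rho> + cmod s) / (\<rho> - cmod s) * lnp (cmod (F w))" by (simp add: mult.commute)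
  next
    have "w \<noteq> s" if "cmod w = \<rho>" for w using that r by auto
    thus "continuous_on (sphere 0 \<rho>) (\<lambda>w. lnp (cmod (F w)) * poisson w s)"
      using r by (auto intro!: continuous_intros entire_continuous F)
  qed (use \<rho> r in \<open>auto intro!: continuous_intros entire_continuous F\<close>)
  finally show ?thesis by (simp only: cavg_cmult char_T_eq)
qed

text \<open>A zero at the origin is divided out; for \<open>r \<ge> 1\<close> the factor
  \<open>r ^ n\<close> only helps. This does the work of the first main theorem: it controls
  \<open>m(r, 1/u)\<close>, and also the mean of \<open>ln |\<kappa>|\<close> for an entire quotient
  of unknown growth.\<close>

lemma Jensen_lower:
  assumes F: "entire F" "\<exists>z. F z \<noteq> 0"
  obtains C where "\<And>r. r \<ge> 1 \<Longrightarrow> (\<And>z. cmod z = r \<Longrightarrow> F z \<noteq> 0) \<Longrightarrow> cavg r (\<lambda>z. ln (cmod (F z))) \<ge> C"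
proof -
  obtain n G where G: "entire G" "G 0 \<noteq> 0" "\<And>z. F z = (z - 0) ^ n * G z"
    using entire_divide_power[OF F, of 0] by blast
  have "cavg r (\<lambda>z. ln (cmod (F z))) \<ge> ln (cmod (G 0))" if r: "r \<ge> 1" and nz: "\<And>z. cmod z = r \<Longrightarrow> F z \<noteq> 0" for r
  proof -
    have nzG: "G z \<noteq> 0" if "cmod z = r" for z using nz[OF that] G(3) by auto
    have "ln (cmod (G 0)) \<le> cavg r (\<lambda>w. ln (cmod (G w)) * poisson w 0)"
      by (rule Poisson_Jensen_ineq) (use nzG r G in auto)
    also have "\<dots> = cavg r (\<lambda>w. ln (cmod (G w)))"
      by (rule cavg_cong) (use r in \<open>auto simp: poisson_def\<close>)
    also have "\<dots> \<le> cavg r (\<lambda>w. ln (cmod (F w)))"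
    proof (rule cavg_mono)
      fix z assume z: "cmod z = r"
      have "cmod (F z) = r ^ n * cmod (G z)" using G(3) z by (simp add: norm_mult norm_power)
      also have "\<dots> \<ge> 1 * cmod (G z)" using r by (intro mult_right_mono) auto
      finally show "ln (cmod (G z)) \<le> ln (cmod (F z))" using nzG[OF z] nz[OF z] by simp
    qed (use r nz nzG in \<open>auto intro!: continuous_intros entire_continuous F G\<close>)
    finally show ?thesis .
  qed
  thus ?thesis using that by blast
qed

text \<open>The Poisson kernel has mean 1 and its numerator is constant on the circle.\<close>

lemma cavg_inverse_square:
  assumes "r > 0" "r < cmod w"
  shows "cavg r (\<lambda>z. 1 / (cmod (w - z))\<^sup>2) = 1 / ((cmod w)\<^sup>2 - r\<^sup>2)"
proof -
  have pos: "(cmod w)\<^sup>2 - r\<^sup>2 > 0" using assms by (simp add: power_strict_mono)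
  have "cavg r (\<lambda>z. poisson w z) = 1"
    using cavg_poisson[of r 0 w] assms by (auto simp: poisson_def)
  moreover have "cavg r (\<lambda>z. poisson w z) = cavg r (\<lambda>z. ((cmod w)\<^sup>2 - r\<^sup>2) * (1 / (cmod (w - z))\<^sup>2))"
    by (rule cavg_cong) (use assms in \<open>auto simp: poisson_eq\<close>)
  ultimately show ?thesis using pos by (simp only: cavg_cmult) (simp add: field_simps)
qed

text \<open>The two Schwarz kernels differ by \<open>w / ((w - 1 - z) (w - z))\<close>. By
  \<open>2 x y \<le> x^2 + y^2\<close> this splits into inverse squares of distances, whose means
  over \<open>|z| = r\<close> are explicit, so only one power of the gap
  \<open>\<rho> - 1 - r\<close> is lost. A large gap later makes the shift difference small.\<close>

lemma cavg_difference_le: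
  assumes h: "entire h" and r: "r \<ge> 1" "r + 1 < \<rho>"
  shows "cavg r (\<lambda>z. cmod (h (z + 1) - h z)) \<le> 2 / (\<rho> - 1 - r) * cavg \<rho> (\<lambda>w. \<bar>Re (h w)\<bar>)"
proof -
  define K where "K = (\<lambda>z w. \<bar>Re (h w)\<bar> * (\<rho> * (1 / (cmod (w - 1 - z))\<^sup>2 + 1 / (cmod (w - z))\<^sup>2)))"
  have \<rho>: "\<rho> > 0" using r by linarith
  have ne: "w \<noteq> z" "w - 1 - z \<noteq> 0" if "cmod w = \<rho>" "cmod z = r" for w z
  proof -
    show "w \<noteq> z" using that r by auto
    show "w - 1 - z \<noteq> 0"
    proof
      assume "w - 1 - z = 0"
      hence "w = z + 1" by (simp add: algebra_simps)
      thus False using norm_triangle_ineq[of z 1] that r by simp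
    qed
  qed
  have ch: "continuous_on S h" for S by (rule entire_continuous[OF h])
  have cK: "continuous_on (sphere 0 r \<times> sphere 0 \<rho>) (\<lambda>(z, w). K z w)"
    unfolding K_def using ne by (auto simp: case_prod_unfold intro!: continuous_intros continuous_on_compose2[OF ch[of UNIV]])
  have "cavg r (\<lambda>z. cmod (h (z + 1) - h z)) \<le> cavg r (\<lambda>z. cavg \<rho> (\<lambda>w. K z w))"
  proof (rule cavg_mono)
    fix z assume z: "cmod z = r"
    have z1: "cmod (z + 1) < \<rho>" using norm_triangle_ineq[of z 1] z r by simp
    have ne': "w \<noteq> z" "w - z - 1 \<noteq> 0" "w - (z + 1) \<noteq> 0" if "cmod w = \<rho>" for w using ne[OF that z] by (auto simp: algebra_simps)
    have "h (z + 1) - h z = (h (z + 1) + cnj (h 0)) - (h z + cnj (h 0))" by simp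
    also have "\<dots> = cavg \<rho> (\<lambda>w. complex_of_real (2 * Re (h w)) * (w / (w - (z + 1)))) -
        cavg \<rho> (\<lambda>w. complex_of_real (2 * Re (h w)) * (w / (w - z)))"
      using z r z1 by (simp only: Schwarz_formula[OF entire_holo[OF h]])
    also have "\<dots> = cavg \<rho> (\<lambda>w. complex_of_real (2 * Re (h w)) * (w / (w - (z + 1))) - complex_of_real (2 * Re (h w)) * (w / (w - z)))"
      by (rule cavg_diff[symmetric]) (use ne' \<rho> in \<open>auto intro!: continuous_intros ch\<close>)
    finally have "cmod (h (z + 1) - h z) \<le> cavg \<rho> (\<lambda>w. cmod (complex_of_real (2 * Re (h w)) * (w / (w - (z + 1))) - complex_of_real (2 * Re (h w)) * (w / (w - z))))"
      by (simp only:) (rule cavg_norm, use ne' \<rho> in \<open>auto intro!: continuous_intros ch\<close>)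
    also have "\<dots> \<le> cavg \<rho> (\<lambda>w. K z w)"
    proof (rule cavg_mono)
      fix w assume w: "cmod w = \<rho>"
      have "complex_of_real (2 * Re (h w)) * (w / (w - (z + 1))) - complex_of_real (2 * Re (h w)) * (w / (w - z)) =
         complex_of_real (2 * Re (h w)) * (w / ((w - 1 - z) * (w - z)))"
      proof -
        have "w / p - w / (p + 1) = w / (p * (p + 1))" if "p \<noteq> 0" "p + 1 \<noteq> 0" for p :: complex
          using that by (simp add: divide_simps) (simp add: algebra_simps)
        from this[of "w - 1 - z"] have "w / (w - (z + 1)) - w / (w - z) = w / ((w - 1 - z) * (w - z))"
          using ne[OF w z] by (simp add: diff_diff_eq add.commute)
        thus ?thesis by (metis right_diff_distrib)
      qed
      hence "cmod (complex_of_real (2 * Re (h w)) * (w / (w - (z + 1))) - complex_of_real (2 * Re (h w)) * (w / (w - z))) =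
         \<bar>Re (h w)\<bar> * (\<rho> * (2 * (1 / cmod (w - 1 - z)) * (1 / cmod (w - z))))"
        using w by (simp add: norm_mult norm_divide)
      also have "\<dots> \<le> K z w"
        unfolding K_def using \<rho> sum_squares_bound[of "1 / cmod (w - 1 - z)" "1 / cmod (w - z)"]
        by (intro mult_left_mono) (auto simp: power_divide)
      finally show "cmod (complex_of_real (2 * Re (h w)) * (w / (w - (z + 1))) - complex_of_real (2 * Re (h w)) * (w / (w - z))) \<le> K z w" .
    next
      show "continuous_on (sphere 0 \<rho>) (K z)"
        unfolding K_def using ne[OF _ z] by (auto intro!: continuous_intros ch)
    qed (use ne' z \<rho> in \<open>auto intro!: continuous_intros ch\<close>)
    finally show "cmod (h (z + 1) - h z) \<le> cavg \<rho> (\<lambda>w. K z w)" .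
  next
    show "continuous_on (sphere 0 r) (\<lambda>z. cavg \<rho> (\<lambda>w. K z w))"
      by (rule cavg_continuous[OF cK]) (use r \<rho> in auto)
  qed (use r in \<open>auto intro!: continuous_intros continuous_on_compose2[OF ch[of UNIV]]\<close>)
  also have "\<dots> = cavg \<rho> (\<lambda>w. cavg r (\<lambda>z. K z w))"
    by (rule cavg_swap[OF cK]) (use r \<rho> in auto)
  also have "\<dots> \<le> cavg \<rho> (\<lambda>w. 2 / (\<rho> - 1 - r) * \<bar>Re (h w)\<bar>)"
  proof (rule cavg_mono)
    fix w assume w: "cmod w = \<rho>"
    have w1: "\<rho> - 1 \<le> cmod (w - 1)" using norm_triangle_ineq2[of w 1] w by simp
    have sq: "(\<rho> - 1)\<^sup>2 \<le> (cmod (w - 1))\<^sup>2" "(\<rho> - 1)\<^sup>2 \<le> \<rho>\<^sup>2" using w1 r by (auto intro!: power_mono)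
    have pos: "(\<rho> - 1 - r) * (\<rho> - 1 + r) > 0" using r by (intro mult_pos_pos) auto
    have sq': "(\<rho> - 1)\<^sup>2 - r\<^sup>2 = (\<rho> - 1 - r) * (\<rho> - 1 + r)" by (simp add: power2_eq_square algebra_simps)
    have "cavg r (\<lambda>z. K z w) = \<bar>Re (h w)\<bar> * (\<rho> * cavg r (\<lambda>z. 1 / (cmod (w - 1 - z))\<^sup>2 + 1 / (cmod (w - z))\<^sup>2))"
      unfolding K_def by (simp only: cavg_cmult)
    also have "cavg r (\<lambda>z. 1 / (cmod (w - 1 - z))\<^sup>2 + 1 / (cmod (w - z))\<^sup>2) =
       1 / ((cmod (w - 1))\<^sup>2 - r\<^sup>2) + 1 / ((cmod w)\<^sup>2 - r\<^sup>2)"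
      by (subst cavg_add) (use r w1 w ne in \<open>auto simp: cavg_inverse_square intro!: continuous_intros\<close>)
    also have "\<dots> \<le> 1 / ((\<rho> - 1)\<^sup>2 - r\<^sup>2) + 1 / ((\<rho> - 1)\<^sup>2 - r\<^sup>2)"
      using sq pos sq' w by (intro add_mono divide_left_mono mult_pos_pos) auto
    also have "\<dots> = 2 / ((\<rho> - 1 - r) * (\<rho> - 1 + r))" unfolding sq' by simp
    finally have "cavg r (\<lambda>z. K z w) \<le> \<bar>Re (h w)\<bar> * (\<rho> * (2 / ((\<rho> - 1 - r) * (\<rho> - 1 + r))))"
      using \<rho> by (simp add: mult_left_mono)
    also have "\<rho> * (2 / ((\<rho> - 1 - r) * (\<rho> - 1 + r))) = 2 / (\<rho> - 1 - r) * (\<rho> / (\<rho> - 1 + r))"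
      by (simp add: mult.commute)
    \<comment> \<open>\<open>r \<ge> 1\<close> makes the factor
      \<open>\<rho> / (\<rho> - 1 + r)\<close> at most 1.\<close>
    also have "\<bar>Re (h w)\<bar> * \<dots> \<le> \<bar>Re (h w)\<bar> * (2 / (\<rho> - 1 - r) * 1)"
      using r by (intro mult_left_mono) auto
    finally show "cavg r (\<lambda>z. K z w) \<le> 2 / (\<rho> - 1 - r) * \<bar>Re (h w)\<bar>" by (simp add: mult.commute)
  next
    have "prod.swap ` (sphere (0::complex) \<rho> \<times> sphere (0::complex) r) \<subseteq> sphere 0 r \<times> sphere 0 \<rho>" by auto
    from continuous_on_compose2[OF cK continuous_on_swap this]
    have "continuous_on (sphere 0 \<rho> \<times> sphere 0 r) (\<lambda>(w, z). K z w)"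
      by (simp add: case_prod_unfold)
    thus "continuous_on (sphere 0 \<rho>) (\<lambda>w. cavg r (\<lambda>z. K z w))"
      by (rule cavg_continuous) (use r \<rho> in auto)
  qed (use r \<rho> in \<open>auto intro!: continuous_intros ch\<close>)
  finally show ?thesis by (simp only: cavg_cmult)
qed

section \<open>Logarithmic derivatives\<close>

text \<open>The exceptional-set quantifier of \<open>small_fun\<close> as a filter, so that unions
  of exceptional sets are absorbed by \<open>eventually_elim\<close>.\<close>

definition nev :: "real filter" where
  "nev = Abs_filter (\<lambda>P. \<exists>E\<in>sets lborel. emeasure lborel E < \<infinity> \<and> (\<exists>R. \<forall>r>R. r \<notin> E \<longrightarrow> P r))"

lemma eventually_nev:
  "eventually P nev \<longleftrightarrow> (\<exists>E\<in>sets lborel. emeasure lborel E < \<infinity> \<and> (\<exists>R. \<forall>r>R. r \<notin> E \<longrightarrow> P r))"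
  unfolding nev_def
proof (rule eventually_Abs_filter, rule is_filter.intro, goal_cases)
  case 1 show ?case by (intro bexI[of _ "{}"]) auto
next
  case (2 P Q)
  then obtain E R E' R' where E: "E \<in> sets lborel" "emeasure lborel E < \<infinity>" "\<forall>r>R. r \<notin> E \<longrightarrow> P r"
    and E': "E' \<in> sets lborel" "emeasure lborel E' < \<infinity>" "\<forall>r>R'. r \<notin> E' \<longrightarrow> Q r" by blast
  have "emeasure lborel (E \<union> E') \<le> emeasure lborel E + emeasure lborel E'"
    using E(1) E'(1) by (rule emeasure_subadditive)
  also have "\<dots> < \<infinity>" using E(2) E'(2) by simp
  finally have "emeasure lborel (E \<union> E') < \<infinity>" .
  moreover have "\<forall>r>max R R'. r \<notin> E \<union> E' \<longrightarrow> P r \<and> Q r" using E(3) E'(3) by simp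
  moreover have "E \<union> E' \<in> sets lborel" using E(1) E'(1) by (rule sets.Un)
  ultimately show ?case by blast
next
  case (3 P Q) thus ?case by blast
qed

lemma nev_le_at_top: "nev \<le> at_top"
proof (rule filter_leI)
  fix P :: "real \<Rightarrow> bool" assume "eventually P at_top"
  thus "eventually P nev"
    unfolding eventually_nev eventually_at_top_dense by (intro bexI[of _ "{}"]) auto
qed

lemma nev_at_topI: "eventually P at_top \<Longrightarrow> eventually P nev"
  using nev_le_at_top filter_leD by blast

text \<open>Far out the exceptional set has measure below 1 and contains no interval of length 1.
  This leads from most radii to all large radii for monotone quantities.\<close>

lemma nev_imp_at_top:
  assumes "eventually P nev"
  shows "\<forall>\<^sub>F s in at_top. \<exists>r\<in>{s..s+1}. P r"
proof -
  obtain E R where E: "E \<in> sets lborel" "emeasure lborel E < \<infinity>" and R: "\<And>r. r > R \<Longrightarrow> r \<notin> E \<Longrightarrow> P r"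
    using assms unfolding eventually_nev by blast
  define D where "D = (\<lambda>n::nat. E \<inter> {real n..})"
  have "(\<lambda>n. emeasure lborel (D n)) \<longlonglongrightarrow> emeasure lborel (\<Inter>n. D n)"
  proof (rule Lim_emeasure_decseq)
    show "range D \<subseteq> sets lborel" using E by (auto simp: D_def)
    show "decseq D" by (auto simp: D_def decseq_def)
    show "emeasure lborel (D n) \<noteq> \<infinity>" for n
      using emeasure_mono[of "D n" E lborel] E by (auto simp: D_def top_unique)
  qed
  moreover have "(\<Inter>n. D n) = {}"
  proof -
    have "x \<notin> D (nat \<lceil>x\<rceil> + 1)" for x by (auto simp: D_def) linarith
    thus ?thesis by blast
  qed
  ultimately have "(\<lambda>n. emeasure lborel (D n)) \<longlonglongrightarrow> 0" by simp
  hence "\<forall>\<^sub>F n in sequentially. emeasure lborel (D n) < 1" by (rule order_tendstoD) simp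
  then obtain N where N: "emeasure lborel (D N) < 1" by (auto simp: eventually_sequentially)
  have "\<exists>r\<in>{s..s+1}. P r" if s: "s > max R (real N)" for s
  proof (rule ccontr)
    assume "\<not> (\<exists>r\<in>{s..s+1}. P r)"
    hence "r \<in> E" if "r \<in> {s..s+1}" for r using R[of r] s that by auto
    hence "{s..s+1} \<subseteq> D N" using s by (auto simp: D_def)
    from emeasure_mono[OF this, of lborel] E have "emeasure lborel {s..s+1} \<le> emeasure lborel (D N)"
      by (auto simp: D_def)
    thus False using N by simp
  qed
  thus ?thesis unfolding eventually_at_top_dense by blast
qed

text \<open>The zeros are countable, so their moduli form a null set of radii.\<close>

lemma eventually_nev_nonzero:
  assumes "entire F" "\<exists>z. F z \<noteq> 0"
  shows "\<forall>\<^sub>F r in nev. \<forall>z. cmod z = r \<longrightarrow> F z \<noteq> 0"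
proof -
  define E where "E = cmod ` {z. F z = 0}"
  have "{z. F z = 0} = (\<Union>n. {z \<in> cball 0 (real n). F z = 0})"
    using real_arch_simple by auto
  moreover have "countable (\<Union>n. {z \<in> cball 0 (real n). F z = 0})"
    by (rule countable_UN[OF countableI_type countable_finite]) (rule entire_finite_zeros[OF assms compact_cball])
  ultimately have "countable {z. F z = 0}" by simp
  hence "countable E" by (simp add: E_def)
  hence "E \<in> sets lborel" "emeasure lborel E = 0"
    by (auto simp: emeasure_lborel_countable intro: sets.countable)
  thus ?thesis unfolding eventually_nev E_def by (intro bexI[of _ E]) (auto simp: E_def)
qed

text \<open>\<open>ln (ln M(r, u)) = o(r)\<close>: all that is needed of hyper-order less than 1, and closed under products.\<close>

definition tame :: "(complex \<Rightarrow> complex) \<Rightarrow> bool" where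
  "tame u \<longleftrightarrow> (\<forall>\<eta>>0. \<forall>\<^sub>F r in at_top. \<forall>z. cmod z \<le> r \<longrightarrow> cmod (u z) \<le> exp (exp (\<eta> * r)))"

lemma tameI:
  assumes "\<And>\<eta>. \<eta> > 0 \<Longrightarrow> \<forall>\<^sub>F r in at_top. \<forall>z. cmod z \<le> r \<longrightarrow> cmod (u z) \<le> exp (exp (\<eta> * r))"
  shows "tame u"
  using assms by (auto simp: tame_def)

lemma tameD:
  assumes "tame u" "\<eta> > 0"
  shows "\<forall>\<^sub>F r in at_top. \<forall>z. cmod z \<le> r \<longrightarrow> cmod (u z) \<le> exp (exp (\<eta> * r))"
  using assms by (auto simp: tame_def)

lemma tame_mult:
  assumes "tame u" "tame v" shows "tame (\<lambda>z. u z * v z)"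
proof (rule tameI)
  fix \<eta> :: real assume "\<eta> > 0"
  hence e: "\<eta> / 2 > 0" by simp
  have "\<forall>\<^sub>F r in at_top. 2 * exp (\<eta> / 2 * r) \<le> exp (\<eta> * r)" using \<open>\<eta> > 0\<close> by real_asymp
  with tameD[OF assms(1) e] tameD[OF assms(2) e]
  show "\<forall>\<^sub>F r in at_top. \<forall>z. cmod z \<le> r \<longrightarrow> cmod (u z * v z) \<le> exp (exp (\<eta> * r))"
  proof eventually_elim
    case (elim r)
    show ?case
    proof (intro allI impI)
      fix z assume "cmod z \<le> r"
      hence "cmod (u z * v z) \<le> exp (exp (\<eta>/2 * r)) * exp (exp (\<eta>/2 * r))"
        unfolding norm_mult using elim by (intro mult_mono) auto
      also have "\<dots> = exp (2 * exp (\<eta>/2 * r))" by (simp flip: exp_add)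
      finally show "cmod (u z * v z) \<le> exp (exp (\<eta> * r))" using elim(3) by (meson exp_le_cancel_iff order_trans)
    qed
  qed
qed

lemma tame_add:
  assumes "tame u" "tame v" shows "tame (\<lambda>z. u z + v z)"
proof (rule tameI)
  fix \<eta> :: real assume "\<eta> > 0"
  hence e: "\<eta> / 2 > 0" by simp
  have "\<forall>\<^sub>F r in at_top. 2 * exp (exp (\<eta> / 2 * r)) \<le> exp (exp (\<eta> * r))" using \<open>\<eta> > 0\<close> by real_asymp
  with tameD[OF assms(1) e] tameD[OF assms(2) e]
  show "\<forall>\<^sub>F r in at_top. \<forall>z. cmod z \<le> r \<longrightarrow> cmod (u z + v z) \<le> exp (exp (\<eta> * r))"
  proof eventually_elim
    case (elim r)
    show ?case
    proof (intro allI impI)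
      fix z assume "cmod z \<le> r"
      hence "cmod (u z) + cmod (v z) \<le> 2 * exp (exp (\<eta>/2 * r))" using elim(1,2) by fastforce
      thus "cmod (u z + v z) \<le> exp (exp (\<eta> * r))" using elim(3) norm_triangle_ineq[of "u z" "v z"] by linarith
    qed
  qed
qed

lemma tame_const: "tame (\<lambda>z. k)"
proof (rule tameI)
  fix \<eta> :: real assume "\<eta> > 0"
  hence "\<forall>\<^sub>F r in at_top. cmod k \<le> exp (exp (\<eta> * r))" by real_asymp
  thus "\<forall>\<^sub>F r in at_top. \<forall>z. cmod z \<le> r \<longrightarrow> cmod k \<le> exp (exp (\<eta> * r))"
    by eventually_elim auto
qed

lemma tame_diff: "tame u \<Longrightarrow> tame v \<Longrightarrow> tame (\<lambda>z. u z - v z)"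
  using tame_add[OF _ tame_mult[OF tame_const[of "-1"]], of u v] by simp

text \<open>The slack of 1 in the radius covers both a shift by 1 and Cauchy's estimate on unit
  discs; it is paid for by passing from \<open>\<eta>\<close> to \<open>\<eta> / 2\<close>.\<close>

lemma tame_transfer:
  assumes u: "tame u" and le: "\<And>r z. r \<ge> R \<Longrightarrow> cmod z \<le> r \<Longrightarrow> \<exists>w. cmod w \<le> r + 1 \<and> cmod (v z) \<le> cmod (u w)"
  shows "tame v"
proof (rule tameI)
  fix \<eta> :: real assume "\<eta> > 0"
  hence e: "\<eta> / 2 > 0" by simp
  have 1: "\<forall>\<^sub>F r in at_top. \<forall>z. cmod z \<le> r + 1 \<longrightarrow> cmod (u z) \<le> exp (exp (\<eta> / 2 * (r + 1)))"
    using tameD[OF u e] by (rule eventually_compose_filterlim) real_asymp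
  have "\<forall>\<^sub>F r::real in at_top. r \<ge> max 1 R" by (rule eventually_ge_at_top)
  with 1 show "\<forall>\<^sub>F r in at_top. \<forall>z. cmod z \<le> r \<longrightarrow> cmod (v z) \<le> exp (exp (\<eta> * r))"
  proof eventually_elim
    case (elim r)
    have "\<eta> / 2 * (r + 1) \<le> \<eta> / 2 * (2 * r)" using elim \<open>\<eta> > 0\<close> by (intro mult_left_mono) auto
    hence "exp (exp (\<eta> / 2 * (r + 1))) \<le> exp (exp (\<eta> * r))" by simp
    with elim le[of r] show ?case by (meson max.bounded_iff order_trans)
  qed
qed

lemma tame_shift: "tame u \<Longrightarrow> tame (\<lambda>z. u (z + 1))"
proof (rule tame_transfer[of u 0])
  fix r :: real and z :: complex assume "cmod z \<le> r"
  hence "cmod (z + 1) \<le> r + 1" using norm_triangle_ineq[of z 1] by simp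
  thus "\<exists>w. cmod w \<le> r + 1 \<and> cmod (u (z + 1)) \<le> cmod (u w)" by blast
qed

lemma Cauchy_deriv_bound:
  assumes "f holomorphic_on cball z d" "d > 0" "\<And>w. cmod (w - z) = d \<Longrightarrow> cmod (f w) \<le> B"
  shows "cmod (deriv f z) \<le> B / d"
proof -
  have "cmod ((deriv ^^ 1) f z) \<le> (fact 1 :: real) * B / d ^ 1"
  proof (rule Cauchy_inequality)
    show "f holomorphic_on ball z d" using assms(1) by (rule holomorphic_on_subset) auto
  qed (use assms holomorphic_on_imp_continuous_on in \<open>auto simp: norm_minus_commute\<close>)
  thus ?thesis by simp
qed

lemma deriv_le_nearby:
  assumes "entire u" "cmod z \<le> r"
  shows "\<exists>w. cmod w \<le> r + 1 \<and> cmod (deriv u z) \<le> cmod (u w)"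
proof -
  obtain w where w: "w \<in> sphere z 1" "\<And>y. y \<in> sphere z 1 \<Longrightarrow> cmod (u y) \<le> cmod (u w)"
    using continuous_attains_sup[OF compact_sphere _ continuous_on_norm[OF entire_continuous[OF assms(1), of "sphere z 1"]]]
    by fastforce
  have "cmod (deriv u z) \<le> cmod (u w) / 1"
    by (rule Cauchy_deriv_bound) (use w entire_holo[OF assms(1)] in \<open>auto simp: dist_norm norm_minus_commute\<close>)
  moreover have "cmod w \<le> r + 1"
    using w(1) assms(2) norm_triangle_ineq2[of w z] by (simp add: dist_norm norm_minus_commute)
  ultimately show ?thesis by auto
qed

lemma tame_deriv: "tame u \<Longrightarrow> entire u \<Longrightarrow> tame (deriv u)"
  by (rule tame_transfer[of u 0]) (auto intro: deriv_le_nearby)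

section \<open>Pointwise bounds for the logarithmic derivative\<close>

lemma prod_list_deriv_bound:
  assumes "\<delta> > 0" "\<And>a. a \<in> set as \<Longrightarrow> \<delta> \<le> cmod (z - a)"
  shows "\<exists>D. ((\<lambda>z. prod_list (map (\<lambda>a. z - a) as)) has_field_derivative D) (at z) \<and>
     cmod D \<le> real (length as) / \<delta> * cmod (prod_list (map (\<lambda>a. z - a) as))"
  using assms(2)
proof (induction as)
  case (Cons a as)
  then obtain D where D: "((\<lambda>z. prod_list (map (\<lambda>a. z - a) as)) has_field_derivative D) (at z)"
     "cmod D \<le> real (length as) / \<delta> * cmod (prod_list (map (\<lambda>a. z - a) as))" by auto
  let ?P = "prod_list (map (\<lambda>a. z - a) as)"
  have "((\<lambda>z. (z - a) * prod_list (map (\<lambda>a. z - a) as)) has_field_derivative (?P + (z - a) * D)) (at z)"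
    by (rule derivative_eq_intros D refl | simp)+
  moreover have "cmod (?P + (z - a) * D) \<le> real (length (a # as)) / \<delta> * cmod ((z - a) * ?P)"
  proof -
    have "1 \<le> cmod (z - a) / \<delta>" using Cons(2)[of a] assms(1) by simp
    hence "1 * cmod ?P \<le> cmod (z - a) / \<delta> * cmod ?P" by (intro mult_right_mono) auto
    moreover have "cmod ((z - a) * D) \<le> cmod (z - a) * (real (length as) / \<delta> * cmod ?P)"
      unfolding norm_mult using D(2) by (intro mult_left_mono) auto
    moreover have "cmod (?P + (z - a) * D) \<le> cmod ?P + cmod ((z - a) * D)" by (rule norm_triangle_ineq)
    moreover have "real (length (a # as)) / \<delta> * cmod ((z - a) * ?P) =
       cmod (z - a) / \<delta> * cmod ?P + cmod (z - a) * (real (length as) / \<delta> * cmod ?P)"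
      unfolding norm_mult by (simp add: add_divide_distrib distrib_right)
    ultimately show ?thesis by linarith
  qed
  ultimately show ?case by auto
qed auto

text \<open>Write \<open>u = P v\<close>, where \<open>P\<close> carries the zeros in
  \<open>|z| \<le> 4 s\<close>. On \<open>|z| = 16 s\<close> each factor of \<open>P\<close> is at
  least \<open>12 s\<close>, at 0 at most \<open>4 s\<close>; the ratio 3, with
  \<open>ln 3 \<ge> 1\<close>, bounds the number of zeros by \<open>ln M - ln |u 0|\<close>. Then
  \<open>P' / P\<close> costs \<open>1 / \<delta>\<close> per zero, and \<open>v' / v\<close> is the
  derivative of a logarithm controlled by \<open>Schwarz_bound\<close>. The distance condition
  concerns moduli, so that the exceptional set is one of radii.\<close>

lemma log_deriv_disc:
  assumes u: "entire u" "u 0 \<noteq> 0" and s: "s \<ge> 1" and M: "M \<ge> 1" "\<And>z. cmod z \<le> 16 * s \<Longrightarrow> cmod (u z) \<le> M"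
  defines "L \<equiv> 2 * ln M - ln (cmod (u 0))"
  obtains Z where "finite Z" "real (card Z) \<le> L" "0 \<le> L"
    "\<And>\<delta> z. 0 < \<delta> \<Longrightarrow> cmod z \<le> 2 * s \<Longrightarrow> (\<And>a. a \<in> Z \<Longrightarrow> \<delta> \<le> \<bar>cmod z - cmod a\<bar>) \<Longrightarrow>
       cmod (deriv u z) \<le> (L / \<delta> + 45 * s * L) * cmod (u z)"
proof -
  have ex: "\<exists>z. u z \<noteq> 0" using u(2) by blast
  obtain as v where v: "entire v" "set as \<subseteq> {z \<in> cball 0 (4 * s). u z = 0}" "\<And>z. z \<in> cball 0 (4 * s) \<Longrightarrow> v z \<noteq> 0"
     "\<And>z. u z = prod_list (map (\<lambda>a. z - a) as) * v z"
    by (rule entire_factor[OF u(1) ex entire_finite_zeros[OF u(1) ex compact_cball, of 0 "4 * s"]]) blast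
  define P where "P = (\<lambda>z. prod_list (map (\<lambda>a. z - a) as))"
  define n where "n = length as"
  have as: "cmod a \<le> 4 * s" if "a \<in> set as" for a using v(2) that by auto
  have Plow: "(12 * s) ^ n \<le> cmod (P z)" if "cmod z = 16 * s" for z
    unfolding P_def n_def using as
  proof (induction as)
    case (Cons a as)
    have "12 * s \<le> cmod (z - a)" using norm_triangle_ineq2[of z a] Cons(2)[of a] that by simp
    thus ?case using Cons s by (auto simp: norm_mult intro!: mult_mono)
  qed simp
  have P0: "cmod (P 0) \<le> (4 * s) ^ n"
    unfolding P_def n_def using as
    by (induction as) (use s in \<open>auto simp: norm_mult intro!: mult_mono\<close>)
  have s12: "(12 * s) ^ n > 0" using s by simp
  have vM: "cmod (v z) \<le> M / (12 * s) ^ n" if "cmod z \<le> 16 * s" for z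
  proof (rule maximum_modulus_frontier[of v "cball 0 (16 * s)"])
    fix z :: complex assume "z \<in> frontier (cball 0 (16 * s))"
    hence z: "cmod z = 16 * s" using s by simp
    have "cmod (v z) * (12 * s) ^ n \<le> cmod (v z) * cmod (P z)" using Plow[OF z] by (intro mult_left_mono) auto
    also have "\<dots> = cmod (u z)" using v(4)[of z] by (simp add: P_def norm_mult)
    also have "\<dots> \<le> M" using M(2) z by simp
    finally show "cmod (v z) \<le> M / (12 * s) ^ n" using s12 by (simp add: field_simps)
  next
    show "v holomorphic_on interior (cball 0 (16 * s))" by (rule entire_holo[OF v(1)])
    show "continuous_on (closure (cball 0 (16 * s))) v" by (rule entire_continuous[OF v(1)])
  qed (use that in simp_all)
  have eq: "(12 * s) ^ n = 3 ^ n * (4 * s) ^ n"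
    by (subst power_mult_distrib[symmetric]) simp
  have v0M: "cmod (v 0) \<le> M / (12 * s) ^ n" by (rule vM) (use s in simp)
  have "u 0 = P 0 * v 0" unfolding P_def by (rule v(4))
  hence "cmod (u 0) = cmod (P 0) * cmod (v 0)" by (simp only: norm_mult)
  also have "\<dots> \<le> (4 * s) ^ n * (M / (12 * s) ^ n)"
    using P0 v0M by (rule mult_mono) (use s in simp_all)
  also have "\<dots> = M / 3 ^ n"
    unfolding eq using s by (simp only: times_divide_eq_right) (simp add: mult.commute)
  finally have "cmod (u 0) * 3 ^ n \<le> M" by (simp add: field_simps)
  hence "ln (cmod (u 0) * 3 ^ n) \<le> ln M" using u(2) M(1) by (subst ln_le_cancel_iff) auto
  hence n1: "ln (cmod (u 0)) + real n * ln 3 \<le> ln M" using u(2) by (simp add: ln_mult ln_realpow)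
  have "exp 1 \<le> (3::real)" by (rule exp_le)
  hence "(1::real) \<le> ln 3" by (simp add: ln_ge_iff)
  hence "real n * 1 \<le> real n * ln 3" by (intro mult_left_mono) auto
  hence nL0: "real n \<le> ln M - ln (cmod (u 0))" using n1 by simp
  have lnM: "0 \<le> ln M" using M(1) by simp
  have nL: "real n \<le> L" using nL0 lnM by (simp add: L_def)
  have v0: "v 0 \<noteq> 0" using v(3)[of 0] s by simp
  have "ln (cmod (u 0)) \<le> ln ((4 * s) ^ n * cmod (v 0))"
    using u(2) P0 v0 s unfolding v(4)[of 0] by (subst ln_le_cancel_iff) (auto simp: P_def norm_mult simp del: diff_0 intro!: mult_right_mono)
  hence lnv0: "ln (cmod (u 0)) - real n * ln (4 * s) \<le> ln (cmod (v 0))"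
    using s v0 by (simp add: ln_mult ln_realpow algebra_simps)
  have nzv: "\<And>z. cmod z \<le> 4 * s \<Longrightarrow> v z \<noteq> 0" using v(3) by simp
  have s4: "4 * s > 0" using s by simp
  obtain g0 where g0: "g0 holomorphic_on cball 0 (4 * s)" "\<And>z. cmod z \<le> 4 * s \<Longrightarrow> v z = exp (g0 z)"
    using entire_log[OF v(1) nzv s4] by blast
  \<comment> \<open>Subtracting an imaginary constant makes \<open>g 0\<close> real, so
    \<open>cmod (g 0)\<close> is governed by real parts alone.\<close>
  define g where "g = (\<lambda>z. g0 z - \<i> * of_real (Im (g0 0)))"
  have g: "g holomorphic_on cball 0 (4 * s)" unfolding g_def by (intro holomorphic_intros g0)
  have Reg: "Re (g z) = ln (cmod (v z))" if "cmod z \<le> 4 * s" for z using g0(2)[OF that] by (simp add: g_def)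
  have cg: "continuous_on (sphere 0 (4 * s)) g"
    using holomorphic_on_imp_continuous_on[OF g] continuous_on_subset by fastforce
  have RegM: "Re (g z) \<le> ln M" if "cmod z \<le> 4 * s" for z
  proof -
    have "M / (12 * s) ^ n \<le> M / 1" using s M(1) by (intro divide_left_mono one_le_power) auto
    hence "cmod (v z) \<le> M" using vM[of z] that s by linarith
    hence "ln (cmod (v z)) \<le> ln M" using v(3)[of z] that M(1) by (subst ln_le_cancel_iff) auto
    thus ?thesis using Reg[OF that] by simp
  qed
  \<comment> \<open>\<open>Re g \<le> ln M\<close> and \<open>ln M \<ge> 0\<close> give
    \<open>|Re g| \<le> 2 ln M - Re g\<close>; this is the origin of the 2 in
    \<open>L\<close>.\<close>
  have avg: "cavg (4 * s) (\<lambda>z. \<bar>Re (g z)\<bar>) \<le> 2 * ln M - Re (g 0)"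
  proof -
    have "cavg (4 * s) (\<lambda>z. \<bar>Re (g z)\<bar>) \<le> cavg (4 * s) (\<lambda>z. 2 * ln M - Re (g z))"
      by (rule cavg_mono) (use s cg RegM lnM in \<open>auto intro!: continuous_intros simp: abs_le_iff\<close>)
    also have "\<dots> = 2 * ln M - cavg (4 * s) (\<lambda>z. Re (g z))"
      by (subst cavg_diff) (use s cg in \<open>auto intro!: continuous_intros\<close>)
    also have "cavg (4 * s) (\<lambda>z. Re (g z)) = Re (g 0)" by (rule cavg_mean_Re) (use g s in auto)
    finally show ?thesis .
  qed
  have g00: "cmod (g 0) = \<bar>Re (g 0)\<bar>" by (simp add: cmod_eq_Re g_def)
  have abs0: "\<bar>Re (g 0)\<bar> \<le> cavg (4 * s) (\<lambda>z. \<bar>Re (g z)\<bar>)"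
    using cavg_mean_Re[OF g] cavg_norm[of "4 * s" "\<lambda>z. Re (g z)"] s cg by (auto intro!: continuous_intros)
  \<comment> \<open>The term \<open>ln (4 * s)\<close> is the price of comparing \<open>v 0\<close>
    with \<open>u 0\<close>, one for each of at most \<open>L\<close> zeros.\<close>
  define Q where "Q = L * (1 + ln (4 * s))"
  have ln4s: "0 \<le> ln (4 * s)" using s by simp
  have "2 * ln M - Re (g 0) \<le> L + real n * ln (4 * s)"
    using lnv0 Reg[of 0] s by (simp add: L_def)
  also have "\<dots> \<le> L + L * ln (4 * s)" using nL ln4s by (intro add_mono mult_right_mono) auto
  finally have avgQ: "cavg (4 * s) (\<lambda>z. \<bar>Re (g z)\<bar>) \<le> Q" using avg by (simp add: Q_def algebra_simps)
  have Q0: "0 \<le> Q" using nL ln4s unfolding Q_def by (intro mult_nonneg_nonneg) auto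
  have gQ: "cmod (g z) \<le> 9 * Q" if "cmod z \<le> 3 * s" for z
  proof -
    have "cmod (g z) \<le> cmod (g 0) + 2 * (4 * s) / (4 * s - cmod z) * cavg (4 * s) (\<lambda>w. \<bar>Re (g w)\<bar>)"
      by (rule Schwarz_bound[OF g]) (use that s in auto)
    also have "\<dots> \<le> Q + 8 * Q"
    proof (intro add_mono mult_mono)
      have "2 * (4 * s) / (4 * s - cmod z) \<le> 2 * (4 * s) / s" using that s by (intro divide_left_mono) auto
      thus "2 * (4 * s) / (4 * s - cmod z) \<le> 8" using s by simp
    qed (use g00 abs0 avgQ that s in auto)
    finally show ?thesis by simp
  qed
  have bound: "cmod (deriv u z) \<le> (L / \<delta> + 45 * s * L) * cmod (u z)"
    if \<delta>: "0 < \<delta>" and z: "cmod z \<le> 2 * s" and away: "\<And>a. a \<in> set as \<Longrightarrow> \<delta> \<le> \<bar>cmod z - cmod a\<bar>" for \<delta> z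
  proof -
    have "\<delta> \<le> cmod (z - a)" if "a \<in> set as" for a
      using away[OF that] norm_triangle_ineq3[of z a] by linarith
    from prod_list_deriv_bound[OF \<delta> this] obtain D where
      D: "(P has_field_derivative D) (at z)" "cmod D \<le> real n / \<delta> * cmod (P z)"
      unfolding P_def n_def by blast
    have "g field_differentiable (at z)"
    proof -
      have "z \<in> interior (cball 0 (4 * s))" using z s by simp
      thus ?thesis using g holomorphic_on_imp_differentiable_at[of g "interior (cball 0 (4 * s))"]
        by (meson holomorphic_on_subset interior_subset open_interior)
    qed
    hence dg: "(g has_field_derivative deriv g z) (at z)" by (simp add: DERIV_deriv_iff_field_differentiable)
    \<comment> \<open>The disc of radius \<open>s\<close> about \<open>z\<close> stays in
      \<open>|w| \<le> 3 s\<close>, where \<open>gQ\<close> applies; \<open>s \<ge> 1\<close> then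
      removes the denominator.\<close>
    have g'b: "cmod (deriv g z) \<le> 9 * Q / s"
    proof (rule Cauchy_deriv_bound)
      have sub: "cmod w \<le> 3 * s" if "cmod (w - z) \<le> s" for w
        using norm_triangle_ineq2[of w z] that z by simp
      show "g holomorphic_on cball z s"
        by (rule holomorphic_on_subset[OF g]) (use sub s in \<open>force simp: dist_norm norm_minus_commute\<close>)
      show "cmod (g w) \<le> 9 * Q" if "cmod (w - z) = s" for w using gQ[of w] sub[of w] that by simp
    qed (use s in auto)
    also have "\<dots> \<le> 9 * Q / 1" using s Q0 by (intro divide_left_mono) auto
    finally have g'b: "cmod (deriv g z) \<le> 9 * Q" by simp
    define k where "k = exp (\<i> * of_real (Im (g0 0)))"
    have veq: "v w = k * exp (g w)" if "cmod w < 4 * s" for w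
      using g0(2)[of w] that by (simp add: g_def k_def flip: exp_add)
    have "((\<lambda>w. k * exp (g w)) has_field_derivative (k * (exp (g z) * deriv g z))) (at z)"
      by (rule derivative_eq_intros dg refl | simp)+
    moreover have "\<forall>\<^sub>F w in nhds z. v w = k * exp (g w)"
    proof (rule eventually_nhds_in_open[THEN eventually_mono])
      show "open (ball (0::complex) (4 * s))" by simp
    qed (use z s veq in auto)
    ultimately have dv: "(v has_field_derivative (v z * deriv g z)) (at z)"
      using veq[of z] z s by (subst DERIV_cong_ev[OF refl _ refl]) (auto simp: mult_ac)
    have "((\<lambda>z. P z * v z) has_field_derivative (D * v z + P z * (v z * deriv g z))) (at z)"
      using DERIV_mult[OF D(1) dv] by (simp add: mult_ac add.commute)
    hence "(u has_field_derivative (D * v z + P z * (v z * deriv g z))) (at z)"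
      unfolding P_def by (simp flip: v(4))
    hence "deriv u z = D * v z + P z * (v z * deriv g z)" by (rule DERIV_imp_deriv)
    hence "cmod (deriv u z) \<le> cmod D * cmod (v z) + cmod (P z) * (cmod (v z) * cmod (deriv g z))"
      using norm_triangle_ineq[of "D * v z" "P z * (v z * deriv g z)"] by (simp add: norm_mult)
    also have "\<dots> \<le> (real n / \<delta> * cmod (P z)) * cmod (v z) + cmod (P z) * (cmod (v z) * (9 * Q))"
      using D(2) g'b by (intro add_mono mult_right_mono mult_left_mono) auto
    also have "\<dots> = (real n / \<delta> + 9 * Q) * (cmod (P z) * cmod (v z))" by (simp add: algebra_simps)
    also have "cmod (P z) * cmod (v z) = cmod (u z)" using v(4)[of z] by (simp add: P_def norm_mult)
    also have "(real n / \<delta> + 9 * Q) * cmod (u z) \<le> (L / \<delta> + 45 * s * L) * cmod (u z)"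
    proof (intro mult_right_mono add_mono divide_right_mono)
      have "ln (4 * s) \<le> 4 * s" using ln_bound[of "4 * s"] s by simp
      hence "1 + ln (4 * s) \<le> 5 * s" using s by linarith
      hence "L * (1 + ln (4 * s)) \<le> L * (5 * s)" using nL by (intro mult_left_mono) auto
      thus "9 * Q \<le> 45 * s * L" by (simp add: Q_def algebra_simps)
    qed (use nL \<delta> in auto)
    finally show ?thesis .
  qed
  have "real (card (set as)) \<le> L" using nL card_length[of as] by (simp add: n_def)
  moreover have "0 \<le> L" using nL by simp
  ultimately show ?thesis by (rule that[OF finite_set _ _ bound])
qed

lemma tame_divide_power:
  assumes "tame F" "entire F" "entire G" "\<And>z. F z = (z - 0) ^ n * G z"
  shows "tame G"
proof (rule tame_transfer[of F 1])
  show "tame F" by fact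
  fix r :: real and z :: complex assume r: "1 \<le> r" and z: "cmod z \<le> r"
  have le: "cmod (G w) \<le> cmod (F w)" if "cmod w \<ge> 1" for w
  proof -
    have "1 * cmod (G w) \<le> cmod w ^ n * cmod (G w)" using that by (intro mult_right_mono one_le_power) auto
    thus ?thesis by (simp add: assms(4) norm_mult norm_power)
  qed
  show "\<exists>w. cmod w \<le> r + 1 \<and> cmod (G z) \<le> cmod (F w)"
  proof (cases "cmod z \<ge> 1")
    case True thus ?thesis using le[OF True] z by (intro exI[of _ z]) simp
  next
    \<comment> \<open>Inside the unit disc division by \<open>z ^ n\<close> may enlarge; the maximum
      principle moves to the unit circle, where \<open>|G| = |F|\<close>.\<close>
    case False
    obtain w where w: "w \<in> sphere 0 (1::real)" "\<And>y. y \<in> sphere 0 1 \<Longrightarrow> cmod (G y) \<le> cmod (G w)"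
      using continuous_attains_sup[OF compact_sphere _ continuous_on_norm[OF entire_continuous[OF assms(3), of "sphere 0 1"]]]
      by fastforce
    have "cmod (G z) \<le> cmod (G w)"
    proof (rule maximum_modulus_frontier[of G "cball 0 1"])
      show "G holomorphic_on interior (cball 0 1)" by (rule entire_holo[OF assms(3)])
      show "continuous_on (closure (cball 0 1)) G" by (rule entire_continuous[OF assms(3)])
    qed (use w False in simp_all)
    thus ?thesis using le[of w] w(1) r by (intro exI[of _ w]) simp
  qed
qed

text \<open>\<open>log_deriv_disc\<close> is used with every large integer \<open>s = j\<close>, and
  a radius \<open>r\<close> is served by its integer part. At stage \<open>j\<close> there are at
  most \<open>L j\<close> zeros, and the intervals removed around their moduli have total length
  \<open>O(1 / j^2)\<close>, which is summable.\<close>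

lemma log_deriv_aux:
  assumes u: "entire u" "tame u" "u 0 \<noteq> 0" and \<epsilon>: "\<epsilon> > 0"
  shows "\<forall>\<^sub>F r in nev. \<forall>z. cmod z = r \<longrightarrow> cmod (deriv u z) \<le> exp (\<epsilon> * r) * cmod (u z)"
proof -
  \<comment> \<open>\<open>16 * \<eta> = \<epsilon> / 4\<close>, so \<open>L j ^ 2\<close> is of
    size \<open>exp (\<epsilon> j / 2)\<close> and leaves room below
    \<open>exp (\<epsilon> j)\<close> for the polynomial factors.\<close>
  define \<eta> where "\<eta> = \<epsilon> / 64"
  have \<eta>: "\<eta> > 0" using \<epsilon> by (simp add: \<eta>_def)
  define c where "c = ln (cmod (u 0))"
  define L where "L = (\<lambda>j::nat. 2 * exp (\<eta> * (16 * real j)) - c)"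
  define \<delta> where "\<delta> = (\<lambda>j. 1 / (real j ^ 2 * (L j + 1)))"
  have "\<forall>\<^sub>F j in sequentially. \<forall>z. cmod z \<le> 16 * real j \<longrightarrow> cmod (u z) \<le> exp (exp (\<eta> * (16 * real j)))"
    using tameD[OF u(2) \<eta>] by (rule eventually_compose_filterlim) real_asymp
  moreover have "\<forall>\<^sub>F j in sequentially. (2 * exp (\<epsilon> / 64 * (16 * real j)) - c) * (real j ^ 2 * ((2 * exp (\<epsilon> / 64 * (16 * real j)) - c) + 1))
       + 45 * real j * (2 * exp (\<epsilon> / 64 * (16 * real j)) - c) \<le> exp (\<epsilon> * real j)"
    using \<epsilon> by real_asymp
  hence "\<forall>\<^sub>F j in sequentially. L j * (real j ^ 2 * (L j + 1)) + 45 * real j * L j \<le> exp (\<epsilon> * real j)"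
    by (simp add: L_def \<eta>_def)
  ultimately have "\<forall>\<^sub>F j in sequentially. (\<forall>z. cmod z \<le> 16 * real j \<longrightarrow> cmod (u z) \<le> exp (exp (\<eta> * (16 * real j))))
      \<and> L j * (real j ^ 2 * (L j + 1)) + 45 * real j * L j \<le> exp (\<epsilon> * real j)"
    by eventually_elim auto
  then obtain J0 where J0: "\<And>j z. j \<ge> J0 \<Longrightarrow> cmod z \<le> 16 * real j \<Longrightarrow> cmod (u z) \<le> exp (exp (\<eta> * (16 * real j)))"
    "\<And>j. j \<ge> J0 \<Longrightarrow> L j * (real j ^ 2 * (L j + 1)) + 45 * real j * L j \<le> exp (\<epsilon> * real j)"
    by (auto simp: eventually_sequentially)
  define J where "J = max J0 1"
  have "\<exists>Z. finite Z \<and> real (card Z) \<le> L j \<and> 0 \<le> L j \<and>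
     (\<forall>\<delta> z. 0 < \<delta> \<longrightarrow> cmod z \<le> 2 * real j \<longrightarrow> (\<forall>a\<in>Z. \<delta> \<le> \<bar>cmod z - cmod a\<bar>) \<longrightarrow>
       cmod (deriv u z) \<le> (L j / \<delta> + 45 * real j * L j) * cmod (u z))" if j: "j \<ge> J" for j
  proof -
    have j1: "1 \<le> real j" using j by (simp add: J_def)
    have e1: "1 \<le> exp (exp (\<eta> * (16 * real j)))" by simp
    have b: "cmod (u z) \<le> exp (exp (\<eta> * (16 * real j)))" if "cmod z \<le> 16 * real j" for z
      using J0(1)[of j z] j that by (simp add: J_def)
    have Leq: "2 * ln (exp (exp (\<eta> * (16 * real j)))) - ln (cmod (u 0)) = L j" by (simp add: L_def c_def)
    show ?thesis
      by (rule log_deriv_disc[OF u(1,3) j1 e1 b, unfolded Leq]) blast+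
  qed
  then obtain Z where Z: "\<And>j. j \<ge> J \<Longrightarrow> finite (Z j)" "\<And>j. j \<ge> J \<Longrightarrow> real (card (Z j)) \<le> L j"
     "\<And>j. j \<ge> J \<Longrightarrow> 0 \<le> L j"
     "\<And>j \<delta> z. j \<ge> J \<Longrightarrow> 0 < \<delta> \<Longrightarrow> cmod z \<le> 2 * real j \<Longrightarrow> (\<forall>a\<in>Z j. \<delta> \<le> \<bar>cmod z - cmod a\<bar>) \<Longrightarrow>
       cmod (deriv u z) \<le> (L j / \<delta> + 45 * real j * L j) * cmod (u z)"
    by metis
  \<comment> \<open>The shift by \<open>J \<ge> 1\<close> bounds the length of \<open>B i\<close> by
    \<open>2 / (i + 1)^2\<close>, with no vanishing denominator at \<open>i = 0\<close>.\<close>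
  define B where "B = (\<lambda>i. \<Union>a\<in>Z (i + J). {cmod a - \<delta> (i + J)<..<cmod a + \<delta> (i + J)})"
  define E where "E = (\<Union>i. B i)"
  have \<delta>pos: "\<delta> j > 0" if "j \<ge> J" for j
  proof -
    have "real j > 0" using that by (simp add: J_def)
    thus ?thesis using Z(3)[OF that] unfolding \<delta>_def by simp
  qed
  have Bs: "B i \<in> sets lborel" for i unfolding B_def using Z(1)[of "i + J"] by (intro sets.finite_UN) auto
  have Bm: "emeasure lborel (B i) \<le> ennreal (2 / (real i + 1) ^ 2)" for i
  proof -
    let ?j = "i + J"
    have j: "?j \<ge> J" by simp
    have "emeasure lborel (B i) \<le> (\<Sum>a\<in>Z ?j. emeasure lborel {cmod a - \<delta> ?j<..<cmod a + \<delta> ?j})"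
      unfolding B_def by (rule emeasure_subadditive_finite) (use Z(1)[OF j] in auto)
    also have "\<dots> = (\<Sum>a\<in>Z ?j. ennreal (2 * \<delta> ?j))"
      using \<delta>pos[OF j] by (intro sum.cong) auto
    also have "\<dots> = ennreal (real (card (Z ?j)) * (2 * \<delta> ?j))"
      using \<delta>pos[OF j] by (simp add: ennreal_mult ennreal_of_nat_eq_real_of_nat)
    also have "\<dots> \<le> ennreal (2 / (real i + 1) ^ 2)"
    proof (rule ennreal_leI)
      have i1: "real i + 1 \<le> real ?j" by (simp add: J_def)
      hence sq: "(real i + 1) ^ 2 \<le> real ?j ^ 2" by (intro power_mono) auto
      have "real (card (Z ?j)) * (2 * \<delta> ?j) \<le> (L ?j + 1) * (2 * \<delta> ?j)"
        using Z(2)[OF j] \<delta>pos[OF j] by (intro mult_right_mono) auto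
      also have "\<dots> = 2 / real ?j ^ 2" 
      proof -
        have "x * (2 * (1 / (y * x))) = 2 / y" if "x \<noteq> 0" for x y :: real using that by simp
        moreover have "L ?j + 1 \<noteq> 0" using Z(3)[OF j] by linarith
        ultimately show ?thesis unfolding \<delta>_def by blast
      qed
      also have "\<dots> \<le> 2 / (real i + 1) ^ 2"
        using sq i1 by (intro divide_left_mono mult_pos_pos) (auto simp: zero_less_power)
      finally show "real (card (Z ?j)) * (2 * \<delta> ?j) \<le> 2 / (real i + 1) ^ 2" .
    qed
    finally show ?thesis .
  qed
  have "emeasure lborel E \<le> (\<Sum>i. emeasure lborel (B i))"
    unfolding E_def by (rule emeasure_subadditive_countably) (use Bs in auto)
  also have "\<dots> \<le> (\<Sum>i. ennreal (2 / (real i + 1) ^ 2))"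
    by (intro suminf_le Bm) auto
  also have "\<dots> < \<infinity>"
  proof -
    have "summable (\<lambda>i. 1 / real i ^ 2)" using inverse_power_summable[of 2, where ?'a = real] by (simp add: field_simps)
    hence "summable (\<lambda>i. 2 * (1 / real (Suc i) ^ 2))" by (intro summable_mult) (subst summable_Suc_iff)
    hence "summable (\<lambda>i. 2 / (real i + 1) ^ 2)" by (simp add: add.commute)
    hence "(\<Sum>i. ennreal (2 / (real i + 1) ^ 2)) \<noteq> top"
      by (rule ennreal_suminf_neq_top) auto
    thus ?thesis by (simp add: less_top)
  qed
  finally have Ef: "emeasure lborel E < \<infinity>" .
  have Es: "E \<in> sets lborel" unfolding E_def using Bs by (intro sets.countable_UN) auto
  have main: "cmod (deriv u z) \<le> exp (\<epsilon> * r) * cmod (u z)" if r: "r > real J + 1" "r \<notin> E" and z: "cmod z = r" for r z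
  proof -
    define j where "j = nat \<lfloor>r\<rfloor>"
    have r0: "r > 0" using r by linarith
    have jr: "real j \<le> r" "r < real j + 1" using r0 by (auto simp: j_def)
    have j: "j \<ge> J" using r jr by linarith
    have j1: "real j \<ge> 1" using j by (simp add: J_def)
    have "r \<notin> B (j - J)" using r by (auto simp: E_def)
    hence away: "\<forall>a\<in>Z j. \<delta> j \<le> \<bar>cmod z - cmod a\<bar>" using j z by (auto simp: B_def abs_if)
    \<comment> \<open>\<open>r < j + 1 \<le> 2 j\<close> puts \<open>z\<close> in the disc of stage
      \<open>j\<close>.\<close>
    have "cmod (deriv u z) \<le> (L j / \<delta> j + 45 * real j * L j) * cmod (u z)"
      by (rule Z(4)[OF j \<delta>pos[OF j] _ away]) (use z jr j1 in linarith)
    also have "L j / \<delta> j = L j * (real j ^ 2 * (L j + 1))" by (simp add: \<delta>_def)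
    also have "(L j * (real j ^ 2 * (L j + 1)) + 45 * real j * L j) * cmod (u z) \<le> exp (\<epsilon> * real j) * cmod (u z)"
      using J0(2)[of j] j by (intro mult_right_mono) (auto simp: J_def)
    also have "\<dots> \<le> exp (\<epsilon> * r) * cmod (u z)" using jr \<epsilon> by (intro mult_right_mono) auto
    finally show ?thesis .
  qed
  show ?thesis unfolding eventually_nev
    using Ef Es main by (intro bexI[of _ E] conjI exI[of _ "real J + 1"]) auto
qed

text \<open>A zero of order \<open>n\<close> at the origin contributes \<open>n / z\<close> to the
  logarithmic derivative, at most \<open>n\<close> in modulus for \<open>r \<ge> 1\<close>.\<close>

lemma log_deriv:
  assumes u: "entire u" "tame u" "\<exists>z. u z \<noteq> 0" and \<epsilon>: "\<epsilon> > 0"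
  shows "\<forall>\<^sub>F r in nev. \<forall>z. cmod z = r \<longrightarrow> cmod (deriv u z) \<le> exp (\<epsilon> * r) * cmod (u z)"
proof -
  obtain n G where G: "entire G" "G 0 \<noteq> 0" "\<And>z. u z = (z - 0) ^ n * G z"
    using entire_divide_power[OF u(1,3), of 0] by blast
  have tG: "tame G" by (rule tame_divide_power[OF u(2,1) G(1,3)])
  have "\<epsilon> / 2 > 0" using \<epsilon> by simp
  from log_deriv_aux[OF G(1) tG G(2) this] show ?thesis
  proof (rule eventually_elim2)
    show "\<forall>\<^sub>F r in nev. r \<ge> 1 \<and> real n + exp (\<epsilon> / 2 * r) \<le> exp (\<epsilon> * r)"
      by (rule nev_at_topI, rule eventually_conj[OF eventually_ge_at_top]) (use \<epsilon> in real_asymp)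
    fix r assume 1: "\<forall>z. cmod z = r \<longrightarrow> cmod (deriv G z) \<le> exp (\<epsilon> / 2 * r) * cmod (G z)"
      and 2: "r \<ge> 1 \<and> real n + exp (\<epsilon> / 2 * r) \<le> exp (\<epsilon> * r)"
    show "\<forall>z. cmod z = r \<longrightarrow> cmod (deriv u z) \<le> exp (\<epsilon> * r) * cmod (u z)"
    proof (intro allI impI)
      fix z assume z: "cmod z = r"
      have ueq: "u = (\<lambda>z. z ^ n * G z)" using G(3) by auto
      have "(G has_field_derivative deriv G z) (at z)"
        using entire_holo[OF G(1), of UNIV] holomorphic_derivI by blast
      hence "((\<lambda>z. z ^ n * G z) has_field_derivative (of_nat n * z ^ (n - 1) * G z + z ^ n * deriv G z)) (at z)"
        by (auto intro!: derivative_eq_intros)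
      hence d: "deriv u z = of_nat n * z ^ (n - 1) * G z + z ^ n * deriv G z"
        unfolding ueq by (rule DERIV_imp_deriv)
      have "cmod (deriv u z) \<le> real n * r ^ (n - 1) * cmod (G z) + r ^ n * cmod (deriv G z)"
        unfolding d using norm_triangle_ineq[of "of_nat n * z ^ (n - 1) * G z" "z ^ n * deriv G z"] z
        by (simp add: norm_mult norm_power)
      also have "\<dots> \<le> real n * r ^ n * cmod (G z) + r ^ n * (exp (\<epsilon> / 2 * r) * cmod (G z))"
        using 1 2 z by (intro add_mono mult_right_mono mult_left_mono power_increasing) auto
      also have "\<dots> = (real n + exp (\<epsilon> / 2 * r)) * cmod (u z)"
        using z by (simp add: ueq norm_mult norm_power algebra_simps)
      also have "\<dots> \<le> exp (\<epsilon> * r) * cmod (u z)" using 2 by (intro mult_right_mono) auto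
      finally show "cmod (deriv u z) \<le> exp (\<epsilon> * r) * cmod (u z)" .
    qed
  qed
qed

section \<open>Small functions relative to a unit\<close>

text \<open>A bound \<open>\<tau> (r + K) \<le> 2 \<tau> r\<close> may fail on sets of infinite measure, so it is not available along \<open>nev\<close>.
  Since \<open>ln \<tau> = o(r)\<close>, for each \<open>K\<close> it does hold on arbitrarily late intervals of length 1,
  and \<open>F\<close> restricts \<open>nev\<close> to a sequence of such intervals with \<open>K\<close> growing.\<close>

lemma doubling_filter:
  fixes \<tau> :: "real \<Rightarrow> real"
  assumes mono: "\<And>r s. 0 < r \<Longrightarrow> r \<le> s \<Longrightarrow> \<tau> r \<le> \<tau> s"
    and pos: "\<forall>\<^sub>F r in at_top. 0 < \<tau> r"
    and sub: "\<And>\<eta>. \<eta> > 0 \<Longrightarrow> \<forall>\<^sub>F r in at_top. \<tau> r \<le> exp (\<eta> * r)"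
  obtains F where "F \<le> nev" "F \<noteq> bot" "\<And>K. \<forall>\<^sub>F r in F. \<tau> (r + K) \<le> 2 * \<tau> r"
proof -
  have ex: "\<exists>s. s > real k \<and> \<tau> (s + (1 + real k)) \<le> 2 * \<tau> s" for k :: nat
  proof (rule ccontr)
    \<comment> \<open>Then \<open>\<tau>\<close> more than doubles on every step of length
      \<open>D = 1 + k\<close>, so it exceeds a multiple of \<open>2 ^ n\<close> after
      \<open>n\<close> steps. The rate \<open>1 / (4 * D)\<close> in \<open>sub\<close> allows only
      a multiple of \<open>exp (n / 4)\<close>, and \<open>exp (1 / 2) \<le> 2\<close>.\<close>
    assume "\<not> (\<exists>s. s > real k \<and> \<tau> (s + (1 + real k)) \<le> 2 * \<tau> s)"
    hence gt: "\<tau> (s + (1 + real k)) > 2 * \<tau> s" if "s > real k" for s using that by force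
    define D where "D = 1 + real k"
    from pos obtain N where N: "\<And>r. r > N \<Longrightarrow> 0 < \<tau> r" by (auto simp: eventually_at_top_dense)
    define s where "s = max N (real k) + 1"
    have s: "s > real k" "0 < \<tau> s" using N[of s] by (auto simp: s_def)
    have pow: "2 ^ n * \<tau> s \<le> \<tau> (s + real n * D)" for n
    proof (induction n)
      case (Suc n)
      have "0 \<le> real n * D" by (simp add: D_def)
      hence "s + real n * D > real k" using s(1) by linarith
      from gt[OF this] have "2 * \<tau> (s + real n * D) < \<tau> (s + real (Suc n) * D)"
        by (simp add: D_def algebra_simps)
      thus ?case using Suc by simp
    qed simp
    have Dp: "D > 0" by (simp add: D_def)
    have "\<forall>\<^sub>F n in sequentially. \<tau> (s + real n * D) \<le> exp (1 / (4 * D) * (s + real n * D))"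
    proof (rule eventually_compose_filterlim[OF sub])
      show "filterlim (\<lambda>n. s + real n * D) at_top sequentially" using Dp by real_asymp
    qed (use Dp in simp)
    moreover have "1 / (4 * D) * (s + real n * D) = s / (4 * D) + real n / 4" for n using Dp by (simp add: field_simps)
    ultimately have "\<forall>\<^sub>F n in sequentially. \<tau> (s + real n * D) \<le> exp (s / (4 * D) + real n / 4)" by simp
    moreover have "\<forall>\<^sub>F n in sequentially. exp (s / (4 * D) + real n / 4) < 2 ^ n * \<tau> s"
    proof -
      have "\<forall>\<^sub>F n in sequentially. exp (q + real n / 4) < 2 ^ n * t" if "t > 0" for q t :: real
      proof -
        have "exp (1 / 2 :: real) ^ 2 = exp 1" by (simp flip: exp_of_nat_mult)
        also have "\<dots> \<le> (2::real) ^ 2" using exp_le by simp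
        finally have e2: "exp (1 / 2 :: real) \<le> 2" by (rule power2_le_imp_le) simp
        have le: "exp (real n / 2) \<le> 2 ^ n" for n
          using power_mono[OF e2, of n] by (simp flip: exp_of_nat_mult)
        have "\<forall>\<^sub>F n in sequentially. exp (q + real n / 4) < exp (real n / 2) * t" using that by real_asymp
        thus ?thesis
        proof eventually_elim
          case (elim n)
          also have "exp (real n / 2) * t \<le> 2 ^ n * t" using le that by (intro mult_right_mono) auto
          finally show ?case .
        qed
      qed
      thus ?thesis using s(2) by blast
    qed
    ultimately have "\<forall>\<^sub>F n::nat in sequentially. False"
      by eventually_elim (use pow in \<open>meson not_le order_trans\<close>)
    thus False by simp
  qed
  then obtain s where s: "\<And>k::nat. s k > real k" "\<And>k. \<tau> (s k + (1 + real k)) \<le> 2 * \<tau> (s k)" by metis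
  \<comment> \<open>The extra 1 in \<open>1 + real k\<close> gives
    \<open>r + k \<le> s k + (1 + k)\<close> for every \<open>r\<close> in the unit interval, not
    just for \<open>s k\<close>.\<close>
  define S where "S = (\<Union>k. {s k..s k + 1})"
  define F where "F = inf nev (principal S)"
  have "F \<le> nev" by (simp add: F_def)
  \<comment> \<open>An exceptional set of finite measure cannot swallow unit intervals that start
    arbitrarily late.\<close>
  moreover have "F \<noteq> bot"
  proof
    assume "F = bot"
    hence "eventually (\<lambda>r. False) F" by simp
    hence "\<forall>\<^sub>F r in nev. r \<notin> S" by (simp add: F_def eventually_inf_principal)
    from nev_imp_at_top[OF this] obtain N where N: "\<And>r. r > N \<Longrightarrow> \<exists>r\<in>{r..r+1}. r \<notin> S"
      by (auto simp: eventually_at_top_dense)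
    obtain k :: nat where "real k > N" using reals_Archimedean2 by blast
    hence "s k > N" using s(1)[of k] by linarith
    from N[OF this] show False by (auto simp: S_def)
  qed
  moreover have "\<forall>\<^sub>F r in F. \<tau> (r + K) \<le> 2 * \<tau> r" for K
  proof -
    obtain k0 :: nat where k0: "real k0 > K" using reals_Archimedean2 by blast
    \<comment> \<open>Beyond \<open>M\<close> only intervals of index \<open>k \<ge> k0 > K\<close>
      remain.\<close>
    define M where "M = Max (insert 1 ((\<lambda>k. s k + 1) ` {..<k0}))"
    have M: "s k + 1 \<le> M" if "k < k0" for k unfolding M_def using that by (intro Max_ge) auto
    have "\<tau> (r + K) \<le> 2 * \<tau> r" if r: "r \<in> S" "r > max M (1 + \<bar>K\<bar>)" for r
    proof -
      obtain k where k: "s k \<le> r" "r \<le> s k + 1" using r(1) by (auto simp: S_def)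
      have "k \<ge> k0" using M[of k] k r(2) by (cases "k < k0") auto
      hence kK: "real k \<ge> K" using k0 by linarith
      have sp: "s k > 0" using s(1)[of k] by (meson of_nat_0_le_iff order_le_less_trans)
      have "\<tau> (r + K) \<le> \<tau> (s k + (1 + real k))" using r(2) k kK by (intro mono) auto
      also have "\<dots> \<le> 2 * \<tau> (s k)" by (rule s(2))
      also have "\<dots> \<le> 2 * \<tau> r" using mono[of "s k" r] sp k by simp
      finally show ?thesis .
    qed
    moreover have "\<forall>\<^sub>F r in nev. r > max M (1 + \<bar>K\<bar>)" by (rule nev_at_topI[OF eventually_gt_at_top])
    ultimately show ?thesis unfolding F_def eventually_inf_principal by (auto elim: eventually_mono)
  qed
  ultimately show ?thesis using that by blast
qed

section \<open>Characteristics of sums, products and dominated functions\<close>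

lemma char_T_add:
  assumes "entire u" "entire v" "r \<ge> 0"
  shows "char_T (\<lambda>z. u z + v z) r \<le> char_T u r + char_T v r + ln 2"
proof -
  have "char_T (\<lambda>z. u z + v z) r \<le> cavg r (\<lambda>z. (lnp (cmod (u z)) + lnp (cmod (v z))) + ln 2)"
    unfolding char_T_eq
  proof (rule cavg_mono)
    fix z
    show "lnp (cmod (u z + v z)) \<le> lnp (cmod (u z)) + lnp (cmod (v z)) + ln 2"
      using lnp_mono[OF norm_triangle_ineq[of "u z" "v z"]] lnp_add[of "cmod (u z)" "cmod (v z)"] by linarith
  qed (intro continuous_intros entire_continuous assms)+
  also have "\<dots> = cavg r (\<lambda>z. lnp (cmod (u z)) + lnp (cmod (v z))) + cavg r (\<lambda>z. ln 2)"
    by (rule cavg_add) (intro continuous_intros entire_continuous assms)+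
  also have "cavg r (\<lambda>z. lnp (cmod (u z)) + lnp (cmod (v z))) = char_T u r + char_T v r"
    unfolding char_T_eq by (rule cavg_add) (intro continuous_intros entire_continuous assms)+
  finally show ?thesis by simp
qed

lemma char_T_mult:
  assumes "entire u" "entire v" "r \<ge> 0"
  shows "char_T (\<lambda>z. u z * v z) r \<le> char_T u r + char_T v r"
proof -
  have "char_T (\<lambda>z. u z * v z) r \<le> cavg r (\<lambda>z. lnp (cmod (u z)) + lnp (cmod (v z)))"
    unfolding char_T_eq
  proof (rule cavg_mono)
    fix z
    show "lnp (cmod (u z * v z)) \<le> lnp (cmod (u z)) + lnp (cmod (v z))"
      unfolding norm_mult by (rule lnp_mult) auto
  qed (intro continuous_intros entire_continuous assms)+
  also have "\<dots> = char_T u r + char_T v r"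
    unfolding char_T_eq by (rule cavg_add) (intro continuous_intros entire_continuous assms)+
  finally show ?thesis .
qed

lemma char_T_le_of_bound:
  assumes "entire u" "entire v" "r \<ge> 0" "b \<ge> 0" "\<And>z. cmod z = r \<Longrightarrow> cmod (v z) \<le> exp b * cmod (u z)"
  shows "char_T v r \<le> char_T u r + b"
proof -
  have "char_T v r \<le> cavg r (\<lambda>z. lnp (cmod (u z)) + b)"
    unfolding char_T_eq
  proof (rule cavg_mono)
    fix z assume "cmod z = r"
    hence "lnp (cmod (v z)) \<le> lnp (exp b * cmod (u z))" using assms by (intro lnp_mono) auto
    also have "\<dots> \<le> lnp (exp b) + lnp (cmod (u z))" by (rule lnp_mult) auto
    also have "lnp (exp b) = b" using assms(4) by (auto simp: lnp_def)
    finally show "lnp (cmod (v z)) \<le> lnp (cmod (u z)) + b" by simp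
  qed (intro continuous_intros entire_continuous assms)+
  also have "\<dots> = cavg r (\<lambda>z. lnp (cmod (u z))) + cavg r (\<lambda>z. b)"
    by (rule cavg_add) (intro continuous_intros entire_continuous assms)+
  finally show ?thesis by (simp add: char_T_eq)
qed

lemma char_T_const_one: "char_T (\<lambda>z. 1) r = 0"
  unfolding char_T_eq by (simp add: lnp_def)

lemma entire_const [simp]: "entire (\<lambda>z. k)"
  by (simp add: entire_def)

lemma char_T_le_sup:
  assumes "entire v" "r \<ge> 0" "b \<ge> 0" "\<And>z. cmod z = r \<Longrightarrow> cmod (v z) \<le> exp b"
  shows "char_T v r \<le> b"
  using char_T_le_of_bound[of "\<lambda>z. 1" v r b] assms by (simp add: char_T_const_one)

lemma entire_add: "entire u \<Longrightarrow> entire v \<Longrightarrow> entire (\<lambda>z. u z + v z)"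
  and entire_diff: "entire u \<Longrightarrow> entire v \<Longrightarrow> entire (\<lambda>z. u z - v z)"
  and entire_mult: "entire u \<Longrightarrow> entire v \<Longrightarrow> entire (\<lambda>z. u z * v z)"
  and entire_exp: "entire u \<Longrightarrow> entire (\<lambda>z. exp (u z))"
  and entire_minus: "entire u \<Longrightarrow> entire (\<lambda>z. - u z)"
  and entire_deriv: "entire u \<Longrightarrow> entire (deriv u)"
  unfolding entire_def by (auto intro!: holomorphic_intros)

lemma entire_shift: "entire u \<Longrightarrow> entire (\<lambda>z. u (z + s))"
proof -
  assume "entire u"
  moreover have "(\<lambda>z. z + s) holomorphic_on UNIV" by (intro holomorphic_intros)
  ultimately show ?thesis
    using holomorphic_on_compose_gen[of "\<lambda>z. z + s" UNIV u UNIV] by (simp add: o_def entire_def)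
qed

lemma entire_poly: "entire (poly p)"
  unfolding entire_def by (intro holomorphic_intros)

lemmas entire_intros = entire_const entire_add entire_diff entire_mult entire_exp entire_minus entire_deriv entire_shift entire_poly

lemma entire_field_derivative: "entire u \<Longrightarrow> (u has_field_derivative deriv u z) (at z)"
  unfolding entire_def by (rule holomorphic_derivI[of _ UNIV]) auto

text \<open>Exponential type zero: the growth of the exponent \<open>h\<close>, whereas
  \<open>tame\<close> is that of \<open>exp h\<close>.\<close>

definition subexp :: "(complex \<Rightarrow> complex) \<Rightarrow> bool" where
  "subexp u \<longleftrightarrow> (\<forall>\<eta>>0. \<forall>\<^sub>F r in at_top. \<forall>z. cmod z \<le> r \<longrightarrow> cmod (u z) \<le> exp (\<eta> * r))"

lemma subexpI: "(\<And>\<eta>. \<eta> > 0 \<Longrightarrow> \<forall>\<^sub>F r in at_top. \<forall>z. cmod z \<le> r \<longrightarrow> cmod (u z) \<le> exp (\<eta> * r)) \<Longrightarrow> subexp u"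
  by (simp add: subexp_def)

lemma subexpD: "subexp u \<Longrightarrow> \<eta> > 0 \<Longrightarrow> \<forall>\<^sub>F r in at_top. \<forall>z. cmod z \<le> r \<longrightarrow> cmod (u z) \<le> exp (\<eta> * r)"
  by (simp add: subexp_def)

lemma subexp_const: "subexp (\<lambda>z. k)"
proof (rule subexpI)
  fix \<eta> :: real assume "\<eta> > 0"
  hence "\<forall>\<^sub>F r in at_top. cmod k \<le> exp (\<eta> * r)" by real_asymp
  thus "\<forall>\<^sub>F r in at_top. \<forall>z. cmod z \<le> r \<longrightarrow> cmod k \<le> exp (\<eta> * r)" by eventually_elim auto
qed

lemma subexp_ident: "subexp (\<lambda>z. z)"
proof (rule subexpI)
  fix \<eta> :: real assume "\<eta> > 0"
  hence "\<forall>\<^sub>F r in at_top. r \<le> exp (\<eta> * r)" by real_asymp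
  thus "\<forall>\<^sub>F r in at_top. \<forall>z. cmod z \<le> r \<longrightarrow> cmod z \<le> exp (\<eta> * r)" by eventually_elim auto
qed

lemma subexp_mult:
  assumes "subexp u" "subexp v" shows "subexp (\<lambda>z. u z * v z)"
proof (rule subexpI)
  fix \<eta> :: real assume "\<eta> > 0"
  hence e: "\<eta> / 2 > 0" by simp
  from subexpD[OF assms(1) e] subexpD[OF assms(2) e]
  show "\<forall>\<^sub>F r in at_top. \<forall>z. cmod z \<le> r \<longrightarrow> cmod (u z * v z) \<le> exp (\<eta> * r)"
  proof eventually_elim
    case (elim r)
    have "cmod (u z * v z) \<le> exp (\<eta> * r)" if "cmod z \<le> r" for z
    proof -
      have "cmod (u z * v z) \<le> exp (\<eta> / 2 * r) * exp (\<eta> / 2 * r)"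
        unfolding norm_mult using elim that by (intro mult_mono) auto
      also have "\<dots> = exp (\<eta> * r)" by (simp flip: exp_add)
      finally show ?thesis .
    qed
    thus ?case by blast
  qed
qed

lemma subexp_add:
  assumes "subexp u" "subexp v" shows "subexp (\<lambda>z. u z + v z)"
proof (rule subexpI)
  fix \<eta> :: real assume "\<eta> > 0"
  hence e: "\<eta> / 2 > 0" by simp
  have "\<forall>\<^sub>F r in at_top. 2 * exp (\<eta> / 2 * r) \<le> exp (\<eta> * r)" using \<open>\<eta> > 0\<close> by real_asymp
  with subexpD[OF assms(1) e] subexpD[OF assms(2) e]
  show "\<forall>\<^sub>F r in at_top. \<forall>z. cmod z \<le> r \<longrightarrow> cmod (u z + v z) \<le> exp (\<eta> * r)"
  proof eventually_elim
    case (elim r)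
    have "cmod (u z + v z) \<le> exp (\<eta> * r)" if "cmod z \<le> r" for z
      using elim(1)[rule_format, OF that] elim(2)[rule_format, OF that] elim(3) norm_triangle_ineq[of "u z" "v z"] by linarith
    thus ?case by blast
  qed
qed

lemma subexp_poly: "subexp (poly p)"
proof (induction p)
  case 0 thus ?case using subexp_const[of 0] by simp
next
  case (pCons a p)
  from subexp_add[OF subexp_const subexp_mult[OF subexp_ident this(2)], of a] show ?case by (simp add: subexp_def)
qed

lemma subexp_transfer:
  assumes u: "subexp u" and le: "\<And>r z. r \<ge> R \<Longrightarrow> cmod z \<le> r \<Longrightarrow> \<exists>w. cmod w \<le> r + 1 \<and> cmod (v z) \<le> cmod (u w)"
  shows "subexp v"
proof (rule subexpI)
  fix \<eta> :: real assume "\<eta> > 0"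
  hence e: "\<eta> / 2 > 0" by simp
  have 1: "\<forall>\<^sub>F r in at_top. \<forall>z. cmod z \<le> r + 1 \<longrightarrow> cmod (u z) \<le> exp (\<eta> / 2 * (r + 1))"
    using subexpD[OF u e] by (rule eventually_compose_filterlim) real_asymp
  have "\<forall>\<^sub>F r::real in at_top. r \<ge> max 1 R" by (rule eventually_ge_at_top)
  with 1 show "\<forall>\<^sub>F r in at_top. \<forall>z. cmod z \<le> r \<longrightarrow> cmod (v z) \<le> exp (\<eta> * r)"
  proof eventually_elim
    case (elim r)
    have "\<eta> / 2 * (r + 1) \<le> \<eta> / 2 * (2 * r)" using elim \<open>\<eta> > 0\<close> by (intro mult_left_mono) auto
    hence "exp (\<eta> / 2 * (r + 1)) \<le> exp (\<eta> * r)" by simp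
    with elim le[of r] show ?case by (meson max.bounded_iff order_trans)
  qed
qed

lemma subexp_deriv: "subexp u \<Longrightarrow> entire u \<Longrightarrow> subexp (deriv u)"
  by (rule subexp_transfer[of u 0]) (auto intro: deriv_le_nearby)

lemma subexp_imp_tame:
  assumes "subexp u" shows "tame u"
proof (rule tameI)
  fix \<eta> :: real assume e: "\<eta> > 0"
  have "\<forall>\<^sub>F r in at_top. exp (\<eta> * r) \<le> exp (exp (\<eta> * r))" using e by real_asymp
  with subexpD[OF assms e] show "\<forall>\<^sub>F r in at_top. \<forall>z. cmod z \<le> r \<longrightarrow> cmod (u z) \<le> exp (exp (\<eta> * r))"
    by eventually_elim (meson order_trans)
qed

lemma tame_exp:
  assumes "subexp u" shows "tame (\<lambda>z. exp (u z))"
proof (rule tameI)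
  fix \<eta> :: real assume e: "\<eta> > 0"
  from subexpD[OF assms e] show "\<forall>\<^sub>F r in at_top. \<forall>z. cmod z \<le> r \<longrightarrow> cmod (exp (u z)) \<le> exp (exp (\<eta> * r))"
    by eventually_elim (auto intro: order_trans[OF complex_Re_le_cmod])
qed

lemma cavg_sum_five:
  fixes u0 u1 u2 u3 u4 :: "complex \<Rightarrow> real"
  assumes c: "continuous_on (sphere 0 r) u0" "continuous_on (sphere 0 r) u1" "continuous_on (sphere 0 r) u2"
    "continuous_on (sphere 0 r) u3" "continuous_on (sphere 0 r) u4" and r: "r \<ge> 0"
  shows "cavg r (\<lambda>z. u0 z + (k + u1 z + u2 z + u3 z + u4 z)) =
    cavg r u0 + (k + cavg r u1 + cavg r u2 + cavg r u3 + cavg r u4)"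
proof -
  have 1: "cavg r (\<lambda>z. k + u1 z) = k + cavg r u1" by (subst cavg_add) (use c r in auto)
  have 2: "cavg r (\<lambda>z. k + u1 z + u2 z) = k + cavg r u1 + cavg r u2"
    unfolding 1[symmetric] by (rule cavg_add) (intro continuous_intros c r)+
  have 3: "cavg r (\<lambda>z. k + u1 z + u2 z + u3 z) = k + cavg r u1 + cavg r u2 + cavg r u3"
    unfolding 2[symmetric] by (rule cavg_add) (intro continuous_intros c r)+
  have 4: "cavg r (\<lambda>z. k + u1 z + u2 z + u3 z + u4 z) = k + cavg r u1 + cavg r u2 + cavg r u3 + cavg r u4"
    unfolding 3[symmetric] by (rule cavg_add) (intro continuous_intros c r)+
  show ?thesis unfolding 4[symmetric] by (rule cavg_add) (intro continuous_intros c r)+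
qed

text \<open>The zero-free function \<open>exp h\<close> replaces \<open>f\<close> as yardstick: its
  characteristic is monotone with no exceptional set, and an affine function of the mean of
  \<open>|Re h|\<close>.\<close>

locale unit_growth =
  fixes h :: "complex \<Rightarrow> complex" and \<tau> :: "real \<Rightarrow> real"
  assumes \<tau>_def: "\<tau> = char_T (\<lambda>z. exp (h z))" and h: "entire h" and nonconst: "\<exists>z. deriv h z \<noteq> 0"
    and sub: "\<And>\<eta>. \<eta> > 0 \<Longrightarrow> \<forall>\<^sub>F r in at_top. \<tau> r \<le> exp (\<eta> * r)"
begin

lemma tau_mono: "0 < r \<Longrightarrow> r \<le> s \<Longrightarrow> \<tau> r \<le> \<tau> s"
  using char_T_shift[of "\<lambda>z. exp (h z)" s r 0] entire_exp[OF h] by (cases "r = s") (auto simp: \<tau>_def)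

text \<open>\<open>|x| = 2 max(x, 0) - x\<close>, and \<open>Re h\<close> has mean
  \<open>Re (h 0)\<close>.\<close>

lemma cavg_abs_Re: assumes "r > 0" shows "cavg r (\<lambda>z. \<bar>Re (h z)\<bar>) = 2 * \<tau> r - Re (h 0)"
proof -
  have "cavg r (\<lambda>z. \<bar>Re (h z)\<bar>) = cavg r (\<lambda>z. 2 * lnp (cmod (exp (h z))) - Re (h z))"
    by (rule cavg_cong) (use assms in \<open>auto simp: lnp_def\<close>)
  also have "\<dots> = cavg r (\<lambda>z. 2 * lnp (cmod (exp (h z)))) - cavg r (\<lambda>z. Re (h z))"
    by (rule cavg_diff) (use assms in \<open>auto intro!: continuous_intros entire_continuous h\<close>)
  also have "cavg r (\<lambda>z. Re (h z)) = Re (h 0)"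
    by (rule cavg_mean_Re) (use assms entire_holo[OF h] in auto)
  finally show ?thesis by (simp only: cavg_cmult \<tau>_def char_T_eq)
qed

lemma h_le_tau:
  assumes "r > 0" "cmod z \<le> r"
  shows "cmod (h z) \<le> 5 * cmod (h 0) + 8 * \<tau> (2 * r)"
proof -
  have r2: "2 * r > 0" using assms by simp
  have "cmod (h z) \<le> cmod (h 0) + 2 * (2 * r) / (2 * r - cmod z) * cavg (2 * r) (\<lambda>w. \<bar>Re (h w)\<bar>)"
    by (rule Schwarz_bound) (use assms entire_holo[OF h] in auto)
  also have "2 * (2 * r) / (2 * r - cmod z) * cavg (2 * r) (\<lambda>w. \<bar>Re (h w)\<bar>) \<le> 4 * (2 * \<tau> (2 * r) + cmod (h 0))"
  proof (rule mult_mono)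
    have "2 * (2 * r) / (2 * r - cmod z) \<le> 2 * (2 * r) / r" using assms by (intro divide_left_mono) auto
    thus "2 * (2 * r) / (2 * r - cmod z) \<le> 4" using assms by simp
    show "cavg (2 * r) (\<lambda>w. \<bar>Re (h w)\<bar>) \<le> 2 * \<tau> (2 * r) + cmod (h 0)"
      unfolding cavg_abs_Re[OF r2] using abs_Re_le_cmod[of "h 0"] by linarith
    have "0 = cavg (2 * r) (\<lambda>z. 0::real)" by simp
    also have "\<dots> \<le> cavg (2 * r) (\<lambda>w. \<bar>Re (h w)\<bar>)"
      by (rule cavg_mono) (use assms in \<open>auto intro!: continuous_intros entire_continuous h\<close>)
    finally show "0 \<le> cavg (2 * r) (\<lambda>w. \<bar>Re (h w)\<bar>)" .
  qed simp
  finally show ?thesis by simp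
qed

lemma subexp_h: "subexp h"
proof (rule subexpI)
  fix \<eta> :: real assume e: "\<eta> > 0"
  hence e4: "\<eta> / 4 > 0" by simp
  have 1: "\<forall>\<^sub>F r in at_top. \<tau> (2 * r) \<le> exp (\<eta> / 4 * (2 * r))"
    using sub[OF e4] by (rule eventually_compose_filterlim) real_asymp
  have 2: "\<forall>\<^sub>F r in at_top. 5 * cmod (h 0) + 8 * exp (\<eta> / 4 * (2 * r)) \<le> exp (\<eta> * r)" using e by real_asymp
  have "\<forall>\<^sub>F r::real in at_top. r > 0" by (rule eventually_gt_at_top)
  with 1 2 show "\<forall>\<^sub>F r in at_top. \<forall>z. cmod z \<le> r \<longrightarrow> cmod (h z) \<le> exp (\<eta> * r)"
  proof eventually_elim
    case (elim r)
    have "cmod (h z) \<le> exp (\<eta> * r)" if "cmod z \<le> r" for z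
      using h_le_tau[of r z] that elim by linarith
    thus ?case by blast
  qed
qed

text \<open>\<open>h_le_tau\<close> bounds \<open>h\<close> on \<open>|z| \<le> r / 2\<close> by
  \<open>\<tau> r\<close>; Cauchy's estimate for a fixed nonzero value of \<open>h'\<close>, on a
  disc of radius about \<open>r / 2\<close>, then forces linear growth. This makes every error
  \<open>\<epsilon> r\<close> negligible.\<close>

lemma tau_linear: "\<exists>c>0. \<forall>\<^sub>F r in at_top. c * r \<le> \<tau> r"
proof -
  obtain z0 where z0: "deriv h z0 \<noteq> 0" using nonconst by blast
  define m where "m = cmod (deriv h z0)"
  have m: "m > 0" using z0 by (simp add: m_def)
  have low: "(r / 2 - cmod z0) * m \<le> 5 * cmod (h 0) + 8 * \<tau> r" if r: "r > 2 * cmod z0" for r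
  proof -
    define d where "d = r / 2 - cmod z0"
    have d: "d > 0" using r by (simp add: d_def)
    have "m \<le> (5 * cmod (h 0) + 8 * \<tau> r) / d"
      unfolding m_def
    proof (rule Cauchy_deriv_bound)
      fix w assume w: "cmod (w - z0) = d"
      have "cmod w \<le> r / 2" using norm_triangle_ineq2[of w z0] w by (simp add: d_def)
      moreover have "r / 2 > 0" using r norm_ge_zero[of z0] by linarith
      ultimately show "cmod (h w) \<le> 5 * cmod (h 0) + 8 * \<tau> r" using h_le_tau[of "r / 2" w] by simp
    qed (use d entire_holo[OF h] in auto)
    thus ?thesis using d by (simp add: field_simps d_def)
  qed
  \<comment> \<open>The slope \<open>8 * m / 32 = m / 4\<close> stays below the slope
    \<open>m / 2\<close> on the right.\<close>
  have 1: "\<forall>\<^sub>F r in at_top. 5 * cmod (h 0) + 8 * (m / 32 * r) \<le> (r / 2 - cmod z0) * m" using m by real_asymp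
  have "\<forall>\<^sub>F r::real in at_top. r > 2 * cmod z0" by (rule eventually_gt_at_top)
  with 1 have "\<forall>\<^sub>F r in at_top. m / 32 * r \<le> \<tau> r"
  proof eventually_elim
    case (elim r) thus ?case using low[of r] by linarith
  qed
  thus ?thesis using m by (intro exI[of _ "m / 32"]) auto
qed

end

locale unit_filter = unit_growth +
  fixes F :: "real filter"
  assumes F_nev: "F \<le> nev" and F_bot: "F \<noteq> bot" and doubling: "\<And>K. \<forall>\<^sub>F r in F. \<tau> (r + K) \<le> 2 * \<tau> r"
begin

text \<open>One-sided, without absolute values: error terms need only upper bounds, and constants of
  either sign occur among them.\<close>

definition sml :: "(real \<Rightarrow> real) \<Rightarrow> bool" where
  "sml g \<longleftrightarrow> (\<forall>\<epsilon>>0. \<forall>\<^sub>F r in F. g r \<le> \<epsilon> * \<tau> r)"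

lemma nevF: "eventually P nev \<Longrightarrow> eventually P F"
  using F_nev filter_leD by blast

lemma topF: "eventually P at_top \<Longrightarrow> eventually P F"
  using nev_at_topI nevF by blast

lemma sml_mono:
  assumes "sml g" "\<forall>\<^sub>F r in F. g' r \<le> g r" shows "sml g'"
  unfolding sml_def
proof (intro allI impI)
  fix \<epsilon> :: real assume "\<epsilon> > 0"
  hence "\<forall>\<^sub>F r in F. g r \<le> \<epsilon> * \<tau> r" using assms(1) by (simp add: sml_def)
  with assms(2) show "\<forall>\<^sub>F r in F. g' r \<le> \<epsilon> * \<tau> r" by eventually_elim simp
qed

lemma sml_add:
  assumes "sml g" "sml g'" shows "sml (\<lambda>r. g r + g' r)"
  unfolding sml_def
proof (intro allI impI)
  fix \<epsilon> :: real assume "\<epsilon> > 0"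
  hence "\<forall>\<^sub>F r in F. g r \<le> \<epsilon> / 2 * \<tau> r" "\<forall>\<^sub>F r in F. g' r \<le> \<epsilon> / 2 * \<tau> r"
    using assms unfolding sml_def by (auto dest!: spec[of _ "\<epsilon> / 2"])
  thus "\<forall>\<^sub>F r in F. g r + g' r \<le> \<epsilon> * \<tau> r" by eventually_elim simp
qed

lemma sml_linear:
  assumes "\<And>\<epsilon>. \<epsilon> > 0 \<Longrightarrow> \<forall>\<^sub>F r in F. g r \<le> \<epsilon> * r" shows "sml g"
  unfolding sml_def
proof (intro allI impI)
  fix \<epsilon> :: real assume e: "\<epsilon> > 0"
  obtain c where c: "c > 0" "\<forall>\<^sub>F r in at_top. c * r \<le> \<tau> r" using tau_linear by blast
  have "\<forall>\<^sub>F r in F. g r \<le> \<epsilon> * c * r" using assms[of "\<epsilon> * c"] e c by simp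
  with topF[OF c(2)] show "\<forall>\<^sub>F r in F. g r \<le> \<epsilon> * \<tau> r"
  proof eventually_elim
    case (elim r)
    have "\<epsilon> * (c * r) \<le> \<epsilon> * \<tau> r" using elim(1) e by (intro mult_left_mono) auto
    thus ?case using elim(2) by simp
  qed
qed

lemma sml_const: "sml (\<lambda>r. k)"
proof (rule sml_linear)
  fix \<epsilon> :: real assume "\<epsilon> > 0"
  hence "\<forall>\<^sub>F r in at_top. k \<le> \<epsilon> * r" by real_asymp
  thus "\<forall>\<^sub>F r in F. k \<le> \<epsilon> * r" by (rule topF)
qed

text \<open>The source of the contradictions: \<open>F\<close> is nontrivial and
  \<open>\<tau>\<close> is eventually positive, so \<open>\<tau>\<close> cannot be bounded by small
  terms.\<close>

lemma not_sml_tau: "\<not> sml \<tau>"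
proof
  assume "sml \<tau>"
  hence "\<forall>\<^sub>F r in F. \<tau> r \<le> 1 / 2 * \<tau> r" by (auto simp: sml_def dest!: spec[of _ "1/2"])
  moreover obtain c where c: "c > 0" "\<forall>\<^sub>F r in at_top. c * r \<le> \<tau> r" using tau_linear by blast
  have "\<forall>\<^sub>F r in F. c * r \<le> \<tau> r" "\<forall>\<^sub>F r in F. r > 0" using topF[OF c(2)] topF[OF eventually_gt_at_top] by auto
  ultimately have "\<forall>\<^sub>F r in F. False"
  proof eventually_elim
    case (elim r)
    have "c * r > 0" using elim c by simp
    thus ?case using elim by linarith
  qed
  thus False using F_bot by (simp add: trivial_limit_def)
qed

text \<open>Tameness is included so that \<open>log_deriv\<close> applies, which closes the class
  under derivatives.\<close>

definition small :: "(complex \<Rightarrow> complex) \<Rightarrow> bool" where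
  "small u \<longleftrightarrow> entire u \<and> tame u \<and> sml (char_T u)"

lemma small_entire: "small u \<Longrightarrow> entire u" by (simp add: small_def)
lemma small_tame: "small u \<Longrightarrow> tame u" by (simp add: small_def)
lemma small_sml: "small u \<Longrightarrow> sml (char_T u)" by (simp add: small_def)

lemma small_subexp:
  assumes "subexp u" "entire u" shows "small u"
  unfolding small_def
proof (intro conjI subexp_imp_tame assms sml_linear topF)
  fix \<epsilon> :: real assume e: "\<epsilon> > 0"
  have "\<forall>\<^sub>F r::real in at_top. r > 0" by (rule eventually_gt_at_top)
  with subexpD[OF assms(1) e] show "\<forall>\<^sub>F r in at_top. char_T u r \<le> \<epsilon> * r"
    by eventually_elim (use assms e in \<open>auto intro!: char_T_le_sup\<close>)
qed

lemma small_add: assumes "small u" "small v" shows "small (\<lambda>z. u z + v z)"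
  unfolding small_def
proof (intro conjI entire_add tame_add)
  show "sml (char_T (\<lambda>z. u z + v z))"
  proof (rule sml_mono)
    show "sml (\<lambda>r. char_T u r + char_T v r + ln 2)"
      using assms by (intro sml_add sml_const small_sml)
    show "\<forall>\<^sub>F r in F. char_T (\<lambda>z. u z + v z) r \<le> char_T u r + char_T v r + ln 2"
      using topF[OF eventually_ge_at_top[of 0]] by eventually_elim (use assms small_entire char_T_add in blast)
  qed
qed (use assms in \<open>simp_all add: small_def\<close>)

lemma small_mult: assumes "small u" "small v" shows "small (\<lambda>z. u z * v z)"
  unfolding small_def
proof (intro conjI entire_mult tame_mult)
  show "sml (char_T (\<lambda>z. u z * v z))"
  proof (rule sml_mono)
    show "sml (\<lambda>r. char_T u r + char_T v r)"
      using assms by (intro sml_add small_sml)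
    show "\<forall>\<^sub>F r in F. char_T (\<lambda>z. u z * v z) r \<le> char_T u r + char_T v r"
      using topF[OF eventually_ge_at_top[of 0]] by eventually_elim (use assms small_entire char_T_mult in blast)
  qed
qed (use assms in \<open>simp_all add: small_def\<close>)

lemma small_const: "small (\<lambda>z. k)"
  by (rule small_subexp[OF subexp_const]) simp

lemma small_diff: assumes "small u" "small v" shows "small (\<lambda>z. u z - v z)"
  using small_add[OF assms(1) small_mult[OF small_const[of "-1"] assms(2)]] by simp

lemma small_deriv: assumes "small u" shows "small (deriv u)"
proof (cases "\<exists>z. u z \<noteq> 0")
  case True
  note u = small_entire[OF assms] small_tame[OF assms]
  have "sml (char_T (deriv u))" unfolding sml_def
  proof (intro allI impI)
    fix \<epsilon> :: real assume e: "\<epsilon> > 0"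
    obtain c where c: "c > 0" "\<forall>\<^sub>F r in at_top. c * r \<le> \<tau> r" using tau_linear by blast
    have e1: "\<epsilon> / 2 * c > 0" using e c by simp
    have "\<forall>\<^sub>F r in F. char_T u r \<le> \<epsilon> / 2 * \<tau> r" using small_sml[OF assms] e unfolding sml_def by (auto dest!: spec[of _ "\<epsilon> / 2"])
    with nevF[OF log_deriv[OF u True e1]] topF[OF c(2)] topF[OF eventually_ge_at_top[of 0]]
    show "\<forall>\<^sub>F r in F. char_T (deriv u) r \<le> \<epsilon> * \<tau> r"
    proof eventually_elim
      case (elim r)
      have "char_T (deriv u) r \<le> char_T u r + \<epsilon> / 2 * c * r"
        using elim e1 by (intro char_T_le_of_bound u entire_deriv) auto
      moreover have "\<epsilon> / 2 * (c * r) \<le> \<epsilon> / 2 * \<tau> r" using elim(2) e by (intro mult_left_mono) auto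
      ultimately show ?case using elim(4) by simp
    qed
  qed
  thus ?thesis using u by (simp add: small_def entire_deriv tame_deriv)
next
  case False
  hence "u = (\<lambda>z. 0)" by auto
  thus ?thesis using small_const[of 0] by simp
qed

text \<open>The proximity function \<open>m(r, 1/u)\<close>; the lemmas evaluate it on zero-free
  circles.\<close>

definition mi :: "(complex \<Rightarrow> complex) \<Rightarrow> real \<Rightarrow> real" where
  "mi u r = cavg r (\<lambda>z. lnp (1 / cmod (u z)))"

lemma cavg_ln_eq:
  assumes "entire u" "r \<ge> 0" "\<And>z. cmod z = r \<Longrightarrow> u z \<noteq> 0"
  shows "cavg r (\<lambda>z. ln (cmod (u z))) = char_T u r - mi u r"
proof -
  have "cavg r (\<lambda>z. ln (cmod (u z))) = cavg r (\<lambda>z. lnp (cmod (u z)) - lnp (1 / cmod (u z)))"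
    by (rule cavg_cong) (use assms in \<open>auto intro: ln_eq_lnp_diff\<close>)
  also have "\<dots> = char_T u r - mi u r"
    unfolding char_T_eq mi_def by (rule cavg_diff) (use assms in \<open>auto intro!: continuous_intros entire_continuous\<close>)
  finally show ?thesis .
qed

text \<open>\<open>T(r, u) - m(r, 1/u)\<close> is the mean of \<open>ln |u|\<close>, which
  \<open>Jensen_lower\<close> bounds below.\<close>

lemma sml_mi:
  assumes "small u" "\<exists>z. u z \<noteq> 0" shows "sml (mi u)"
proof -
  note u = small_entire[OF assms(1)]
  obtain C where C: "\<And>r. r \<ge> 1 \<Longrightarrow> (\<And>z. cmod z = r \<Longrightarrow> u z \<noteq> 0) \<Longrightarrow> cavg r (\<lambda>z. ln (cmod (u z))) \<ge> C"
    using Jensen_lower[OF u assms(2)] by blast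
  show ?thesis
  proof (rule sml_mono)
    show "sml (\<lambda>r. char_T u r + (- C))" by (intro sml_add sml_const small_sml assms)
    show "\<forall>\<^sub>F r in F. mi u r \<le> char_T u r + (- C)"
      using nevF[OF eventually_nev_nonzero[OF u assms(2)]] topF[OF eventually_ge_at_top[of 1]]
    proof eventually_elim
      case (elim r)
      show ?case using C[of r] cavg_ln_eq[OF u, of r] elim by simp
    qed
  qed
qed

lemma unit_quotient_not_small:
  assumes A: "small A" "\<exists>z. A z \<noteq> 0" and \<beta>: "small \<beta>" and eq: "\<And>z. A z * exp (h z) = \<beta> z"
  shows False
proof -
  have "sml \<tau>"
  proof (rule sml_mono)
    show "sml (\<lambda>r. char_T \<beta> r + mi A r)" by (intro sml_add small_sml sml_mi A \<beta>)
    show "\<forall>\<^sub>F r in F. \<tau> r \<le> char_T \<beta> r + mi A r"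
      using nevF[OF eventually_nev_nonzero[OF small_entire[OF A(1)] A(2)]] topF[OF eventually_ge_at_top[of 1]]
    proof eventually_elim
      case (elim r)
      have "\<tau> r \<le> cavg r (\<lambda>z. lnp (cmod (\<beta> z)) + lnp (1 / cmod (A z)))"
        unfolding \<tau>_def char_T_eq
      proof (rule cavg_mono)
        fix z assume "cmod z = r"
        hence "exp (h z) = \<beta> z / A z" using eq[of z] elim by (simp add: field_simps)
        hence "cmod (exp (h z)) = cmod (\<beta> z) * (1 / cmod (A z))" by (simp only: norm_divide) simp
        thus "lnp (cmod (exp (h z))) \<le> lnp (cmod (\<beta> z)) + lnp (1 / cmod (A z))"
          by (simp only:) (rule lnp_mult, auto)
      qed (use elim in \<open>auto intro!: continuous_intros entire_continuous h small_entire A \<beta>\<close>)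
      also have "\<dots> = char_T \<beta> r + mi A r"
        unfolding char_T_eq mi_def by (rule cavg_add) (use elim in \<open>auto intro!: continuous_intros entire_continuous small_entire A \<beta>\<close>)
      finally show ?case .
    qed
  qed
  thus False using not_sml_tau by blast
qed


text \<open>\<open>B / \<alpha>\<close> has zero derivative on a disc where \<open>\<alpha>\<close>
  does not vanish; the identity theorem spreads the relation to the plane.\<close>

lemma linear_dependence_of_Wronskian:
  assumes "entire B" "entire \<alpha>" "\<exists>z. \<alpha> z \<noteq> 0"
    and W: "\<And>z. deriv B z * \<alpha> z = B z * deriv \<alpha> z"
  obtains k where "\<And>z. B z = k * \<alpha> z"
proof -
  obtain z0 where z0: "\<alpha> z0 \<noteq> 0" using assms(3) by blast
  obtain e where e: "e > 0" "ball z0 e \<subseteq> {z. \<alpha> z \<noteq> 0}" by (rule openE[OF entire_open_nonzero[OF assms(2)], of z0]) (use z0 in simp_all)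
  have "\<exists>k. \<forall>z\<in>ball z0 e. B z / \<alpha> z = k"
  proof (rule has_field_derivative_zero_constant)
    fix z assume z: "z \<in> ball z0 e"
    have nz: "\<alpha> z \<noteq> 0" using e z by auto
    have "((\<lambda>z. B z / \<alpha> z) has_field_derivative (deriv B z * \<alpha> z - B z * deriv \<alpha> z) / (\<alpha> z * \<alpha> z)) (at z within ball z0 e)"
      by (intro DERIV_divide has_field_derivative_at_within[OF entire_field_derivative] assms(1,2) nz)
    thus "((\<lambda>z. B z / \<alpha> z) has_field_derivative 0) (at z within ball z0 e)" using W[of z] by simp
  qed simp
  then obtain k where k: "\<And>z. z \<in> ball z0 e \<Longrightarrow> B z / \<alpha> z = k" by blast
  have "B z = k * \<alpha> z" for z
  proof (rule analytic_continuation_open[of "ball z0 e" UNIV B "\<lambda>z. k * \<alpha> z"])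
    show "ball z0 e \<noteq> {}" using e(1) by simp
    show "(\<lambda>z. k * \<alpha> z) holomorphic_on UNIV" by (intro holomorphic_intros entire_holo assms)
    show "B z = k * \<alpha> z" if z: "z \<in> ball z0 e" for z
    proof -
      have "\<alpha> z \<noteq> 0" using e(2) z by blast
      thus ?thesis using k[OF z] by (simp add: field_simps)
    qed
    show "B holomorphic_on UNIV" by (rule entire_holo[OF assms(1)])
  qed (simp_all add: connected_UNIV)
  thus ?thesis by (rule that)
qed

text \<open>Lower bound for \<open>p = \<bar>A exp h - \<alpha>\<bar>\<close> with \<open>X = \<bar>exp h\<bar>\<close>, \<open>a = \<bar>\<alpha>\<bar>\<close>, \<open>b = \<bar>A\<bar>\<close>, \<open>w\<close> the
  Wronskian divided by \<open>exp h\<close>, and \<open>E\<close> the bound for the logarithmic derivatives.\<close>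

lemma lnp_unit_bound:
  fixes X p a b w E :: real
  assumes "X > 0" "p > 0" "a > 0" "b \<ge> 0" "w > 0" "E \<ge> 1" "X * w \<le> 2 * E * p * a" "a \<le> b * X + p"
  shows "lnp X \<le> ln p + (ln 3 + ln E + lnp a + lnp b + lnp (1 / w) + lnp (1 / a))"
proof -
  define W V ma mb mW mV where "W = 1 / w" and "V = 1 / a" and "ma = max 1 a" and "mb = max 1 b"
    and "mW = max 1 (1 / w)" and "mV = max 1 (1 / a)"
  have m: "1 \<le> ma" "1 \<le> mb" "1 \<le> mW" "1 \<le> mV" "a \<le> ma" "b \<le> mb" "W \<le> mW" "V \<le> mV" "W > 0" "V > 0"
    using assms by (auto simp: ma_def mb_def mW_def mV_def W_def V_def)
  define K where "K = 3 * E * ma * mb * mW * mV"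
  \<comment> \<open>The Wronskian inequality alone bounds \<open>X\<close> by
    \<open>p * K\<close>.\<close>
  have X1: "X \<le> p * (2 * E * a * W)" using assms by (simp add: W_def field_simps)
  have "2 * E * a * W \<le> 3 * E * ma * mW" using m assms by (intro mult_mono) auto
  also have "\<dots> = 3 * E * ma * 1 * mW * 1" by simp
  also have "\<dots> \<le> K" unfolding K_def using m assms by (intro mult_mono) auto
  finally have K1: "X \<le> p * K" using X1 assms mult_left_mono[of "2 * E * a * W" K p] by linarith
  \<comment> \<open>For \<open>max 1 X\<close> also \<open>1 \<le> p * K\<close> is needed:
    \<open>a \<le> b * X + p\<close> is divided by \<open>a\<close> and \<open>X\<close> replaced by
    its bound \<open>X1\<close>. The summands 2 and 1 make up the 3 in \<open>K\<close>.\<close>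
  have "a * V \<le> (b * X + p) * V" using assms m by (intro mult_right_mono) auto
  hence "1 \<le> (b * X + p) * V" using assms by (simp add: V_def)
  also have "\<dots> \<le> (b * (p * (2 * E * a * W)) + p) * V"
    using X1 assms m by (intro mult_right_mono add_mono mult_left_mono) auto
  also have "\<dots> = p * (2 * E * b * W + V)" using assms by (simp add: V_def field_simps)
  finally have one: "1 \<le> p * (2 * E * b * W + V)" .
  have "2 * E * b * W \<le> 2 * E * mb * mW" using m assms by (intro mult_mono) auto
  also have "\<dots> = 2 * E * mb * mW * 1" by simp
  also have "\<dots> \<le> 2 * E * mb * mW * mV" using m assms by (intro mult_left_mono) auto
  finally have 1: "2 * E * b * W \<le> 2 * E * mb * mW * mV" .
  have "V \<le> 1 * 1 * 1 * mV" using m by simp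
  also have "\<dots> \<le> E * mb * mW * mV" using m assms by (intro mult_mono) auto
  finally have 2: "V \<le> E * mb * mW * mV" .
  have "2 * E * b * W + V \<le> 3 * E * 1 * mb * mW * mV" using 1 2 by simp
  also have "\<dots> \<le> K" unfolding K_def using m assms by (intro mult_mono) auto
  finally have K2: "1 \<le> p * K" using one assms mult_left_mono[of "2 * E * b * W + V" K p] by linarith
  have Kp: "K > 0" unfolding K_def using m assms by (intro mult_pos_pos) auto
  have "lnp X = ln (max 1 X)" by (rule lnp_eq)
  also have "\<dots> \<le> ln (p * K)" using K1 K2 by (subst ln_le_cancel_iff) auto
  also have "\<dots> = ln p + ln K" using Kp assms by (simp add: ln_mult)
  also have "ln K = ln 3 + ln E + ln ma + ln mb + ln mW + ln mV"
    unfolding K_def using m assms by (simp add: ln_mult)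
  finally show ?thesis by (simp add: lnp_eq ma_def mb_def mW_def mV_def)
qed

text \<open>If \<open>\<phi> = A exp h - \<alpha>\<close> divides
  \<open>\<delta> \<noteq> 0\<close>, the mean of \<open>ln |\<phi>|\<close> is at most
  \<open>T(r, \<delta>)\<close> plus a constant, since that of \<open>ln |\<kappa>|\<close> is
  bounded below whatever the growth of \<open>\<kappa>\<close>. Integrating
  \<open>lnp_unit_bound\<close> bounds \<open>\<tau>\<close> by this mean plus small terms, so
  \<open>\<tau>\<close> would be small.\<close>

theorem second_main_theorem:
  assumes A: "small A" "\<exists>z. A z \<noteq> 0" and \<alpha>: "small \<alpha>" "\<exists>z. \<alpha> z \<noteq> 0"
    and \<kappa>: "entire \<kappa>" and \<delta>: "small \<delta>" and eq: "\<And>z. (A z * exp (h z) - \<alpha> z) * \<kappa> z = \<delta> z"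
  shows "\<delta> z = 0"
proof (rule ccontr)
  assume "\<delta> z \<noteq> 0"
  hence \<delta>0: "\<exists>z. \<delta> z \<noteq> 0" by blast
  define \<phi> where "\<phi> = (\<lambda>z. A z * exp (h z) - \<alpha> z)"
  have e\<phi>: "entire \<phi>" unfolding \<phi>_def by (intro entire_intros small_entire A \<alpha> h)
  have t\<phi>: "tame \<phi>" unfolding \<phi>_def by (intro tame_diff tame_mult tame_exp subexp_h small_tame A \<alpha>)
  have \<phi>0: "\<exists>z. \<phi> z \<noteq> 0" and \<kappa>0: "\<exists>z. \<kappa> z \<noteq> 0" using \<delta>0 eq unfolding \<phi>_def by (metis mult_zero_left, metis mult_zero_right)
  note es = small_entire[OF A(1)] small_entire[OF \<alpha>(1)] small_entire[OF \<delta>]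
  define w where "w = (\<lambda>z. A z * deriv \<alpha> z - (deriv A z + A z * deriv h z) * \<alpha> z)"
  have sw: "small w" unfolding w_def
    by (intro small_diff small_mult small_add small_deriv A \<alpha> small_subexp subexp_deriv subexp_h h entire_deriv)
  have dB: "deriv (\<lambda>z. A z * exp (h z)) z = (deriv A z + A z * deriv h z) * exp (h z)" for z
    by (rule DERIV_imp_deriv) (auto intro!: derivative_eq_intros entire_field_derivative es h simp: algebra_simps)
  have d\<phi>: "deriv \<phi> z = (deriv A z + A z * deriv h z) * exp (h z) - deriv \<alpha> z" for z
    unfolding \<phi>_def
    by (rule DERIV_imp_deriv) (auto intro!: derivative_eq_intros entire_field_derivative es h simp: algebra_simps)
  \<comment> \<open>A vanishing Wronskian would make \<open>A exp h\<close> a constant multiple of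
    \<open>\<alpha>\<close>, hence small.\<close>
  have w0: "\<exists>z. w z \<noteq> 0"
  proof (rule ccontr)
    assume "\<not> (\<exists>z. w z \<noteq> 0)"
    hence w0: "A z * deriv \<alpha> z = (deriv A z + A z * deriv h z) * \<alpha> z" for z by (simp add: w_def)
    obtain k where "\<And>z. A z * exp (h z) = k * \<alpha> z"
    proof (rule linear_dependence_of_Wronskian[of "\<lambda>z. A z * exp (h z)" \<alpha>])
      fix z
      have "deriv (\<lambda>z. A z * exp (h z)) z * \<alpha> z = ((deriv A z + A z * deriv h z) * \<alpha> z) * exp (h z)" unfolding dB by simp
      thus "deriv (\<lambda>z. A z * exp (h z)) z * \<alpha> z = A z * exp (h z) * deriv \<alpha> z" unfolding w0[symmetric] by simp
    qed (use es h \<alpha> in \<open>auto intro!: entire_intros\<close>)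
    thus False using unit_quotient_not_small[OF A small_mult[OF small_const \<alpha>(1)]] by blast
  qed
  obtain C where C: "\<And>r. r \<ge> 1 \<Longrightarrow> (\<And>z. cmod z = r \<Longrightarrow> \<kappa> z \<noteq> 0) \<Longrightarrow> cavg r (\<lambda>z. ln (cmod (\<kappa> z))) \<ge> C"
    using Jensen_lower[OF \<kappa> \<kappa>0] by blast
  define G where "G = (\<lambda>r. char_T \<delta> r + (ln 3 - C) + char_T \<alpha> r + char_T A r + mi w r + mi \<alpha> r)"
  have sG: "sml G" unfolding G_def by (intro sml_add sml_const small_sml sml_mi A \<alpha> sw w0 \<delta>)
  have main: "\<forall>\<^sub>F r in F. \<tau> r \<le> G r + e * r" if e: "e > 0" for e
    using nevF[OF log_deriv[OF e\<phi> t\<phi> \<phi>0 e]] nevF[OF log_deriv[OF es(2) small_tame[OF \<alpha>(1)] \<alpha>(2) e]]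
      nevF[OF eventually_nev_nonzero[OF es(3) \<delta>0]] nevF[OF eventually_nev_nonzero[OF es(2) \<alpha>(2)]]
      nevF[OF eventually_nev_nonzero[OF small_entire[OF sw] w0]] topF[OF eventually_ge_at_top[of 1]]
  proof eventually_elim
    case (elim r)
    have nz: "\<phi> z \<noteq> 0" "\<kappa> z \<noteq> 0" if "cmod z = r" for z
      using elim(3)[rule_format, OF that] eq[of z] by (auto simp: \<phi>_def)
    have r: "r \<ge> 0" using elim by simp
    have c: "continuous_on (sphere 0 r) u" if "entire u" for u using entire_continuous[OF that] .
    note cs = c[OF e\<phi>] c[OF \<kappa>] c[OF es(1)] c[OF es(2)] c[OF es(3)] c[OF small_entire[OF sw]] c[OF h]
    have nzc: "\<forall>z\<in>sphere 0 r. cmod (\<phi> z) \<noteq> 0" "\<forall>z\<in>sphere 0 r. cmod (w z) \<noteq> 0" "\<forall>z\<in>sphere 0 r. cmod (\<alpha> z) \<noteq> 0"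
       "\<forall>z\<in>sphere 0 r. cmod (\<kappa> z) \<noteq> 0" "\<forall>z\<in>sphere 0 r. cmod (\<delta> z) \<noteq> 0"
      using nz elim by auto
    have "\<tau> r \<le> cavg r (\<lambda>z. ln (cmod (\<phi> z)) + (ln 3 + e * r + lnp (cmod (\<alpha> z)) + lnp (cmod (A z)) + lnp (1 / cmod (w z)) + lnp (1 / cmod (\<alpha> z))))"
      unfolding \<tau>_def char_T_eq
    proof (rule cavg_mono)
      fix z assume z: "cmod z = r"
      have "lnp (cmod (exp (h z))) \<le> ln (cmod (\<phi> z)) + (ln 3 + ln (exp (e * r)) + lnp (cmod (\<alpha> z)) + lnp (cmod (A z)) + lnp (1 / cmod (w z)) + lnp (1 / cmod (\<alpha> z)))"
      proof (rule lnp_unit_bound)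
        have "exp (h z) * w z = \<phi> z * deriv \<alpha> z - deriv \<phi> z * \<alpha> z"
          unfolding d\<phi> w_def by (simp add: \<phi>_def algebra_simps)
        hence "cmod (exp (h z)) * cmod (w z) \<le> cmod (\<phi> z) * cmod (deriv \<alpha> z) + cmod (deriv \<phi> z) * cmod (\<alpha> z)"
          by (metis norm_mult norm_triangle_ineq4)
        also have "\<dots> \<le> cmod (\<phi> z) * (exp (e * r) * cmod (\<alpha> z)) + (exp (e * r) * cmod (\<phi> z)) * cmod (\<alpha> z)"
          using elim(1,2) z by (intro add_mono mult_left_mono mult_right_mono) auto
        finally show "cmod (exp (h z)) * cmod (w z) \<le> 2 * exp (e * r) * cmod (\<phi> z) * cmod (\<alpha> z)" by (simp add: algebra_simps)
        have "\<alpha> z = A z * exp (h z) - \<phi> z" by (simp add: \<phi>_def)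
        thus "cmod (\<alpha> z) \<le> cmod (A z) * cmod (exp (h z)) + cmod (\<phi> z)"
          by (metis norm_mult norm_triangle_ineq4)
        show "1 \<le> exp (e * r)" using e r by simp
      qed (use elim nz z in auto)
      thus "lnp (cmod (exp (h z))) \<le> ln (cmod (\<phi> z)) + (ln 3 + e * r + lnp (cmod (\<alpha> z)) + lnp (cmod (A z)) + lnp (1 / cmod (w z)) + lnp (1 / cmod (\<alpha> z)))"
        by (simp only: ln_exp)
    qed (intro continuous_intros cs nzc r)+
    also have "\<dots> = cavg r (\<lambda>z. ln (cmod (\<phi> z))) + (ln 3 + e * r + char_T \<alpha> r + char_T A r + mi w r + mi \<alpha> r)"
      unfolding char_T_eq mi_def
      by (rule cavg_sum_five) (intro continuous_intros cs nzc r)+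
    also have "cavg r (\<lambda>z. ln (cmod (\<phi> z))) = cavg r (\<lambda>z. ln (cmod (\<delta> z)) - ln (cmod (\<kappa> z)))"
    proof (rule cavg_cong[OF _ r])
      fix z assume z: "cmod z = r"
      have "cmod (\<delta> z) = cmod (\<phi> z) * cmod (\<kappa> z)" unfolding eq[of z, symmetric] \<phi>_def by (rule norm_mult)
      thus "ln (cmod (\<phi> z)) = ln (cmod (\<delta> z)) - ln (cmod (\<kappa> z))" using nz[OF z] by (simp add: ln_mult)
    qed
    also have "\<dots> = cavg r (\<lambda>z. ln (cmod (\<delta> z))) - cavg r (\<lambda>z. ln (cmod (\<kappa> z)))"
      by (rule cavg_diff) (intro continuous_intros cs nzc r)+
    also have "cavg r (\<lambda>z. ln (cmod (\<delta> z))) \<le> char_T \<delta> r"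
      unfolding char_T_eq
    proof (rule cavg_mono)
      show "ln (cmod (\<delta> z)) \<le> lnp (cmod (\<delta> z))" if "cmod z = r" for z
        using elim(3) that by (intro ln_le_lnp) auto
    qed (intro continuous_intros cs nzc r)+
    finally show ?case using C[of r] elim(6) nz(2) by (simp add: G_def)
  qed
  have "sml \<tau>" unfolding sml_def
  proof (intro allI impI)
    fix \<epsilon> :: real assume e: "\<epsilon> > 0"
    obtain c where c: "c > 0" "\<forall>\<^sub>F r in at_top. c * r \<le> \<tau> r" using tau_linear by blast
    have e1: "\<epsilon> / 2 * c > 0" using e c by simp
    have "\<forall>\<^sub>F r in F. G r \<le> \<epsilon> / 2 * \<tau> r" using sG e unfolding sml_def by (auto dest!: spec[of _ "\<epsilon> / 2"])
    with main[OF e1] topF[OF c(2)] show "\<forall>\<^sub>F r in F. \<tau> r \<le> \<epsilon> * \<tau> r"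
    proof eventually_elim
      case (elim r)
      have "\<epsilon> / 2 * (c * r) \<le> \<epsilon> / 2 * \<tau> r" using elim(2) e by (intro mult_left_mono) auto
      thus ?case using elim by simp
    qed
  qed
  thus False using not_sml_tau by blast
qed

end

section \<open>Sharing two small functions\<close>

lemma subexp_shift: "subexp u \<Longrightarrow> subexp (\<lambda>z. u (z + 1))"
proof (rule subexp_transfer[of u 0])
  fix r :: real and z :: complex assume "cmod z \<le> r"
  hence "cmod (z + 1) \<le> r + 1" using norm_triangle_ineq[of z 1] by simp
  thus "\<exists>w. cmod w \<le> r + 1 \<and> cmod (u (z + 1)) \<le> cmod (u w)" by blast
qed

lemma subexp_diff: "subexp u \<Longrightarrow> subexp v \<Longrightarrow> subexp (\<lambda>z. u z - v z)"
  using subexp_add[OF _ subexp_mult[OF subexp_const[of "-1"]], of u v] by simp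

lemma entire_mult_eq_0:
  assumes "entire u" "entire v" "\<And>z. u z * v z = 0" "\<exists>z. u z \<noteq> 0"
  shows "v z = 0"
proof -
  obtain z0 where z0: "u z0 \<noteq> 0" using assms(4) by blast
  obtain e where e: "e > 0" "ball z0 e \<subseteq> {z. u z \<noteq> 0}"
    by (rule openE[OF entire_open_nonzero[OF assms(1)], of z0]) (use z0 in simp_all)
  show ?thesis
  proof (rule analytic_continuation_open[of "ball z0 e" UNIV v "\<lambda>z. 0"])
    show "ball z0 e \<noteq> {}" using e(1) by simp
    show "v z = 0" if "z \<in> ball z0 e" for z using assms(3)[of z] e(2) that by auto
    show "v holomorphic_on UNIV" by (rule entire_holo[OF assms(2)])
  qed (simp_all add: connected_UNIV)
qed

section \<open>Multiplicities and divisibility of entire functions\<close>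

lemma zmult_power:
  assumes "entire G" "G a \<noteq> 0" "\<And>z. F z = (z - a) ^ n * G z"
  shows "zmult F a = enat n"
proof (cases "n = 0")
  case True thus ?thesis using assms by (simp add: zmult_def enat_0)
next
  case False
  have "zorder F a = int n"
  proof (rule zorder_eqI[of UNIV a G])
    show "F w = G w * (w - a) powi int n" if "w \<in> UNIV" "w \<noteq> a" for w
      using assms(3)[of w] by (simp add: mult.commute)
  qed (use assms entire_holo in auto)
  moreover have "\<not> (\<forall>\<^sub>F w in at a. F w = 0)"
  proof
    assume ev: "\<forall>\<^sub>F w in at a. F w = 0"
    have "\<forall>\<^sub>F w in at a. w \<in> {z. G z \<noteq> 0}"
      using entire_open_nonzero[OF assms(1)] assms(2) by (intro eventually_at_in_open') auto
    moreover have "\<forall>\<^sub>F w in at a. w \<noteq> a" by (rule eventually_neq_at_within)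
    ultimately have "\<forall>\<^sub>F w in at a. False"
      using ev by eventually_elim (use assms(3) in auto)
    thus False by simp
  qed
  ultimately show ?thesis using False assms(3)[of a] by (simp add: zmult_def)
qed

lemma zmult_mult:
  assumes "entire u" "\<exists>z. u z \<noteq> 0" "entire v" "\<exists>z. v z \<noteq> 0"
  shows "zmult (\<lambda>z. u z * v z) a = zmult u a + zmult v a"
proof -
  obtain m u' where u: "entire u'" "u' a \<noteq> 0" "\<And>z. u z = (z - a) ^ m * u' z"
    using entire_divide_power[OF assms(1,2), of a] by blast
  obtain n v' where v: "entire v'" "v' a \<noteq> 0" "\<And>z. v z = (z - a) ^ n * v' z"
    using entire_divide_power[OF assms(3,4), of a] by blast
  have "zmult (\<lambda>z. u z * v z) a = enat (m + n)"
  proof (rule zmult_power[of "\<lambda>z. u' z * v' z"])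
    show "u z * v z = (z - a) ^ (m + n) * (u' z * v' z)" for z by (simp add: u(3) v(3) power_add mult_ac)
  qed (use u v in \<open>auto intro: entire_mult\<close>)
  thus ?thesis using zmult_power[OF u] zmult_power[OF v] by simp
qed

text \<open>Near \<open>a\<close> the quotient is \<open>(z - a) ^ (n - m) * G' / F'\<close>, where
  \<open>F'\<close> and \<open>G'\<close> are cofactors, not derivatives;
  \<open>remove_sings\<close> picks the one global function that agrees with all local ones.\<close>

lemma entire_dvd:
  assumes F: "entire F" "\<exists>z. F z \<noteq> 0" and G: "entire G" "\<exists>z. G z \<noteq> 0" and le: "\<And>z. zmult F z \<le> zmult G z"
  obtains \<kappa> where "entire \<kappa>" "\<And>z. G z = F z * \<kappa> z"
proof -
  have loc: "\<exists>N q. open N \<and> a \<in> N \<and> q holomorphic_on N \<and> (\<forall>z\<in>N. G z = F z * q z) \<and> (\<forall>z\<in>N. z \<noteq> a \<longrightarrow> F z \<noteq> 0)" for a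
  proof -
    obtain m F' where F': "entire F'" "F' a \<noteq> 0" "\<And>z. F z = (z - a) ^ m * F' z"
      using entire_divide_power[OF F, of a] by blast
    obtain n G' where G': "entire G'" "G' a \<noteq> 0" "\<And>z. G z = (z - a) ^ n * G' z"
      using entire_divide_power[OF G, of a] by blast
    have mn: "m \<le> n" using le[of a] zmult_power[OF F'] zmult_power[OF G'] by simp
    define N where "N = {z. F' z \<noteq> 0}"
    define q where "q = (\<lambda>z. (z - a) ^ (n - m) * G' z / F' z)"
    have "q holomorphic_on N" unfolding q_def
      by (intro holomorphic_intros entire_holo F' G') (auto simp: N_def)
    moreover have "G z = F z * q z" if "z \<in> N" for z
    proof -
      have "(z - a) ^ n = (z - a) ^ m * (z - a) ^ (n - m)" using mn by (simp flip: power_add)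
      thus ?thesis using that by (simp add: F'(3) G'(3) q_def N_def)
    qed
    moreover have "open N" "a \<in> N" unfolding N_def using entire_open_nonzero[OF F'(1)] F'(2) by auto
    moreover have "F z \<noteq> 0" if "z \<in> N" "z \<noteq> a" for z using that by (simp add: F'(3) N_def)
    ultimately show ?thesis by blast
  qed
  define \<kappa> where "\<kappa> = remove_sings (\<lambda>z. G z / F z)"
  have eq: "\<kappa> z = q z" if "open N" "a \<in> N" "q holomorphic_on N" "\<forall>z\<in>N. G z = F z * q z" "\<forall>z\<in>N. z \<noteq> a \<longrightarrow> F z \<noteq> 0" "z \<in> N" for N a q z
  proof -
    have "isCont q z" using that(1,3,6) by (meson continuous_on_eq_continuous_at holomorphic_on_imp_continuous_on)
    hence "q \<midarrow>z\<rightarrow> q z" by (simp add: isCont_def)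
    moreover have "\<forall>\<^sub>F w in at z. q w = G w / F w"
    proof (cases "z = a")
      case True
      have "\<forall>\<^sub>F w in at z. w \<in> N - {z}" using that(1,6) by (intro eventually_at_in_open) auto
      thus ?thesis by eventually_elim (use that True in auto)
    next
      case False
      have "\<forall>\<^sub>F w in at z. w \<in> N - {a}" using that(1,6) False by (intro eventually_at_in_open') auto
      thus ?thesis by eventually_elim (use that in auto)
    qed
    ultimately have "(\<lambda>w. G w / F w) \<midarrow>z\<rightarrow> q z" by (rule Lim_transform_eventually)
    thus ?thesis unfolding \<kappa>_def by (rule remove_sings_eqI)
  qed
  have "\<kappa> field_differentiable at a" and mult: "G a = F a * \<kappa> a" for a
  proof -
    obtain N q where N: "open N" "a \<in> N" "q holomorphic_on N" "\<forall>z\<in>N. G z = F z * q z" "\<forall>z\<in>N. z \<noteq> a \<longrightarrow> F z \<noteq> 0"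
      using loc[of a] by blast
    have "\<kappa> holomorphic_on N" by (rule holomorphic_transform[OF N(3)]) (rule eq[OF N, symmetric])
    thus "\<kappa> field_differentiable at a" using N(1,2) holomorphic_on_imp_differentiable_at by blast
    show "G a = F a * \<kappa> a" using N(4) N(2) eq[OF N N(2)] by simp
  qed
  hence "entire \<kappa>" unfolding entire_def holomorphic_on_def by (simp add: field_differentiable_at_within)
  thus ?thesis using that mult by blast
qed

context unit_filter
begin

text \<open>The difference analogue of the logarithmic derivative estimate, and the reason for the
  doubling filter: \<open>cavg_difference_le\<close> at \<open>\<rho> = r + 1 + K\<close> gives a
  factor \<open>2 / K\<close>, and doubling brings \<open>\<tau> \<rho>\<close> back to
  \<open>2 * \<tau> r\<close>.\<close>

lemma small_unit_difference: "small (\<lambda>z. exp (h (z + 1) - h z))"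
  unfolding small_def
proof (intro conjI)
  have ed: "entire (\<lambda>z. h (z + 1) - h z)" by (intro entire_diff entire_shift h)
  show "entire (\<lambda>z. exp (h (z + 1) - h z))" by (rule entire_exp[OF ed])
  show "tame (\<lambda>z. exp (h (z + 1) - h z))" by (intro tame_exp subexp_diff subexp_shift subexp_h)
  show "sml (char_T (\<lambda>z. exp (h (z + 1) - h z)))" unfolding sml_def
  proof (intro allI impI)
    fix \<epsilon> :: real assume e: "\<epsilon> > 0"
    \<comment> \<open>Chosen so that the main term \<open>2 / K * (4 * \<tau> r)\<close> is
      \<open>\<epsilon> / 2 * \<tau> r\<close>.\<close>
    define K where "K = 16 / \<epsilon>"
    have K: "K > 0" using e by (simp add: K_def)
    have "\<forall>\<^sub>F r in F. 2 / K * cmod (h 0) \<le> \<epsilon> / 2 * \<tau> r" using sml_const[of "2 / K * cmod (h 0)"] e unfolding sml_def by (auto dest!: spec[of _ "\<epsilon> / 2"])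
    with doubling[of "1 + K"] topF[OF eventually_ge_at_top[of 1]]
    show "\<forall>\<^sub>F r in F. char_T (\<lambda>z. exp (h (z + 1) - h z)) r \<le> \<epsilon> * \<tau> r"
    proof eventually_elim
      case (elim r)
      let ?\<rho> = "r + (1 + K)"
      have "char_T (\<lambda>z. exp (h (z + 1) - h z)) r \<le> cavg r (\<lambda>z. cmod (h (z + 1) - h z))"
        unfolding char_T_eq
      proof (rule cavg_mono)
        fix z
        have "lnp (cmod (exp (h (z + 1) - h z))) = max 0 (Re (h (z + 1) - h z))" by (simp add: lnp_def)
        thus "lnp (cmod (exp (h (z + 1) - h z))) \<le> cmod (h (z + 1) - h z)"
          using complex_Re_le_cmod[of "h (z + 1) - h z"] by simp
      next
        show "continuous_on (sphere 0 r) (\<lambda>z. lnp (cmod (exp (h (z + 1) - h z))))"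
          by (intro continuous_on_lnp continuous_on_norm entire_continuous entire_exp ed)
        show "continuous_on (sphere 0 r) (\<lambda>z. cmod (h (z + 1) - h z))"
          by (intro continuous_on_norm entire_continuous ed)
      qed (use elim in simp)
      also have "\<dots> \<le> 2 / (?\<rho> - 1 - r) * cavg ?\<rho> (\<lambda>w. \<bar>Re (h w)\<bar>)"
        by (rule cavg_difference_le[OF h]) (use elim K in auto)
      also have "cavg ?\<rho> (\<lambda>w. \<bar>Re (h w)\<bar>) = 2 * \<tau> ?\<rho> - Re (h 0)" by (rule cavg_abs_Re) (use elim K in auto)
      also have "2 / (?\<rho> - 1 - r) * (2 * \<tau> ?\<rho> - Re (h 0)) \<le> 2 / K * (2 * (2 * \<tau> r) + cmod (h 0))"
      proof -
        have "2 * \<tau> ?\<rho> - Re (h 0) \<le> 2 * (2 * \<tau> r) + cmod (h 0)"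
          using elim(1) abs_Re_le_cmod[of "h 0"] by linarith
        moreover have "?\<rho> - 1 - r = K" by simp
        ultimately show ?thesis using K by (simp only:) (rule mult_left_mono, simp_all)
      qed
      also have "\<dots> = 2 / K * (4 * \<tau> r) + 2 / K * cmod (h 0)" by (simp only: distrib_left)
      also have "2 / K * (4 * \<tau> r) = \<epsilon> / 2 * \<tau> r" using e unfolding K_def by simp
      finally show ?case using elim(3) by simp
    qed
  qed
qed

lemma small_nev:
  assumes u: "entire u" "tame u" and s: "\<And>\<epsilon>. \<epsilon> > 0 \<Longrightarrow> \<forall>\<^sub>F r in nev. char_T u r \<le> \<epsilon> * \<tau> r"
  shows "small u"
  unfolding small_def sml_def by (intro conjI u allI impI nevF s)

text \<open>Smallness is assumed along \<open>nev\<close> rather than \<open>F\<close>: the enlarged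
  radius \<open>\<rho>\<close> in \<open>[r + 2, r + 3]\<close> is chosen off an exceptional set and
  off the moduli of zeros, and need not stay in the intervals behind \<open>F\<close>.\<close>

lemma small_nev_shift:
  assumes u: "entire u" "tame u" and s: "\<And>\<epsilon>. \<epsilon> > 0 \<Longrightarrow> \<forall>\<^sub>F r in nev. char_T u r \<le> \<epsilon> * \<tau> r"
  shows "small (\<lambda>z. u (z + 1))"
proof (cases "\<exists>z. u z \<noteq> 0")
  case True
  have "sml (char_T (\<lambda>z. u (z + 1)))" unfolding sml_def
  proof (intro allI impI)
    fix \<epsilon> :: real assume e: "\<epsilon> > 0"
    \<comment> \<open>The loss is 3 from \<open>(\<rho> + 1) / (\<rho> - 1)\<close> with
      \<open>\<rho> \<ge> 2\<close>, times 2 from doubling.\<close>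
    hence e6: "\<epsilon> / 6 > 0" by simp
    have "\<forall>\<^sub>F t in at_top. \<exists>\<rho>\<in>{t..t + 1}. char_T u \<rho> \<le> \<epsilon> / 6 * \<tau> \<rho> \<and> (\<forall>z. cmod z = \<rho> \<longrightarrow> u z \<noteq> 0)"
      by (intro nev_imp_at_top eventually_conj s[OF e6] eventually_nev_nonzero[OF u(1) True])
    hence "\<forall>\<^sub>F r in at_top. \<exists>\<rho>\<in>{r + 2..r + 2 + 1}. char_T u \<rho> \<le> \<epsilon> / 6 * \<tau> \<rho> \<and> (\<forall>z. cmod z = \<rho> \<longrightarrow> u z \<noteq> 0)"
      by (rule eventually_compose_filterlim) real_asymp
    from topF[OF this] doubling[of 3] topF[OF eventually_gt_at_top[of 0]]
    show "\<forall>\<^sub>F r in F. char_T (\<lambda>z. u (z + 1)) r \<le> \<epsilon> * \<tau> r"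
    proof eventually_elim
      case (elim r)
      from elim(1) obtain \<rho> where "\<rho> \<in> {r + 2..r + 2 + 1}"
        and \<rho>': "char_T u \<rho> \<le> \<epsilon> / 6 * \<tau> \<rho>" "\<forall>z. cmod z = \<rho> \<longrightarrow> u z \<noteq> 0" by blast
      hence \<rho>: "r + 2 \<le> \<rho>" "\<rho> \<le> r + 3" by simp_all
      have nz: "\<And>z. cmod z = \<rho> \<Longrightarrow> u z \<noteq> 0" using \<rho>'(2) by blast
      have "char_T (\<lambda>z. u (z + 1)) r \<le> (\<rho> + cmod 1) / (\<rho> - cmod 1) * char_T u \<rho>"
        by (rule char_T_shift[OF u(1) nz]) (use elim(3) \<rho> in simp_all)
      also have "\<dots> \<le> 3 * char_T u \<rho>"
      proof (intro mult_right_mono char_T_nonneg u)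
        show "(\<rho> + cmod 1) / (\<rho> - cmod 1) \<le> 3" using \<rho>(1) elim(3) by (simp add: divide_le_eq)
      qed (use \<rho>(1) elim(3) in simp)
      also have "\<dots> \<le> 3 * (\<epsilon> / 6 * \<tau> \<rho>)" using \<rho>'(1) by simp
      also have "\<dots> \<le> 3 * (\<epsilon> / 6 * (2 * \<tau> r))"
      proof -
        have "\<tau> \<rho> \<le> \<tau> (r + 3)" using \<rho> elim(3) by (intro tau_mono) simp_all
        hence "\<tau> \<rho> \<le> 2 * \<tau> r" using elim(2) by simp
        thus ?thesis using e by (intro mult_left_mono) simp_all
      qed
      finally show ?case by simp
    qed
  qed
  thus ?thesis using u by (simp add: small_def entire_shift tame_shift)
next
  case False
  hence "u = (\<lambda>z. 0)" by auto
  thus ?thesis using small_const[of 0] by simp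
qed

lemma unit_minus_small_nonzero:
  assumes "small A" "\<exists>z. A z \<noteq> 0" "small \<alpha>"
  shows "\<exists>z. A z * exp (h z) - \<alpha> z \<noteq> 0"
  using unit_quotient_not_small[OF assms] by force

text \<open>Since \<open>A \<psi>1 = B \<phi> + d1\<close> and
  \<open>A \<psi>2 = B \<phi> + d2\<close>, the product \<open>A^2 \<psi>1 \<psi>2\<close> is
  \<open>d1 d2\<close> modulo \<open>\<phi>\<close>. Divisibility makes \<open>\<phi>\<close> a
  factor of the small function \<open>d1 d2\<close>, which must then vanish.\<close>

lemma root_match:
  assumes A: "small A" "\<exists>z. A z \<noteq> 0" and B: "small B" "\<exists>z. B z \<noteq> 0"
    and \<alpha>: "small \<alpha>" "\<exists>z. \<alpha> z \<noteq> 0" and \<beta>1: "small \<beta>1" and \<beta>2: "small \<beta>2"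
    and le: "\<And>z. zmult (\<lambda>z. A z * exp (h z) - \<alpha> z) z \<le>
        zmult (\<lambda>z. B z * exp (h z) - \<beta>1 z) z + zmult (\<lambda>z. B z * exp (h z) - \<beta>2 z) z"
  shows "(\<forall>z. B z * \<alpha> z = A z * \<beta>1 z) \<or> (\<forall>z. B z * \<alpha> z = A z * \<beta>2 z)"
proof -
  note ent = small_entire[OF A(1)] small_entire[OF B(1)] small_entire[OF \<alpha>(1)] small_entire[OF \<beta>1] small_entire[OF \<beta>2]
  define \<phi> where "\<phi> = (\<lambda>z. A z * exp (h z) - \<alpha> z)"
  define \<psi>1 where "\<psi>1 = (\<lambda>z. B z * exp (h z) - \<beta>1 z)"
  define \<psi>2 where "\<psi>2 = (\<lambda>z. B z * exp (h z) - \<beta>2 z)"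
  have e: "entire \<phi>" "entire \<psi>1" "entire \<psi>2" unfolding \<phi>_def \<psi>1_def \<psi>2_def
    by (intro entire_diff entire_mult entire_exp ent h)+
  have nz: "\<exists>z. \<phi> z \<noteq> 0" "\<exists>z. \<psi>1 z \<noteq> 0" "\<exists>z. \<psi>2 z \<noteq> 0"
    unfolding \<phi>_def \<psi>1_def \<psi>2_def using unit_minus_small_nonzero A B \<alpha>(1) \<beta>1 \<beta>2 by blast+
  have nzp: "\<exists>z. \<psi>1 z * \<psi>2 z \<noteq> 0" using entire_mult_eq_0[OF e(2,3) _ nz(2)] nz(3) by blast
  obtain \<kappa> where \<kappa>: "entire \<kappa>" "\<And>z. \<psi>1 z * \<psi>2 z = \<phi> z * \<kappa> z"
  proof (rule entire_dvd[OF e(1) nz(1) entire_mult[OF e(2,3)] nzp])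
    show "zmult \<phi> z \<le> zmult (\<lambda>z. \<psi>1 z * \<psi>2 z) z" for z
      unfolding zmult_mult[OF e(2) nz(2) e(3) nz(3)] using le[of z] by (simp add: \<phi>_def \<psi>1_def \<psi>2_def)
  qed blast
  define d1 where "d1 = (\<lambda>z. B z * \<alpha> z - A z * \<beta>1 z)"
  define d2 where "d2 = (\<lambda>z. B z * \<alpha> z - A z * \<beta>2 z)"
  define \<mu> where "\<mu> = (\<lambda>z. A z * A z * \<kappa> z - B z * (B z * \<phi> z + d1 z + d2 z))"
  have sd: "small d1" "small d2" unfolding d1_def d2_def by (intro small_diff small_mult A B \<alpha> \<beta>1 \<beta>2)+
  have "d1 z * d2 z = 0" for z
  proof (rule second_main_theorem[OF A \<alpha>, of \<mu> "\<lambda>z. d1 z * d2 z"])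
    show "entire \<mu>" unfolding \<mu>_def
      by (intro entire_diff entire_mult entire_add ent \<kappa> e small_entire[OF sd(1)] small_entire[OF sd(2)])
    show "small (\<lambda>z. d1 z * d2 z)" by (rule small_mult[OF sd])
    fix z
    have 1: "A z * \<psi>1 z = B z * \<phi> z + d1 z" "A z * \<psi>2 z = B z * \<phi> z + d2 z"
      by (simp_all add: \<phi>_def \<psi>1_def \<psi>2_def d1_def d2_def algebra_simps)
    have "A z * A z * (\<phi> z * \<kappa> z) = (A z * \<psi>1 z) * (A z * \<psi>2 z)" unfolding \<kappa>(2)[symmetric] by (simp only: mult_ac)
    also have "\<dots> = \<phi> z * (B z * (B z * \<phi> z + d1 z + d2 z)) + d1 z * d2 z" unfolding 1 by (simp add: algebra_simps)
    finally have "d1 z * d2 z = \<phi> z * \<mu> z" unfolding \<mu>_def by (simp add: algebra_simps)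
    thus "(A z * exp (h z) - \<alpha> z) * \<mu> z = d1 z * d2 z" by (simp add: \<phi>_def)
  qed
  hence "(\<forall>z. d1 z = 0) \<or> (\<forall>z. d2 z = 0)"
    using entire_mult_eq_0[OF small_entire[OF sd(1)] small_entire[OF sd(2)]] by blast
  thus ?thesis by (simp add: d1_def d2_def)
qed

text \<open>\<open>root_match\<close> requires a nonzero small term, so each of \<open>u1\<close>,
  \<open>u2\<close>, \<open>v1\<close>, \<open>v2\<close> is zero or matched; as both pairs are
  distinct, each contains zero at most once, and the pairs coincide as sets. Comparing
  \<open>u1 - u2 = B d\<close> with \<open>v1 - v2 = A d\<close> then gives \<open>A = B\<close> or
  \<open>A = -B\<close>.\<close>

theorem shared_roots:
  assumes A: "small A" "\<exists>z. A z \<noteq> 0" and B: "small B" "\<exists>z. B z \<noteq> 0"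
    and s: "small \<alpha>1" "small \<alpha>2" "small \<beta>1" "small \<beta>2"
    and diff: "\<And>z. \<alpha>1 z - \<alpha>2 z = \<beta>1 z - \<beta>2 z" and ne: "\<exists>z. \<alpha>1 z \<noteq> \<alpha>2 z"
    and share: "\<And>z. zmult (\<lambda>z. A z * exp (h z) - \<alpha>1 z) z + zmult (\<lambda>z. A z * exp (h z) - \<alpha>2 z) z =
        zmult (\<lambda>z. B z * exp (h z) - \<beta>1 z) z + zmult (\<lambda>z. B z * exp (h z) - \<beta>2 z) z"
  shows "(\<forall>z. A z = B z \<and> \<alpha>1 z = \<beta>1 z) \<or> (\<forall>z. A z = - B z \<and> \<alpha>1 z = - \<beta>2 z)"
proof -
  note ent = small_entire[OF A(1)] small_entire[OF B(1)] small_entire[OF s(1)] small_entire[OF s(2)] small_entire[OF s(3)] small_entire[OF s(4)]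
  define d where "d = (\<lambda>z. \<alpha>1 z - \<alpha>2 z)"
  have ed: "entire d" unfolding d_def by (intro entire_diff ent)
  have d0: "\<exists>z. d z \<noteq> 0" using ne by (simp add: d_def)
  have dA: "\<exists>z. A z * d z \<noteq> 0" and dB: "\<exists>z. B z * d z \<noteq> 0"
    using entire_mult_eq_0[OF ent(1) ed _ A(2)] entire_mult_eq_0[OF ent(2) ed _ B(2)] d0 by blast+
  define u1 u2 v1 v2 where "u1 = (\<lambda>z. B z * \<alpha>1 z)" and "u2 = (\<lambda>z. B z * \<alpha>2 z)"
    and "v1 = (\<lambda>z. A z * \<beta>1 z)" and "v2 = (\<lambda>z. A z * \<beta>2 z)"
  have ud: "u1 z - u2 z = B z * d z" "v1 z - v2 z = A z * d z" for z
    using diff[of z] by (simp_all add: u1_def u2_def v1_def v2_def d_def right_diff_distrib[symmetric])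
  have une: "u1 \<noteq> u2" "v1 \<noteq> v2"
  proof -
    show "u1 \<noteq> u2" using dB unfolding ud(1)[symmetric] by auto
    show "v1 \<noteq> v2" using dA unfolding ud(2)[symmetric] by auto
  qed
  let ?z = "\<lambda>z::complex. 0::complex"
  have zm: "zmult (\<lambda>z. A z * exp (h z) - \<alpha>1 z) z \<le> zmult (\<lambda>z. B z * exp (h z) - \<beta>1 z) z + zmult (\<lambda>z. B z * exp (h z) - \<beta>2 z) z"
     "zmult (\<lambda>z. A z * exp (h z) - \<alpha>2 z) z \<le> zmult (\<lambda>z. B z * exp (h z) - \<beta>1 z) z + zmult (\<lambda>z. B z * exp (h z) - \<beta>2 z) z"
     "zmult (\<lambda>z. B z * exp (h z) - \<beta>1 z) z \<le> zmult (\<lambda>z. A z * exp (h z) - \<alpha>1 z) z + zmult (\<lambda>z. A z * exp (h z) - \<alpha>2 z) z"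
     "zmult (\<lambda>z. B z * exp (h z) - \<beta>2 z) z \<le> zmult (\<lambda>z. A z * exp (h z) - \<alpha>1 z) z + zmult (\<lambda>z. A z * exp (h z) - \<alpha>2 z) z" for z
    subgoal unfolding share[symmetric] by (rule add_increasing2) simp_all
    subgoal unfolding share[symmetric] by (rule add_increasing) simp_all
    subgoal unfolding share by (rule add_increasing2) simp_all
    subgoal unfolding share by (rule add_increasing) simp_all
    done
  have r: "u1 = ?z \<or> u1 = v1 \<or> u1 = v2" "u2 = ?z \<or> u2 = v1 \<or> u2 = v2"
     "v1 = ?z \<or> v1 = u1 \<or> v1 = u2" "v2 = ?z \<or> v2 = u1 \<or> v2 = u2"
    subgoal using root_match[OF A B s(1) _ s(3,4) zm(1)] unfolding u1_def u2_def v1_def v2_def fun_eq_iff by fastforce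
    subgoal using root_match[OF A B s(2) _ s(3,4) zm(2)] unfolding u1_def u2_def v1_def v2_def fun_eq_iff by fastforce
    subgoal using root_match[OF B A s(3) _ s(1,2) zm(3)] unfolding u1_def u2_def v1_def v2_def fun_eq_iff by fastforce
    subgoal using root_match[OF B A s(4) _ s(1,2) zm(4)] unfolding u1_def u2_def v1_def v2_def fun_eq_iff by fastforce
    done
  have "(u1 = v1 \<and> u2 = v2) \<or> (u1 = v2 \<and> u2 = v1)" using r une by metis
  thus ?thesis
  proof
    assume c: "u1 = v1 \<and> u2 = v2"
    have "d z * (A z - B z) = 0" for z
    proof -
      have "d z * (A z - B z) = A z * d z - B z * d z" by (simp add: algebra_simps)
      also have "\<dots> = 0" unfolding ud[symmetric] using c by simp
      finally show ?thesis .
    qed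
    hence "A z - B z = 0" for z using entire_mult_eq_0[OF ed entire_diff[OF ent(1,2)] _ d0] by blast
    hence AB: "A z = B z" for z by simp
    have "A z * (\<alpha>1 z - \<beta>1 z) = 0" for z
    proof -
      have "A z * (\<alpha>1 z - \<beta>1 z) = u1 z - v1 z" unfolding u1_def v1_def AB by (rule right_diff_distrib)
      thus ?thesis using c by simp
    qed
    hence "\<alpha>1 z - \<beta>1 z = 0" for z using entire_mult_eq_0[OF ent(1) entire_diff[OF ent(3,5)] _ A(2)] by blast
    thus ?thesis using AB by simp
  next
    assume c: "u1 = v2 \<and> u2 = v1"
    have "d z * (A z + B z) = 0" for z
    proof -
      have "d z * (A z + B z) = A z * d z + B z * d z" by (simp add: algebra_simps)
      also have "\<dots> = 0" unfolding ud[symmetric] using c by simp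
      finally show ?thesis .
    qed
    hence "A z + B z = 0" for z using entire_mult_eq_0[OF ed entire_add[OF ent(1,2)] _ d0] by blast
    hence AB: "A z = - B z" for z by (simp add: eq_neg_iff_add_eq_0)
    have "B z * (\<alpha>1 z + \<beta>2 z) = 0" for z
    proof -
      have "B z * (\<alpha>1 z + \<beta>2 z) = u1 z - v2 z" unfolding u1_def v2_def AB by (simp add: distrib_left)
      thus ?thesis using c by simp
    qed
    hence "\<alpha>1 z + \<beta>2 z = 0" for z using entire_mult_eq_0[OF ent(2) entire_add[OF ent(3,6)] _ B(2)] by blast
    hence "\<alpha>1 z = - \<beta>2 z" for z by (simp add: eq_neg_iff_add_eq_0)
    thus ?thesis using AB by simp
  qed
qed

end

section \<open>Growth estimates and the exponential form\<close>

lemma lnp_le_imp: "lnp x \<le> y \<Longrightarrow> x \<le> exp y"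
proof (cases "x \<le> 1")
  case True
  assume "lnp x \<le> y"
  hence "0 \<le> y" using lnp_nonneg[of x] by linarith
  thus ?thesis using True by (meson one_le_exp_iff order_trans)
next
  case False
  assume "lnp x \<le> y"
  hence "ln x \<le> y" using False by (simp add: lnp_def)
  hence "exp (ln x) \<le> exp y" by (simp only: exp_le_cancel_iff)
  moreover have "exp (ln x) = x" using False by (intro exp_ln) linarith
  ultimately show ?thesis by (simp only:)
qed

lemma hyper_order_growth:
  assumes "hyper_order f < 1" "\<eta> > 0"
  shows "\<forall>\<^sub>F r in at_top. char_T f r \<le> exp (\<eta> * r)"
proof -
  have "Limsup at_top (\<lambda>r. ereal (lnp (lnp (char_T f r)) / ln r)) < ereal 1"
    using assms(1) by (simp add: hyper_order_def one_ereal_def)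
  then obtain s where s: "Limsup at_top (\<lambda>r. ereal (lnp (lnp (char_T f r)) / ln r)) < ereal s" "ereal s < ereal 1"
    using ereal_dense2 by blast
  \<comment> \<open>The bound \<open>s\<close> from the limsup may be negative; enlarging it gives
    an exponent strictly between 0 and 1.\<close>
  define t where "t = max s (1 / 2)"
  have t: "0 < t" "t < 1" "s \<le> t" using s(2) by (auto simp: t_def)
  have 1: "\<forall>\<^sub>F r in at_top. ereal (lnp (lnp (char_T f r)) / ln r) < ereal s"
    by (rule Limsup_lessD[OF s(1)])
  have 2: "\<forall>\<^sub>F r in at_top. exp (t * ln r) \<le> \<eta> * r" using t assms(2) by real_asymp
  have 3: "\<forall>\<^sub>F r::real in at_top. r > 1" by (rule eventually_gt_at_top)
  show ?thesis using 1 2 3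
  proof eventually_elim
    case (elim r)
    have ln: "ln r > 0" using elim(3) by simp
    have "lnp (lnp (char_T f r)) < s * ln r" using elim(1) ln by (simp add: divide_less_eq)
    also have "\<dots> \<le> t * ln r" using t ln by (intro mult_right_mono) auto
    finally have "lnp (char_T f r) \<le> exp (t * ln r)" by (intro lnp_le_imp) simp
    also have "\<dots> \<le> \<eta> * r" by (rule elim(2))
    finally show ?case by (rule lnp_le_imp)
  qed
qed

text \<open>Some \<open>\<rho>\<close> in \<open>[2 r, 2 r + 1]\<close> is unexceptional and
  zero-free, and \<open>|z| \<le> \<rho> / 2\<close> makes the Poisson factor at most 3. The
  exceptional set disappears since a bound on a larger disc covers the smaller one.\<close>

lemma sup_bound_of_char_T:
  assumes u: "entire u" and T: "\<forall>\<^sub>F r in nev. char_T u r \<le> b r" and b: "\<And>r s. 1 \<le> r \<Longrightarrow> r \<le> s \<Longrightarrow> b r \<le> b s"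
  shows "\<forall>\<^sub>F r in at_top. \<forall>z. cmod z \<le> r \<longrightarrow> lnp (cmod (u z)) \<le> 3 * b (2 * r + 1)"
proof -
  \<comment> \<open>The zero function has no zero-free circle and is carried along as a separate
    alternative.\<close>
  have "\<forall>\<^sub>F r in nev. char_T u r \<le> b r \<and> ((\<forall>z. cmod z = r \<longrightarrow> u z \<noteq> 0) \<or> (\<forall>z. u z = 0))"
  proof (cases "\<exists>z. u z \<noteq> 0")
    case True
    show ?thesis using T eventually_nev_nonzero[OF u True] by eventually_elim blast
  next
    case False
    show ?thesis using T by eventually_elim (use False in blast)
  qed
  from nev_imp_at_top[OF this]
  have "\<forall>\<^sub>F r in at_top. \<exists>\<rho>\<in>{2 * r..2 * r + 1}. char_T u \<rho> \<le> b \<rho> \<and> ((\<forall>z. cmod z = \<rho> \<longrightarrow> u z \<noteq> 0) \<or> (\<forall>z. u z = 0))"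
    by (rule eventually_compose_filterlim) real_asymp
  moreover have "\<forall>\<^sub>F r::real in at_top. r \<ge> 1" by (rule eventually_ge_at_top)
  ultimately show ?thesis
  proof eventually_elim
    case (elim r)
    from elim(1) obtain \<rho> where "\<rho> \<in> {2 * r..2 * r + 1}" and T\<rho>: "char_T u \<rho> \<le> b \<rho>"
      and nz: "(\<forall>z. cmod z = \<rho> \<longrightarrow> u z \<noteq> 0) \<or> (\<forall>z. u z = 0)" by blast
    hence \<rho>: "2 * r \<le> \<rho>" "\<rho> \<le> 2 * r + 1" by simp_all
    have T0: "0 \<le> char_T u \<rho>" by (rule char_T_nonneg[OF _ u]) (use \<rho> elim(2) in simp)
    have b\<rho>: "b \<rho> \<le> b (2 * r + 1)" by (rule b) (use \<rho> elim(2) in simp_all)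
    have "lnp (cmod (u z)) \<le> 3 * b (2 * r + 1)" if z: "cmod z \<le> r" for z
      using nz
    proof
      assume nz: "\<forall>z. cmod z = \<rho> \<longrightarrow> u z \<noteq> 0"
      have "lnp (cmod (u z)) \<le> (\<rho> + cmod z) / (\<rho> - cmod z) * char_T u \<rho>"
        by (rule lnp_le_char_T[OF u]) (use nz z \<rho> elim(2) in auto)
      also have "\<dots> \<le> 3 * char_T u \<rho>"
      proof (rule mult_right_mono[OF _ T0])
        show "(\<rho> + cmod z) / (\<rho> - cmod z) \<le> 3" using z \<rho> elim(2) by (simp add: divide_le_eq)
      qed
      finally show ?thesis using T\<rho> b\<rho> by linarith
    next
      assume "\<forall>z. u z = 0"
      hence "lnp (cmod (u z)) = 0" by (simp add: lnp_def)
      thus ?thesis using T0 T\<rho> b\<rho> by linarith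
    qed
    thus ?case by blast
  qed
qed

lemma tame_of_char_T:
  assumes u: "entire u" and T: "\<And>\<eta>. \<eta> > 0 \<Longrightarrow> \<forall>\<^sub>F r in nev. char_T u r \<le> exp (\<eta> * r)"
  shows "tame u"
proof (rule tameI)
  fix \<eta> :: real assume e: "\<eta> > 0"
  have "\<forall>\<^sub>F r in at_top. \<forall>z. cmod z \<le> r \<longrightarrow> lnp (cmod (u z)) \<le> 3 * exp (\<eta> / 4 * (2 * r + 1))"
    by (rule sup_bound_of_char_T[OF u T]) (use e in auto)
  moreover have "\<forall>\<^sub>F r in at_top. 3 * exp (\<eta> / 4 * (2 * r + 1)) \<le> exp (\<eta> * r)" using e by real_asymp
  ultimately show "\<forall>\<^sub>F r in at_top. \<forall>z. cmod z \<le> r \<longrightarrow> cmod (u z) \<le> exp (exp (\<eta> * r))"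
    by eventually_elim (blast intro: lnp_le_imp order_trans)
qed

lemma subexp_of_char_T:
  assumes u: "entire u" and T: "\<And>\<eta>. \<eta> > 0 \<Longrightarrow> \<forall>\<^sub>F r in nev. char_T u r \<le> \<eta> * r"
  shows "subexp u"
proof (rule subexpI)
  fix \<eta> :: real assume e: "\<eta> > 0"
  have "\<forall>\<^sub>F r in at_top. \<forall>z. cmod z \<le> r \<longrightarrow> lnp (cmod (u z)) \<le> 3 * (\<eta> / 12 * (2 * r + 1))"
    by (rule sup_bound_of_char_T[OF u T]) (use e in auto)
  moreover have "\<forall>\<^sub>F r in at_top. 3 * (\<eta> / 12 * (2 * r + 1)) \<le> \<eta> * r" using e by real_asymp
  ultimately show "\<forall>\<^sub>F r in at_top. \<forall>z. cmod z \<le> r \<longrightarrow> cmod (u z) \<le> exp (\<eta> * r)"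
    by eventually_elim (blast intro: lnp_le_imp order_trans)
qed

text \<open>The bound becomes \<open>|u| = O(|z| ^ (3 n))\<close>, with the 3 of
  \<open>sup_bound_of_char_T\<close>, and Liouville's theorem applies.\<close>

lemma polynomial_of_char_T:
  assumes u: "entire u" and T: "\<forall>\<^sub>F r in nev. char_T u r \<le> K + real n * ln r"
  shows "\<exists>p. \<forall>z. u z = poly p z"
proof -
  have "\<forall>\<^sub>F r in at_top. \<forall>z. cmod z \<le> r \<longrightarrow> lnp (cmod (u z)) \<le> 3 * (K + real n * ln (2 * r + 1))"
    by (rule sup_bound_of_char_T[OF u T]) (auto intro!: mult_left_mono)
  then obtain R where R: "\<And>r z. r > R \<Longrightarrow> cmod z \<le> r \<Longrightarrow> lnp (cmod (u z)) \<le> 3 * (K + real n * ln (2 * r + 1))"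
    unfolding eventually_at_top_dense by blast
  define N where "N = 3 * n"
  define B where "B = exp (3 * K) * 3 ^ N"
  have b: "cmod (u z) \<le> B * cmod z ^ N" if z: "cmod z \<ge> max (R + 1) 1" for z
  proof -
    have z1: "cmod z \<ge> 1" "cmod z > R" using z by simp_all
    have "cmod (u z) \<le> exp (3 * (K + real n * ln (2 * cmod z + 1)))"
      by (rule lnp_le_imp, rule R) (use z1 in auto)
    also have "\<dots> = exp (3 * K + real N * ln (2 * cmod z + 1))" by (simp add: N_def algebra_simps)
    also have "\<dots> = exp (3 * K) * (2 * cmod z + 1) ^ N"
      using z1 by (simp add: exp_add exp_of_nat_mult)
    also have "\<dots> \<le> exp (3 * K) * (3 * cmod z) ^ N"
      using z1 by (intro mult_left_mono power_mono) auto
    finally show ?thesis by (simp add: B_def power_mult_distrib mult_ac)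
  qed
  have "u z = (\<Sum>k\<le>N. (deriv ^^ k) u 0 / fact k * z ^ k)" for z
    by (rule Liouville_polynomial[OF entire_holo[OF u] b])
  hence "u z = poly (\<Sum>k\<le>N. monom ((deriv ^^ k) u 0 / fact k) k) z" for z
    by (simp add: poly_sum poly_monom)
  thus ?thesis by blast
qed

section \<open>Size of complex polynomials\<close>

lemma poly_upper_bound:
  fixes p :: "complex poly"
  shows "\<exists>C\<ge>1. \<forall>z. cmod z \<ge> 1 \<longrightarrow> cmod (poly p z) \<le> C * cmod z ^ degree p"
proof (induction p)
  case 0 show ?case by (intro exI[of _ 1]) auto
next
  case (pCons a p)
  then obtain C where C: "C \<ge> 1" "\<And>z. cmod z \<ge> 1 \<Longrightarrow> cmod (poly p z) \<le> C * cmod z ^ degree p" by blast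
  show ?case
  proof (cases "p = 0")
    case True thus ?thesis by (intro exI[of _ "max 1 (cmod a)"]) auto
  next
    case False
    have "cmod (poly (pCons a p) z) \<le> (cmod a + C) * cmod z ^ degree (pCons a p)" if z: "cmod z \<ge> 1" for z
    proof -
      have "cmod (poly (pCons a p) z) \<le> cmod a + cmod z * cmod (poly p z)"
        using norm_triangle_ineq[of a "z * poly p z"] by (simp add: norm_mult)
      also have "\<dots> \<le> cmod a * cmod z ^ Suc (degree p) + cmod z * (C * cmod z ^ degree p)"
        using C(2)[OF z] z mult_left_mono[OF one_le_power[OF z, of "Suc (degree p)"], of "cmod a"]
        by (intro add_mono mult_left_mono) auto
      finally show ?thesis using False by (simp add: algebra_simps)
    qed
    thus ?thesis using C(1) by (intro exI[of _ "cmod a + C"]) (auto simp: add_increasing)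
  qed
qed

lemma poly_lower_bound:
  fixes p :: "complex poly"
  assumes "p \<noteq> 0"
  shows "\<exists>m>0. \<exists>R\<ge>1. \<forall>z. cmod z \<ge> R \<longrightarrow> m * cmod z ^ degree p \<le> cmod (poly p z)"
proof -
  define l where "l = cmod (lead_coeff p)"
  have l: "l > 0" using assms by (simp add: l_def)
  have "((\<lambda>z. cmod (poly p z / z ^ degree p)) \<longlongrightarrow> l) at_infinity"
    unfolding l_def by (intro tendsto_norm poly_divide_tendsto_aux)
  hence "\<forall>\<^sub>F z in at_infinity. l / 2 < cmod (poly p z / z ^ degree p)" using l by (intro order_tendstoD) auto
  then obtain R where R: "\<And>z. cmod z \<ge> R \<Longrightarrow> l / 2 < cmod (poly p z / z ^ degree p)"
    by (auto simp: eventually_at_infinity)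
  have "l / 2 * cmod z ^ degree p \<le> cmod (poly p z)" if z: "cmod z \<ge> max R 1" for z
  proof -
    have "cmod z > 0" using z by linarith
    hence "cmod z ^ degree p > 0" by (rule zero_less_power)
    thus ?thesis using R[of z] z by (simp add: norm_divide norm_power field_simps)
  qed
  thus ?thesis using l by (intro exI[of _ "l / 2"] conjI exI[of _ "max R 1"]) auto
qed

lemma char_T_poly: "\<exists>K n. \<forall>r\<ge>1. char_T (poly p) r \<le> K + real n * ln r"
proof -
  obtain C where C: "C \<ge> 1" "\<And>z. cmod z \<ge> 1 \<Longrightarrow> cmod (poly p z) \<le> C * cmod z ^ degree p" using poly_upper_bound by blast
  have "char_T (poly p) r \<le> ln C + real (degree p) * ln r" if r: "r \<ge> 1" for r
  proof (rule char_T_le_sup[OF entire_poly])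
    show "cmod (poly p z) \<le> exp (ln C + real (degree p) * ln r)" if "cmod z = r" for z
      using C(2)[of z] C(1) that r by (simp add: exp_add exp_of_nat_mult)
  qed (use r C in auto)
  thus ?thesis by blast
qed

text \<open>An upper bound \<open>M \<ge> 0\<close> for \<open>Re g\<close> suffices:
  \<open>|Re g| \<le> 2 M - Re g\<close> bounds the mean, \<open>Schwarz_bound\<close> then bounds
  \<open>g\<close> on half the disc, and Cauchy's estimate gives
  \<open>g' = O(\<eta>)\<close>.\<close>

lemma constant_of_Re_bound:
  assumes g: "entire g" and Re: "\<And>\<eta>. \<eta> > 0 \<Longrightarrow> \<forall>\<^sub>F r in at_top. \<forall>z. cmod z = r \<longrightarrow> Re (g z) \<le> \<eta> * r"
  shows "deriv g z = 0"
proof -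
  have le: "cmod (deriv g z) \<le> 17 * \<eta>" if e: "\<eta> > 0" for \<eta>
  proof -
    \<comment> \<open>The quotient tends to \<open>16 * \<eta>\<close>; 17 leaves room for the
      lower-order terms.\<close>
    have 1: "\<forall>\<^sub>F r in at_top. (5 * cmod (g 0) + 8 * (\<eta> * r)) / (r / 2 - cmod z) \<le> 17 * \<eta>" using e by real_asymp
    have 2: "\<forall>\<^sub>F r::real in at_top. r > 2 * cmod z" by (rule eventually_gt_at_top)
    from eventually_conj[OF Re[OF e] eventually_conj[OF 1 2]] obtain r where
      r: "\<And>w. cmod w = r \<Longrightarrow> Re (g w) \<le> \<eta> * r" "(5 * cmod (g 0) + 8 * (\<eta> * r)) / (r / 2 - cmod z) \<le> 17 * \<eta>" "r > 2 * cmod z"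
      by (auto simp: eventually_at_top_dense) (metis gt_ex)
    have r0: "r > 0" using r(3) norm_ge_zero[of z] by linarith
    have er: "0 \<le> \<eta> * r" using e r0 by simp
    have "cavg r (\<lambda>w. \<bar>Re (g w)\<bar>) \<le> cavg r (\<lambda>w. 2 * (\<eta> * r) - Re (g w))"
    proof (rule cavg_mono)
      show "\<bar>Re (g w)\<bar> \<le> 2 * (\<eta> * r) - Re (g w)" if "cmod w = r" for w using r(1)[OF that] er by linarith
    qed (use r0 in \<open>auto intro!: continuous_intros entire_continuous g\<close>)
    also have "\<dots> = 2 * (\<eta> * r) - cavg r (\<lambda>w. Re (g w))"
      by (subst cavg_diff) (use r0 in \<open>auto intro!: continuous_intros entire_continuous g\<close>)
    also have "cavg r (\<lambda>w. Re (g w)) = Re (g 0)" by (rule cavg_mean_Re[OF entire_holo[OF g] r0])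
    finally have avg: "cavg r (\<lambda>w. \<bar>Re (g w)\<bar>) \<le> 2 * (\<eta> * r) + cmod (g 0)" using abs_Re_le_cmod[of "g 0"] by linarith
    define d where "d = r / 2 - cmod z"
    have d: "d > 0" using r(3) by (simp add: d_def)
    have "cmod (deriv g z) \<le> (5 * cmod (g 0) + 8 * (\<eta> * r)) / d"
    proof (rule Cauchy_deriv_bound[OF entire_holo[OF g] d])
      fix w assume w: "cmod (w - z) = d"
      have wr: "cmod w \<le> r / 2" using norm_triangle_ineq2[of w z] w by (simp add: d_def)
      have "cmod (g w) \<le> cmod (g 0) + 2 * r / (r - cmod w) * cavg r (\<lambda>w. \<bar>Re (g w)\<bar>)"
        by (rule Schwarz_bound[OF entire_holo[OF g]]) (use wr r0 in linarith)
      also have "2 * r / (r - cmod w) * cavg r (\<lambda>w. \<bar>Re (g w)\<bar>) \<le> 4 * (2 * (\<eta> * r) + cmod (g 0))"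
      proof (rule mult_mono)
        show "2 * r / (r - cmod w) \<le> 4" using wr r0 by (simp add: divide_le_eq)
        show "0 \<le> cavg r (\<lambda>w. \<bar>Re (g w)\<bar>)"
          using cavg_mono[of r "\<lambda>w. 0" "\<lambda>w. \<bar>Re (g w)\<bar>"] r0 entire_continuous[OF g] by (simp add: continuous_on_rabs continuous_on_Re)
      qed (use avg in simp_all)
      finally show "cmod (g w) \<le> 5 * cmod (g 0) + 8 * (\<eta> * r)" by simp
    qed
    thus ?thesis using r(2) by (simp add: d_def)
  qed
  have "cmod (deriv g z) \<le> 0"
  proof (rule field_le_epsilon)
    fix e :: real assume "e > 0"
    thus "cmod (deriv g z) \<le> 0 + e" using le[of "e / 17"] by simp
  qed
  thus ?thesis by simp
qed

lemma entire_deriv_const: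
  assumes "entire u" "\<And>z. deriv u z = k"
  shows "u z = k * z + u 0"
proof -
  have "\<exists>c. \<forall>z\<in>UNIV. u z - k * z = c"
  proof (rule has_field_derivative_zero_constant)
    fix z
    have "((\<lambda>z. u z - k * z) has_field_derivative deriv u z - k) (at z)"
      by (auto intro!: derivative_eq_intros entire_field_derivative assms(1))
    thus "((\<lambda>z. u z - k * z) has_field_derivative 0) (at z within UNIV)" using assms(2) by simp
  qed simp
  then obtain c where c: "\<And>z. u z - k * z = c" by blast
  have "u 0 = c" using c[of 0] by simp
  thus ?thesis using c[of z] by (simp add: algebra_simps)
qed

text \<open>Differentiation preserves the equation and lowers the degree, down to a constant, where
  \<open>\<gamma> = \<kappa>\<close>. At degree 1, comparing values at 0 gives
  \<open>\<gamma> = 1\<close>.\<close>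

lemma poly_difference_equation:
  fixes q :: "complex poly"
  assumes "q \<noteq> 0" "pderiv q + smult \<gamma> q = smult \<kappa> (pcompose q [:1, 1:])"
  shows "\<gamma> = \<kappa> \<and> (degree q = 0 \<or> \<gamma> = 1)"
  using assms
proof (induction "degree q" arbitrary: q)
  case 0
  then obtain a where a: "q = [:a:]" "a \<noteq> 0" using degree_eq_zeroE[of q] by (metis pCons_0_0)
  thus ?case using 0(3) by (simp add: pderiv_pCons)
next
  case (Suc n)
  have dq: "degree (pderiv q) = n" using Suc(2) by (simp add: degree_pderiv)
  have nz: "pderiv q \<noteq> 0" using Suc(2) by (simp add: pderiv_eq_0_iff)
  have "pderiv (pderiv q + smult \<gamma> q) = pderiv (smult \<kappa> (pcompose q [:1, 1:]))" using Suc(4) by simp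
  hence eq: "pderiv (pderiv q) + smult \<gamma> (pderiv q) = smult \<kappa> (pcompose (pderiv q) [:1, 1:])"
    by (simp add: pderiv_add pderiv_smult pderiv_pcompose pderiv_pCons)
  have IH: "\<gamma> = \<kappa> \<and> (n = 0 \<or> \<gamma> = 1)" using Suc(1)[OF dq[symmetric] nz eq] unfolding dq .
  show ?case
  proof (cases "n = 0")
    case True
    hence "degree q = 1" using Suc(2) by simp
    then obtain a b where q: "q = [:b, a:]" "a \<noteq> 0" using degree1_coeffs[of q] by blast
    have "poly (pderiv q + smult \<gamma> q) 0 = poly (smult \<gamma> (pcompose q [:1, 1:])) 0" using Suc(4) IH by simp
    hence "a = \<gamma> * a" by (simp add: q pderiv_pCons poly_pcompose algebra_simps)
    thus ?thesis using q(2) IH by simp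
  next
    case False thus ?thesis using IH by blast
  qed
qed

text \<open>Only \<open>|\<sigma>| = 1\<close> matters, so the two signs are treated together. Far
  out \<open>q(z+1)\<close> is bounded below, so the growth of the left side bounds the real part of
  the shift difference.\<close>

lemma exponent_linear:
  fixes q :: "complex poly"
  assumes q: "q \<noteq> 0" and h: "entire h" "subexp h" and \<sigma>: "cmod \<sigma> = 1"
    and eq: "\<And>z. poly (pderiv q) z + poly q z * deriv h z = \<sigma> * poly q (z + 1) * exp (h (z + 1) - h z)"
  obtains \<gamma> p0 d where "q = [:p0:]" "\<gamma> = \<sigma> * exp \<gamma>" "\<And>z. h z = \<gamma> * z + d"
proof -
  define q1 where "q1 = pcompose q [:1, 1:]"
  have q1: "poly q1 z = poly q (z + 1)" for z by (simp add: q1_def poly_pcompose add.commute)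
  have q1d: "degree q1 = degree q" by (simp add: q1_def degree_pcompose)
  have q10: "q1 \<noteq> 0" using q by (simp add: q1_def pcompose_eq_0_iff)
  define g where "g = (\<lambda>z. h (z + 1) - h z)"
  have eg: "entire g" unfolding g_def by (intro entire_diff entire_shift h)
  define A where "A = (\<lambda>z. poly (pderiv q) z + poly q z * deriv h z)"
  have sA: "subexp A" unfolding A_def by (intro subexp_add subexp_mult subexp_poly subexp_deriv h)
  obtain m R where m: "m > 0" "R \<ge> 1" "\<And>z. cmod z \<ge> R \<Longrightarrow> m * cmod z ^ degree q1 \<le> cmod (poly q1 z)"
    using poly_lower_bound[OF q10] by blast
  have q1low: "m \<le> cmod (poly q1 z)" if "cmod z \<ge> R" for z
  proof -
    have "m * 1 \<le> m * cmod z ^ degree q1" using m(1,2) that by (intro mult_left_mono one_le_power) auto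
    thus ?thesis using m(3)[OF that] by simp
  qed
  have g0: "deriv g z = 0" for z
  proof (rule constant_of_Re_bound[OF eg])
    fix \<eta> :: real assume e: "\<eta> > 0"
    have e2: "\<eta> / 2 > 0" using e by simp
    have 1: "\<forall>\<^sub>F r in at_top. exp (\<eta> / 2 * r) \<le> m * exp (\<eta> * r)" using e m(1) by real_asymp
    have 2: "\<forall>\<^sub>F r in at_top. r \<ge> R" by (rule eventually_ge_at_top)
    from subexpD[OF sA e2] 1 2 show "\<forall>\<^sub>F r in at_top. \<forall>z. cmod z = r \<longrightarrow> Re (g z) \<le> \<eta> * r"
    proof eventually_elim
      case (elim r)
      have "Re (g z) \<le> \<eta> * r" if z: "cmod z = r" for z
      proof -
        have "A z = \<sigma> * poly q1 z * exp (g z)" using eq[of z] by (simp add: A_def q1 g_def)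
        hence "cmod (A z) = cmod (poly q1 z) * exp (Re (g z))" using \<sigma> by (simp add: norm_mult)
        also have "\<dots> \<ge> m * exp (Re (g z))" using q1low[of z] z elim(3) by (intro mult_right_mono) auto
        finally have "m * exp (Re (g z)) \<le> m * exp (\<eta> * r)" using elim(1,2) z by fastforce
        thus ?thesis using m(1) by simp
      qed
      thus ?case by blast
    qed
  qed
  have gc: "g z = g 0" for z using entire_deriv_const[OF eg g0, of z] by simp
  define k where "k = \<sigma> * exp (g 0)"
  have eqk: "poly (pderiv q) z + poly q z * deriv h z = k * poly q1 z" for z
    using eq[of z] gc[of z] by (simp add: k_def q1 g_def mult_ac)
  \<comment> \<open>With \<open>g\<close> constant, \<open>h'\<close> is a quotient of polynomials
    whose numerator has degree at most \<open>degree q\<close>, since shifting preserves the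
    degree.\<close>
  have "bounded (range (deriv h))"
  proof -
    obtain m' R' where m': "m' > 0" "R' \<ge> 1" "\<And>z. cmod z \<ge> R' \<Longrightarrow> m' * cmod z ^ degree q \<le> cmod (poly q z)"
      using poly_lower_bound[OF q] by blast
    obtain C1 where C1: "C1 \<ge> 1" "\<And>z. cmod z \<ge> 1 \<Longrightarrow> cmod (poly q1 z) \<le> C1 * cmod z ^ degree q1" using poly_upper_bound by blast
    obtain C2 where C2: "C2 \<ge> 1" "\<And>z. cmod z \<ge> 1 \<Longrightarrow> cmod (poly (pderiv q) z) \<le> C2 * cmod z ^ degree (pderiv q)" using poly_upper_bound by blast
    define M where "M = (cmod k * C1 + C2) / m'"
    have out: "cmod (deriv h z) \<le> M" if z: "cmod z \<ge> R'" for z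
    proof -
      have z1: "cmod z \<ge> 1" using z m'(2) by simp
      have "cmod z > 0" using z1 by linarith
      hence zp: "cmod z ^ degree q > 0" by (rule zero_less_power)
      have "m' * cmod z ^ degree q * cmod (deriv h z) \<le> cmod (poly q z) * cmod (deriv h z)"
        using m'(3)[OF z] by (intro mult_right_mono) auto
      also have "\<dots> = cmod (k * poly q1 z - poly (pderiv q) z)" using eqk[of z] by (metis add_diff_cancel_left' norm_mult)
      also have "\<dots> \<le> cmod k * cmod (poly q1 z) + cmod (poly (pderiv q) z)"
        using norm_triangle_ineq4[of "k * poly q1 z" "poly (pderiv q) z"] by (simp add: norm_mult)
      also have "\<dots> \<le> cmod k * (C1 * cmod z ^ degree q) + C2 * cmod z ^ degree q"
      proof (intro add_mono mult_left_mono)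
        show "cmod (poly q1 z) \<le> C1 * cmod z ^ degree q" using C1(2)[OF z1] q1d by simp
        have "C2 * cmod z ^ degree (pderiv q) \<le> C2 * cmod z ^ degree q"
          using C2(1) z1 by (intro mult_left_mono power_increasing) (auto simp: degree_pderiv)
        thus "cmod (poly (pderiv q) z) \<le> C2 * cmod z ^ degree q" using C2(2)[OF z1] by linarith
      qed simp
      also have "\<dots> = cmod z ^ degree q * (cmod k * C1 + C2)" by (simp add: algebra_simps)
      finally have "cmod z ^ degree q * (m' * cmod (deriv h z)) \<le> cmod z ^ degree q * (cmod k * C1 + C2)" by (simp add: mult_ac)
      hence "m' * cmod (deriv h z) \<le> cmod k * C1 + C2" using zp by (simp only: mult_le_cancel_left_pos)
      thus ?thesis using m'(1) by (simp add: M_def field_simps)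
    qed
    have "compact (deriv h ` cball 0 R')"
      by (intro compact_continuous_image entire_continuous entire_deriv h compact_cball)
    then obtain M2 where M2: "\<And>z. cmod z \<le> R' \<Longrightarrow> cmod (deriv h z) \<le> M2"
      using compact_imp_bounded bounded_iff by (metis imageI mem_cball_0)
    have "cmod (deriv h z) \<le> max M M2" for z using out[of z] M2[of z] by (cases "cmod z \<le> R'") auto
    thus ?thesis unfolding bounded_iff by blast
  qed
  from Liouville_theorem[OF entire_holo[OF entire_deriv[OF h(1)]] this] obtain \<gamma> where \<gamma>: "\<And>z. deriv h z = \<gamma>"
    by (auto simp: constant_on_def)
  have hl: "h z = \<gamma> * z + h 0" for z by (rule entire_deriv_const[OF h(1) \<gamma>])
  have "g 0 = \<gamma>" using hl[of 1] by (simp add: g_def)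
  hence k: "k = \<sigma> * exp \<gamma>" by (simp add: k_def)
  have "pderiv q + smult \<gamma> q = smult k q1"
    by (rule poly_ext) (use eqk \<gamma> in \<open>simp add: mult.commute\<close>)
  from poly_difference_equation[OF q this[unfolded q1_def]]
  have "\<gamma> = k" and deg: "degree q = 0 \<or> \<gamma> = 1" by auto
  hence \<gamma>k: "\<gamma> = \<sigma> * exp \<gamma>" using k by simp
  \<comment> \<open>A nonconstant \<open>q\<close> would need \<open>\<gamma> = 1\<close>, but then
    \<open>\<sigma> exp \<gamma>\<close> has modulus \<open>e\<close>.\<close>
  have "degree q = 0"
  proof (rule ccontr)
    assume "degree q \<noteq> 0"
    hence "\<gamma> = 1" using deg by simp
    hence "1 = \<sigma> * exp (1::complex)" using \<gamma>k by simp
    from arg_cong[OF this, of cmod] have "exp (1::real) = 1" using \<sigma> by (simp add: norm_mult)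
    thus False by simp
  qed
  then obtain p0 where "q = [:p0:]" using degree_eq_zeroE by blast
  thus ?thesis using that \<gamma>k hl by blast
qed

text \<open>If \<open>\<bar>c z\<bar> \<le> L exp (\<bar>z\<bar> / 30)\<close>, Cauchy's estimate on discs of radius 30 bounds both \<open>c'\<close> and
  \<open>c(z+1) - c(z)\<close>, hence \<open>c(z) = c'(z) - (c(z+1) - c(z))\<close>, so well that \<open>L\<close> can be halved.\<close>

lemma derivative_eq_shift_imp_zero:
  assumes c: "entire c" "subexp c" and eq: "\<And>z. deriv c z = c (z + 1)"
  shows "c z = 0"
proof -
  define \<eta> :: real where "\<eta> = 1 / 30"
  have \<eta>: "\<eta> > 0" by (simp add: \<eta>_def)
  obtain R where R: "\<And>r z. r > R \<Longrightarrow> cmod z \<le> r \<Longrightarrow> cmod (c z) \<le> exp (\<eta> * r)"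
    using subexpD[OF c(2) \<eta>] unfolding eventually_at_top_dense by blast
  define R1 where "R1 = max R 0 + 1"
  define K where "K = exp (\<eta> * R1)"
  have K0: "cmod (c z) \<le> K * exp (\<eta> * cmod z)" for z
  proof (cases "cmod z \<le> R1")
    case True
    have "cmod (c z) \<le> K" unfolding K_def by (rule R[OF _ True]) (simp add: R1_def)
    also have "\<dots> \<le> K * exp (\<eta> * cmod z)" using \<eta> by (simp add: K_def)
    finally show ?thesis .
  next
    case False
    have "1 \<le> K" unfolding K_def using \<eta> by (simp add: R1_def)
    hence "1 * exp (\<eta> * cmod z) \<le> K * exp (\<eta> * cmod z)" by (intro mult_right_mono) auto
    moreover have "cmod z > R" using False by (simp add: R1_def)
    ultimately show ?thesis using R[of "cmod z" z] by linarith
  qed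
  have K: "K > 0" by (simp add: K_def)
  have "cmod (c z) \<le> K / 2 ^ n * exp (\<eta> * cmod z)" for n z
  proof (induction n arbitrary: z)
    case 0 thus ?case using K0 by simp
  next
    case (Suc n)
    define L where "L = K / 2 ^ n"
    have L: "L > 0" using K by (simp add: L_def)
    have IH: "cmod (c z) \<le> L * exp (\<eta> * cmod z)" for z using Suc by (simp add: L_def)
    \<comment> \<open>Moving by 30 raises the bound by \<open>exp 1 \<le> 3\<close>, so the
      derivative costs \<open>3 / 30\<close>; the difference will cost \<open>3 / 10\<close>, and
      \<open>1/10 + 3/10 \<le> 1/2\<close>.\<close>
    have d: "cmod (deriv c z) \<le> L / 10 * exp (\<eta> * cmod z)" for z
    proof -
      have "cmod (deriv c z) \<le> (L * exp (\<eta> * (cmod z + 30))) / 30"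
      proof (rule Cauchy_deriv_bound[OF entire_holo[OF c(1)]])
        fix w assume "cmod (w - z) = 30"
        hence "cmod w \<le> cmod z + 30" using norm_triangle_ineq2[of w z] by simp
        hence "L * exp (\<eta> * cmod w) \<le> L * exp (\<eta> * (cmod z + 30))" using L \<eta> by simp
        thus "cmod (c w) \<le> L * exp (\<eta> * (cmod z + 30))" using IH[of w] by linarith
      qed simp
      also have "\<eta> * (cmod z + 30) = \<eta> * cmod z + 1" by (simp add: \<eta>_def algebra_simps)
      also have "L * exp (\<eta> * cmod z + 1) / 30 = L / 30 * exp (\<eta> * cmod z) * exp 1" by (simp add: exp_add)
      also have "\<dots> \<le> L / 30 * exp (\<eta> * cmod z) * 3" using L exp_le by (intro mult_left_mono) auto
      finally show ?thesis by simp
    qed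
    have "cmod (c (z + 1) - c z) \<le> L / 10 * exp (\<eta> * (cmod z + 1)) * cmod ((z + 1) - z)"
    proof (rule field_differentiable_bound[of "cball z 1" c "deriv c"])
      fix w assume "w \<in> cball z 1"
      hence "cmod w \<le> cmod z + 1" using norm_triangle_ineq2[of w z] by (simp add: dist_norm norm_minus_commute)
      hence "L / 10 * exp (\<eta> * cmod w) \<le> L / 10 * exp (\<eta> * (cmod z + 1))" using L \<eta> by simp
      thus "cmod (deriv c w) \<le> L / 10 * exp (\<eta> * (cmod z + 1))" using d[of w] by linarith
      show "(c has_field_derivative deriv c w) (at w within cball z 1)"
        by (rule has_field_derivative_at_within[OF entire_field_derivative[OF c(1)]])
    qed (auto simp: dist_norm)
    also have "\<dots> = L / 10 * exp (\<eta> * cmod z) * exp \<eta>" by (simp add: distrib_left exp_add)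
    also have "\<dots> \<le> L / 10 * exp (\<eta> * cmod z) * 3"
    proof (intro mult_left_mono)
      have "exp \<eta> \<le> exp (1::real)" by (simp add: \<eta>_def)
      thus "exp \<eta> \<le> 3" using exp_le by linarith
    qed (use L in simp)
    finally have 1: "cmod (c (z + 1) - c z) \<le> 3 / 10 * (L * exp (\<eta> * cmod z))" by simp
    have "cmod (c z) \<le> cmod (c (z + 1)) + cmod (c (z + 1) - c z)" by (metis norm_minus_commute norm_triangle_sub)
    also have "\<dots> \<le> 1 / 10 * (L * exp (\<eta> * cmod z)) + 3 / 10 * (L * exp (\<eta> * cmod z))"
      using d[of z] 1 by (intro add_mono) (auto simp: eq)
    also have "\<dots> \<le> 1 / 2 * (L * exp (\<eta> * cmod z))" using L by simp
    finally show ?case by (simp add: L_def)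
  qed
  hence le: "cmod (c z) \<le> (K * exp (\<eta> * cmod z)) / 2 ^ n" for n by simp
  have "(\<lambda>n. (K * exp (\<eta> * cmod z)) / 2 ^ n) \<longlonglongrightarrow> 0" by real_asymp
  hence "cmod (c z) \<le> 0" by (rule LIMSEQ_le_const) (use le in blast)
  thus ?thesis by simp
qed

section \<open>From \<open>f\<close> to the unit \<open>exp h\<close>\<close>

lemma small_fun_nev:
  assumes "small_fun g f" "\<epsilon> > 0"
  shows "\<forall>\<^sub>F r in nev. char_T g r \<le> \<epsilon> * char_T f r"
  using assms unfolding small_fun_def eventually_nev by (meson abs_le_D1)

lemma Eset_two:
  assumes "a \<noteq> b"
  shows "Eset {a, b} F z = zmult (\<lambda>w. F w - a w) z + zmult (\<lambda>w. F w - b w) z"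
  using assms by (simp add: Eset_def)

text \<open>Otherwise \<open>T(r, c) \<le> T(r, f) / 2\<close> yields
  \<open>T(r, f) = O(ln r)\<close> and \<open>f\<close> is a polynomial. This later keeps
  \<open>h\<close> nonconstant and \<open>A\<close> nonzero.\<close>

lemma small_fun_not_polynomial_diff:
  assumes f: "transcendental_entire f" and c: "entire c" "small_fun c f"
  shows "\<not> (\<exists>p. \<forall>z. f z - c z = poly p z)"
proof
  assume "\<exists>p. \<forall>z. f z - c z = poly p z"
  then obtain p where "\<And>z. f z - c z = poly p z" by blast
  hence p: "f = (\<lambda>z. c z + poly p z)" by (simp add: fun_eq_iff algebra_simps)
  have ef: "entire f" using f by (simp add: transcendental_entire_def)
  obtain K n where K: "\<And>r. r \<ge> 1 \<Longrightarrow> char_T (poly p) r \<le> K + real n * ln r" using char_T_poly by blast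
  have "\<forall>\<^sub>F r in nev. char_T c r \<le> 1 / 2 * char_T f r" by (rule small_fun_nev[OF c(2)]) simp
  hence "\<forall>\<^sub>F r in nev. char_T f r \<le> (2 * K + 2 * ln 2) + real (2 * n) * ln r"
    using nev_at_topI[OF eventually_ge_at_top[of 1]]
  proof eventually_elim
    case (elim r)
    have "char_T f r \<le> char_T c r + char_T (poly p) r + ln 2"
      unfolding p by (rule char_T_add[OF c(1) entire_poly]) (use elim in simp)
    thus ?case using elim(1) K[OF elim(2)] by simp
  qed
  from polynomial_of_char_T[OF ef this] show False using f by (simp add: transcendental_entire_def)
qed

lemma entire_log_global:
  assumes "entire G" "\<And>z. G z \<noteq> 0"
  obtains h where "entire h" "\<And>z. G z = exp (h z)"
  using contractible_imp_holomorphic_log[OF entire_holo[OF assms(1), of UNIV] convex_imp_contractible[OF convex_UNIV]] assms(2)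
  unfolding entire_def by (metis UNIV_I)

lemma prod_list_poly: "prod_list (map (\<lambda>a. z - a) as) = poly (prod_list (map (\<lambda>a. [:- a, 1:]) as)) z"
  for z :: complex
  by (induction as) (auto simp: algebra_simps)

lemma finite_zeros_factor:
  assumes "entire u" "finite {z. u z = 0}" "\<exists>z. u z \<noteq> 0"
  obtains q h where "q \<noteq> 0" "entire h" "\<And>z. u z = poly q z * exp (h z)"
proof -
  have "finite {z \<in> UNIV. u z = 0}" using assms(2) by simp
  from entire_factor[OF assms(1,3) this]
  obtain as G where G: "entire G" "\<And>z. G z \<noteq> 0" "\<And>z. u z = prod_list (map (\<lambda>a. z - a) as) * G z"
    by (metis UNIV_I)
  obtain h where h: "entire h" "\<And>z. G z = exp (h z)" using entire_log_global[OF G(1,2)] by blast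
  define q where "q = prod_list (map (\<lambda>a. [:- a, 1:]) as)"
  have u: "u z = poly q z * exp (h z)" for z using G(3)[of z] h(2)[of z] by (simp add: q_def prod_list_poly)
  have "q \<noteq> 0" using assms(3) u by auto
  thus ?thesis using that h(1) u by blast
qed

text \<open>Far out \<open>|q|\<close> is bounded below, so division by \<open>q\<close> costs only
  a constant.\<close>

lemma char_T_unit_le:
  assumes q: "q \<noteq> 0" and f: "entire f" and c: "entire c" and h: "entire h"
    and eq: "\<And>z. f z - c z = poly q z * exp (h z)"
  shows "\<exists>K. \<forall>\<^sub>F r in at_top. char_T (\<lambda>z. exp (h z)) r \<le> char_T f r + char_T c r + K"
proof -
  obtain m R where m: "m > 0" "R \<ge> 1" "\<And>z. cmod z \<ge> R \<Longrightarrow> m * cmod z ^ degree q \<le> cmod (poly q z)"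
    using poly_lower_bound[OF q] by blast
  define b where "b = lnp (1 / m)"
  have bnd: "char_T (\<lambda>z. exp (h z)) r \<le> char_T f r + char_T c r + (ln 2 + b)" if r: "r \<ge> R" for r
  proof -
    have "char_T (\<lambda>z. exp (h z)) r \<le> char_T (\<lambda>z. f z + (-1) * c z) r + b"
    proof (rule char_T_le_of_bound)
      fix z assume z: "cmod z = r"
      have "m * 1 \<le> m * cmod z ^ degree q" using m(1,2) z r by (intro mult_left_mono one_le_power) auto
      hence mq: "m \<le> cmod (poly q z)" using m(3)[of z] z r by simp
      have "m * cmod (exp (h z)) \<le> cmod (poly q z) * cmod (exp (h z))" using mq by (intro mult_right_mono) auto
      also have "\<dots> = cmod (f z + (-1) * c z)"
      proof -
        have "f z + (-1) * c z = poly q z * exp (h z)" using eq[of z] by simp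
        thus ?thesis by (simp only: norm_mult)
      qed
      finally have 1: "cmod (exp (h z)) \<le> 1 / m * cmod (f z + (-1) * c z)" using m(1) by (simp add: field_simps)
      have "1 / m \<le> exp b" unfolding b_def by (rule lnp_le_imp) simp
      hence "1 / m * cmod (f z + (-1) * c z) \<le> exp b * cmod (f z + (-1) * c z)" by (intro mult_right_mono) auto
      thus "cmod (exp (h z)) \<le> exp b * cmod (f z + (-1) * c z)" using 1 by linarith
    next
      show "entire (\<lambda>z. f z + (-1) * c z)" by (intro entire_intros f c)
      show "entire (\<lambda>z. exp (h z))" by (intro entire_intros h)
    qed (use r m in \<open>auto simp: b_def\<close>)
    also have "char_T (\<lambda>z. f z + (-1) * c z) r \<le> char_T f r + char_T (\<lambda>z. (-1) * c z) r + ln 2"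
    proof (rule char_T_add)
      show "entire (\<lambda>z. (-1) * c z)" by (intro entire_mult entire_const c)
    qed (use r m(2) f in simp_all)
    also have "char_T (\<lambda>z. (-1) * c z) r = char_T c r" unfolding char_T_eq by simp
    finally show ?thesis by simp
  qed
  have "\<forall>\<^sub>F r in at_top. char_T (\<lambda>z. exp (h z)) r \<le> char_T f r + char_T c r + (ln 2 + b)"
    by (rule eventually_mono[OF eventually_ge_at_top[of R]], rule bnd)
  thus ?thesis by blast
qed

lemma char_T_le_unit:
  assumes f: "entire f" and c: "entire c" and h: "entire h"
    and eq: "\<And>z. f z - c z = poly q z * exp (h z)" and r: "r \<ge> 0"
  shows "char_T f r \<le> char_T c r + char_T (poly q) r + char_T (\<lambda>z. exp (h z)) r + ln 2"
proof -
  have feq: "f = (\<lambda>z. c z + poly q z * exp (h z))" using eq by (simp add: fun_eq_iff algebra_simps)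
  have "char_T f r \<le> char_T c r + char_T (\<lambda>z. poly q z * exp (h z)) r + ln 2"
    unfolding feq by (rule char_T_add[OF c _ r]) (intro entire_intros h)
  also have "char_T (\<lambda>z. poly q z * exp (h z)) r \<le> char_T (poly q) r + char_T (\<lambda>z. exp (h z)) r"
    by (rule char_T_mult[OF _ _ r]) (intro entire_intros h)+
  finally show ?thesis by simp
qed

text \<open>Smallness relative to \<open>f\<close> passes to \<open>exp h\<close> because
  \<open>T(r, f) \<le> 3 \<tau> r\<close> off an exceptional set. Subtracting \<open>c'\<close> from
  \<open>a\<close>, \<open>b\<close> on one side and \<open>c(z+1)\<close> on the other leaves the
  same difference \<open>a - b\<close>, as \<open>shared_roots\<close> requires.\<close>

lemma shared_set_dichotomy:
  assumes f: "transcendental_entire f" "hyper_order f < 1"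
    and ent: "entire a" "entire b" "entire c"
    and sm: "small_fun a f" "small_fun b f" "small_fun c f"
    and ne: "a \<noteq> b" and share: "share_set_CM (deriv f) (\<lambda>z. f (z + 1)) {a, b}"
    and q: "q \<noteq> 0" and h: "entire h" and eq: "\<And>z. f z - c z = poly q z * exp (h z)"
  defines "A \<equiv> (\<lambda>z. poly (pderiv q) z + poly q z * deriv h z)"
    and "B \<equiv> (\<lambda>z. poly q (z + 1) * exp (h (z + 1) - h z))"
  shows "subexp h \<and> ((\<forall>z. A z = B z \<and> a z - deriv c z = a z - c (z + 1)) \<or>
    (\<forall>z. A z = - B z \<and> a z - deriv c z = - (b z - c (z + 1))))"
proof -
  have ef: "entire f" using f(1) by (simp add: transcendental_entire_def)
  have notpoly: "\<not> (\<exists>p. \<forall>z. f z - c z = poly p z)" by (rule small_fun_not_polynomial_diff[OF f(1) ent(3) sm(3)])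
  define \<tau> where tau_eq: "\<tau> = char_T (\<lambda>z. exp (h z))"
  have deq: "deriv f z = deriv c z + A z * exp (h z)" for z
  proof -
    have feq: "f = (\<lambda>z. c z + poly q z * exp (h z))" using eq by (simp add: fun_eq_iff algebra_simps)
    show ?thesis unfolding feq A_def
      by (rule DERIV_imp_deriv) (auto intro!: derivative_eq_intros entire_field_derivative ent h simp: algebra_simps)
  qed
  have seq: "f (z + 1) = c (z + 1) + B z * exp (h z)" for z
    using eq[of "z + 1"] by (simp add: B_def mult.assoc algebra_simps flip: exp_add)
  have nonconst: "\<exists>z. deriv h z \<noteq> 0"
  proof (rule ccontr)
    assume "\<not> (\<exists>z. deriv h z \<noteq> 0)"
    hence hc: "h z = h 0" for z using entire_deriv_const[OF h, of 0 z] by simp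
    have "f z - c z = poly (smult (exp (h 0)) q) z" for z
      unfolding eq[of z] poly_smult by (subst hc) (rule mult.commute)
    thus False using notpoly by blast
  qed
  have A0: "\<exists>z. A z \<noteq> 0"
  proof (rule ccontr)
    assume "\<not> (\<exists>z. A z \<noteq> 0)"
    hence "deriv f z = deriv c z" for z using deq[of z] by simp
    hence "deriv (\<lambda>z. f z - c z) z = 0" for z
      by (subst DERIV_imp_deriv[OF DERIV_diff[OF entire_field_derivative[OF ef] entire_field_derivative[OF ent(3)]]]) simp
    from entire_deriv_const[OF entire_diff[OF ef ent(3)] this]
    have "f z - c z = poly [:f 0 - c 0:] z" for z by simp
    thus False using notpoly by blast
  qed
  have half: "\<forall>\<^sub>F r in nev. char_T c r \<le> 1 / 2 * char_T f r" by (rule small_fun_nev[OF sm(3)]) simp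
  obtain K where K: "\<forall>\<^sub>F r in at_top. \<tau> r \<le> char_T f r + char_T c r + K"
    using char_T_unit_le[OF q ef ent(3) h eq] unfolding tau_eq by blast
  have mono: "\<tau> r \<le> \<tau> s" if "0 < r" "r \<le> s" for r s
    using char_T_shift[of "\<lambda>z. exp (h z)" s r 0] entire_exp[OF h] that by (cases "r = s") (auto simp: tau_eq)
  \<comment> \<open>The bound for \<open>\<tau>\<close> holds only off an exceptional set; a good
    \<open>s\<close> in \<open>[r, r + 1]\<close> and monotonicity extend it to all large
    \<open>r\<close>.\<close>
  have sub: "\<forall>\<^sub>F r in at_top. \<tau> r \<le> exp (\<eta> * r)" if e: "\<eta> > 0" for \<eta>
  proof -
    have e2: "\<eta> / 2 > 0" using e by simp
    have "\<forall>\<^sub>F r in nev. \<tau> r \<le> 2 * exp (\<eta> / 2 * r) + \<bar>K\<bar>"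
      using half nev_at_topI[OF K] nev_at_topI[OF hyper_order_growth[OF f(2) e2]] nev_at_topI[OF eventually_ge_at_top[of 0]]
    proof eventually_elim
      case (elim r)
      have "0 \<le> char_T f r" by (rule char_T_nonneg[OF elim(4) ef])
      thus ?case using elim by linarith
    qed
    from nev_imp_at_top[OF this] have 1: "\<forall>\<^sub>F r in at_top. \<exists>s\<in>{r..r+1}. \<tau> s \<le> 2 * exp (\<eta> / 2 * s) + \<bar>K\<bar>" .
    have 2: "\<forall>\<^sub>F r in at_top. 2 * exp (\<eta> / 2 * (r + 1)) + \<bar>K\<bar> \<le> exp (\<eta> * r)" using e by real_asymp
    have 3: "\<forall>\<^sub>F r::real in at_top. r > 0" by (rule eventually_gt_at_top)
    show ?thesis using 1 2 3
    proof eventually_elim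
      case (elim r)
      then obtain s where s: "s \<in> {r..r+1}" "\<tau> s \<le> 2 * exp (\<eta> / 2 * s) + \<bar>K\<bar>" by blast
      have "\<tau> r \<le> \<tau> s" using mono[of r s] s elim(3) by simp
      moreover have "exp (\<eta> / 2 * s) \<le> exp (\<eta> / 2 * (r + 1))" using s(1) e by simp
      ultimately show ?case using s(2) elim(2) by linarith
    qed
  qed
  interpret unit_growth h \<tau>
    by unfold_locales (rule tau_eq h nonconst sub | assumption)+
  have pos: "\<forall>\<^sub>F r in at_top. 0 < \<tau> r"
  proof -
    obtain k where k: "k > 0" "\<forall>\<^sub>F r in at_top. k * r \<le> \<tau> r" using tau_linear by blast
    from k(2) eventually_gt_at_top[of 0] show ?thesis
    proof eventually_elim
      case (elim r)
      have "0 < k * r" using k(1) elim(2) by simp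
      thus ?case using elim(1) by linarith
    qed
  qed
  obtain F where F: "F \<le> nev" "F \<noteq> bot" "\<And>K. \<forall>\<^sub>F r in F. \<tau> (r + K) \<le> 2 * \<tau> r"
    using doubling_filter[OF mono pos sub] by blast
  interpret unit_filter h \<tau> F by unfold_locales (rule F)+
  \<comment> \<open>Moving \<open>T(c) \<le> T(f) / 2\<close> to the left gives
    \<open>T(f) \<le> 2 \<tau> + 2 T(q) + 2 ln 2\<close>, and the logarithmic rest is below
    \<open>\<tau>\<close> by linear growth.\<close>
  have fle: "\<forall>\<^sub>F r in nev. char_T f r \<le> 3 * \<tau> r"
  proof -
    obtain k where k: "k > 0" "\<forall>\<^sub>F r in at_top. k * r \<le> \<tau> r" using tau_linear by blast
    obtain K' n where K': "\<And>r. r \<ge> 1 \<Longrightarrow> char_T (poly q) r \<le> K' + real n * ln r" using char_T_poly by blast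
    have "\<forall>\<^sub>F r in at_top. 2 * (K' + real n * ln r) + 2 * ln 2 \<le> k * r" using k(1) by real_asymp
    from half nev_at_topI[OF this] nev_at_topI[OF k(2)] nev_at_topI[OF eventually_ge_at_top[of 1]]
    show ?thesis
    proof eventually_elim
      case (elim r)
      have "char_T f r \<le> char_T c r + char_T (poly q) r + \<tau> r + ln 2"
        unfolding tau_eq by (rule char_T_le_unit[OF ef ent(3) h eq]) (use elim in simp)
      moreover define X where "X = K' + real n * ln r"
      hence "char_T (poly q) r \<le> X" "2 * X + 2 * ln 2 \<le> k * r" using K'[OF elim(4)] elim(2) by simp_all
      ultimately show ?case using elim(1,3) by linarith
    qed
  qed
  have nevsmall: "\<forall>\<^sub>F r in nev. char_T u r \<le> \<epsilon> * \<tau> r" if u: "small_fun u f" and e: "\<epsilon> > 0" for u \<epsilon>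
  proof -
    have "\<epsilon> / 3 > 0" using e by simp
    from small_fun_nev[OF u this] fle show ?thesis
    proof eventually_elim
      case (elim r)
      have "\<epsilon> / 3 * char_T f r \<le> \<epsilon> / 3 * (3 * \<tau> r)" using elim(2) e by (intro mult_left_mono) auto
      thus ?case using elim(1) by simp
    qed
  qed
  have tm: "tame u" if u: "entire u" "small_fun u f" for u
  proof (rule tame_of_char_T[OF u(1)])
    fix \<eta> :: real assume e: "\<eta> > 0"
    have "\<forall>\<^sub>F r in nev. char_T u r \<le> 1 * \<tau> r" by (rule nevsmall[OF u(2)]) simp
    thus "\<forall>\<^sub>F r in nev. char_T u r \<le> exp (\<eta> * r)"
      using nev_at_topI[OF sub[OF e]] by eventually_elim simp
  qed
  have sa: "small a" and sb: "small b" and sc: "small c" and sc1: "small (\<lambda>z. c (z + 1))"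
    using small_nev[OF ent(1) tm nevsmall] small_nev[OF ent(2) tm nevsmall] small_nev[OF ent(3) tm nevsmall]
      small_nev_shift[OF ent(3) tm nevsmall] ent sm by blast+
  have sA: "small A" unfolding A_def
    by (intro small_subexp subexp_add subexp_mult subexp_poly subexp_deriv subexp_h h entire_intros)
  have sB: "small B" unfolding B_def
  proof (rule small_mult[OF _ small_unit_difference])
    show "small (\<lambda>z. poly q (z + 1))"
      by (rule small_subexp[OF subexp_shift[OF subexp_poly] entire_shift[OF entire_poly]])
  qed
  have B0: "\<exists>z. B z \<noteq> 0"
  proof -
    obtain w where "poly q w \<noteq> 0" using q poly_all_0_iff_0 by blast
    hence "B (w - 1) \<noteq> 0" by (simp add: B_def)
    thus ?thesis by blast
  qed
  have "Eset {a, b} (deriv f) z = Eset {a, b} (\<lambda>z. f (z + 1)) z" for z using share by (simp add: share_set_CM_def)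
  hence sh: "zmult (\<lambda>w. deriv f w - a w) z + zmult (\<lambda>w. deriv f w - b w) z =
     zmult (\<lambda>w. f (w + 1) - a w) z + zmult (\<lambda>w. f (w + 1) - b w) z" for z
    by (simp only: Eset_two[OF ne])
  have re: "deriv f w - u w = A w * exp (h w) - (u w - deriv c w)" "f (w + 1) - u w = B w * exp (h w) - (u w - c (w + 1))" for w u
    by (simp_all add: deq seq)
  have "\<exists>z. a z - deriv c z \<noteq> b z - deriv c z" using ne by (auto simp: fun_eq_iff)
  from shared_roots[OF sA A0 sB B0 small_diff[OF sa small_deriv[OF sc]] small_diff[OF sb small_deriv[OF sc]]
       small_diff[OF sa sc1] small_diff[OF sb sc1] _ this sh[unfolded re]]
  show ?thesis using subexp_h by simp
qed

theorem theorem4: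
  fixes f a b c :: "complex \<Rightarrow> complex"
  assumes "transcendental_entire f"
    and "hyper_order f < 1"
    and "entire a" and "entire b" and "entire c"
    and "small_fun a f" and "small_fun b f" and "small_fun c f"
    and "finite {z. f z - c z = 0}"
    and "order_of c < order_of f"
    and "a \<noteq> b"
    and "share_set_CM (deriv f) (\<lambda>z. f (z + 1)) {a, b}"
  shows "\<exists>\<gamma> p :: complex. \<gamma> \<noteq> 0 \<and> p \<noteq> 0 \<and> (\<forall>z. f z = c z + p * exp (\<gamma> * z)) \<and>
     ((\<gamma> / exp \<gamma> = 1 \<and> (\<forall>z. c z = 0) \<and> (\<forall>z. deriv f z = f (z + 1))) \<or>
      (\<gamma> / exp \<gamma> = -1 \<and>
       (\<forall>z. deriv (\<lambda>w. f w - c w) z = - (f (z + 1) - c (z + 1))) \<and>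
       (\<forall>z. deriv c z + c (z + 1) = a z + b z)))"
proof -
  have ef: "entire f" using assms(1) by (simp add: transcendental_entire_def)
  have "\<exists>z. f z - c z \<noteq> 0"
    using small_fun_not_polynomial_diff[OF assms(1,5,8)] poly_0 by metis
  then obtain q h where q: "q \<noteq> 0" and h: "entire h" and eq: "\<And>z. f z - c z = poly q z * exp (h z)"
    using finite_zeros_factor[OF entire_diff[OF ef assms(5)] assms(9)] by blast
  have red: "subexp h \<and> ((\<forall>z. poly (pderiv q) z + poly q z * deriv h z = poly q (z + 1) * exp (h (z + 1) - h z) \<and>
        a z - deriv c z = a z - c (z + 1)) \<or>
      (\<forall>z. poly (pderiv q) z + poly q z * deriv h z = - (poly q (z + 1) * exp (h (z + 1) - h z)) \<and>
        a z - deriv c z = - (b z - c (z + 1))))"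
    by (rule shared_set_dichotomy[OF assms(1-8) assms(11,12) q h eq])
  hence sh: "subexp h" by blast
  have form: "\<exists>\<gamma> p. \<gamma> \<noteq> 0 \<and> p \<noteq> 0 \<and> \<gamma> / exp \<gamma> = \<sigma> \<and> (\<forall>z. f z = c z + p * exp (\<gamma> * z))"
    if \<sigma>: "cmod \<sigma> = 1" and e: "\<And>z. poly (pderiv q) z + poly q z * deriv h z = \<sigma> * poly q (z + 1) * exp (h (z + 1) - h z)" for \<sigma>
  proof -
    obtain \<gamma> p0 d where g: "q = [:p0:]" "\<gamma> = \<sigma> * exp \<gamma>" "\<And>z. h z = \<gamma> * z + d"
      using exponent_linear[OF q h sh \<sigma> e] by blast
    have "\<sigma> \<noteq> 0" using \<sigma> by auto
    hence "\<gamma> \<noteq> 0" using g(2) by (metis exp_not_eq_zero mult_eq_0_iff)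
    moreover have "p0 * exp d \<noteq> 0" using q g(1) by simp
    moreover have "\<gamma> / exp \<gamma> = \<sigma>"
    proof -
      have "\<gamma> / exp \<gamma> = (\<sigma> * exp \<gamma>) / exp \<gamma>" using g(2) by (rule arg_cong)
      thus ?thesis by simp
    qed
    moreover have "f z = c z + (p0 * exp d) * exp (\<gamma> * z)" for z
      using eq[of z] by (simp add: g(1,3) exp_add algebra_simps)
    ultimately show ?thesis by blast
  qed
  have df: "deriv f z = deriv c z + p * \<gamma> * exp (\<gamma> * z)" if "\<forall>z. f z = c z + p * exp (\<gamma> * z)" for z \<gamma> p
  proof -
    have "f = (\<lambda>z. c z + p * exp (\<gamma> * z))" using that by auto
    thus ?thesis
      by (simp only:) (rule DERIV_imp_deriv, auto intro!: derivative_eq_intros entire_field_derivative assms(5))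
  qed
  from red show ?thesis
  proof (elim conjE disjE)
    assume *: "\<forall>z. poly (pderiv q) z + poly q z * deriv h z = poly q (z + 1) * exp (h (z + 1) - h z) \<and>
        a z - deriv c z = a z - c (z + 1)"
    hence cc: "deriv c z = c (z + 1)" for z by simp
    obtain \<gamma> p where g: "\<gamma> \<noteq> 0" "p \<noteq> 0" "\<gamma> / exp \<gamma> = 1" "\<forall>z. f z = c z + p * exp (\<gamma> * z)"
      using form[of 1] * by auto
    \<comment> \<open>Now \<open>T(f) \<le> T(c) + O(r)\<close>. Smallness of \<open>c\<close> first
      gives \<open>T(f) = O(r)\<close> and then \<open>T(c) = o(r)\<close>, off an exceptional
      set.\<close>
    have "subexp c"
    proof (rule subexp_of_char_T[OF assms(5)])
      fix \<eta> :: real assume e: "\<eta> > 0"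
      \<comment> \<open>The bound \<open>1 / 2\<close> moves \<open>T(c)\<close> to the left; the
        other makes \<open>\<epsilon> * (2 * ((|\<gamma>| + 1) * r))\<close> at most
        \<open>\<eta> * r / 2\<close>.\<close>
      define \<epsilon> where "\<epsilon> = min (1 / 2) (\<eta> / (4 * (cmod \<gamma> + 1)))"
      have \<epsilon>: "\<epsilon> > 0" "\<epsilon> \<le> 1 / 2" "\<epsilon> * (4 * (cmod \<gamma> + 1)) \<le> \<eta>"
      proof -
        have pos: "4 * (cmod \<gamma> + 1) > 0" by (simp add: add_nonneg_pos)
        show "\<epsilon> > 0" using e pos by (simp add: \<epsilon>_def)
        show "\<epsilon> \<le> 1 / 2" unfolding \<epsilon>_def by (rule min.cobounded1)
        have "\<epsilon> \<le> \<eta> / (4 * (cmod \<gamma> + 1))" unfolding \<epsilon>_def by (rule min.cobounded2)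
        thus "\<epsilon> * (4 * (cmod \<gamma> + 1)) \<le> \<eta>" using pos by (simp only: pos_le_divide_eq)
      qed
      have 1: "\<forall>\<^sub>F r in nev. lnp (cmod p) + ln 2 \<le> 1 * r"
        by (rule nev_at_topI) real_asymp
      show "\<forall>\<^sub>F r in nev. char_T c r \<le> \<eta> * r"
        using small_fun_nev[OF assms(8) \<epsilon>(1)] 1 nev_at_topI[OF eventually_ge_at_top[of 0]]
      proof eventually_elim
        case (elim r)
        have feq: "f = (\<lambda>z. c z + p * exp (\<gamma> * z))" using g(4) by auto
        have epe: "entire (\<lambda>z. p * exp (\<gamma> * z))" unfolding entire_def by (intro holomorphic_intros)
        have "char_T f r \<le> char_T c r + char_T (\<lambda>z. p * exp (\<gamma> * z)) r + ln 2"
          unfolding feq by (rule char_T_add[OF assms(5) epe elim(3)])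
        also have "char_T (\<lambda>z. p * exp (\<gamma> * z)) r \<le> lnp (cmod p) + cmod \<gamma> * r"
        proof (rule char_T_le_sup[OF epe elim(3)])
          fix z assume z: "cmod z = r"
          have "cmod p \<le> exp (lnp (cmod p))" by (rule lnp_le_imp) simp
          moreover have "Re (\<gamma> * z) \<le> cmod \<gamma> * r" using complex_Re_le_cmod[of "\<gamma> * z"] z by (simp add: norm_mult)
          ultimately show "cmod (p * exp (\<gamma> * z)) \<le> exp (lnp (cmod p) + cmod \<gamma> * r)"
            unfolding norm_mult exp_add norm_exp_eq_Re by (intro mult_mono) auto
        qed (use elim(3) in simp)
        finally have "char_T f r \<le> char_T c r + (cmod \<gamma> + 1) * r" using elim(2) by (simp add: algebra_simps)
        moreover have "0 \<le> char_T c r" by (rule char_T_nonneg[OF elim(3) assms(5)])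
        moreover have "0 \<le> char_T f r" by (rule char_T_nonneg[OF elim(3) ef])
        moreover have "\<epsilon> * char_T f r \<le> 1 / 2 * char_T f r" using \<epsilon>(2) calculation(3) by (rule mult_right_mono)
        ultimately have "char_T f r \<le> 2 * ((cmod \<gamma> + 1) * r)" using elim(1) by linarith
        hence "\<epsilon> * char_T f r \<le> \<epsilon> * (2 * ((cmod \<gamma> + 1) * r))" using \<epsilon>(1) by (intro mult_left_mono) auto
        also have "\<dots> = (\<epsilon> * (4 * (cmod \<gamma> + 1))) * r / 2" by simp
        also have "\<dots> \<le> \<eta> * r / 2" using \<epsilon>(3) elim(3) by (intro divide_right_mono mult_right_mono) auto
        also have "\<dots> \<le> \<eta> * r" using e elim(3) by simp
        finally show ?case using elim(1) by linarith
      qed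
    qed
    from derivative_eq_shift_imp_zero[OF assms(5) this cc] have c0: "\<forall>z. c z = 0" by blast
    have "deriv f z = f (z + 1)" for z
    proof -
      have "c = (\<lambda>z. 0)" using c0 by auto
      hence "deriv c z = 0" by simp
      moreover have "\<gamma> * exp (\<gamma> * z) = exp (\<gamma> * (z + 1))"
      proof -
        have "\<gamma> = exp \<gamma>" using g(3) by (simp add: divide_eq_1_iff)
        hence "\<gamma> * exp (\<gamma> * z) = exp \<gamma> * exp (\<gamma> * z)" by (rule arg_cong)
        also have "\<dots> = exp (\<gamma> * (z + 1))" by (simp add: distrib_left exp_add mult.commute)
        finally show ?thesis .
      qed
      ultimately show ?thesis using df[OF g(4), of z] g(4) c0 by simp
    qed
    thus ?thesis using g c0 by blast
  next
    assume *: "\<forall>z. poly (pderiv q) z + poly q z * deriv h z = - (poly q (z + 1) * exp (h (z + 1) - h z)) \<and>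
        a z - deriv c z = - (b z - c (z + 1))"
    have cc: "deriv c z + c (z + 1) = a z + b z" for z
    proof -
      have "a z - deriv c z = - (b z - c (z + 1))" using * by blast
      thus ?thesis by (simp add: algebra_simps)
    qed
    obtain \<gamma> p where g: "\<gamma> \<noteq> 0" "p \<noteq> 0" "\<gamma> / exp \<gamma> = -1" "\<forall>z. f z = c z + p * exp (\<gamma> * z)"
      using form[of "-1"] * by auto
    have "deriv (\<lambda>w. f w - c w) z = - (f (z + 1) - c (z + 1))" for z
    proof -
      have "deriv (\<lambda>w. f w - c w) z = deriv f z - deriv c z"
        by (rule DERIV_imp_deriv[OF DERIV_diff[OF entire_field_derivative[OF ef] entire_field_derivative[OF assms(5)]]])
      also have "\<dots> = p * (\<gamma> * exp (\<gamma> * z))" using df[OF g(4), of z] by simp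
      also have "\<gamma> * exp (\<gamma> * z) = - exp (\<gamma> * (z + 1))"
      proof -
        have "\<gamma> = - exp \<gamma>" using g(3) by (simp add: divide_eq_minus_1_iff)
        hence "\<gamma> * exp (\<gamma> * z) = - exp \<gamma> * exp (\<gamma> * z)" by (rule arg_cong)
        also have "\<dots> = - exp (\<gamma> * (z + 1))" by (simp add: distrib_left exp_add mult.commute)
        finally show ?thesis .
      qed
      finally show ?thesis using g(4) by simp
    qed
    thus ?thesis using g cc by blast
  qed
qed

end
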